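(* Let $M\subset\mathbb{C}^{n+1}$ be a real smooth hypersurface and $p\in M$, and suppose the Levi form at $p$ has $r$ positive and $s$ negative eigenvalues with $r+s<n$. Let $g_{\bar\alpha\beta}=\epsilon_\beta\delta_{\alpha\beta}$ ($\alpha,\beta=1,\dots,n$) where $\epsilon_\beta=1$ for $\beta\le r$, $\epsilon_\beta=-1$ for $r<\beta\le r+s$, $\epsilon_\beta=0$ for $\beta>r+s$, and let $h_{\bar\alpha\bar\beta\gamma}\in\mathbb{C}$ ($\alpha,\beta=1,\dots,n$, $\gamma=r+s+1,\dots,n$) be symmetric in $\alpha,\beta$. Then there exist local holomorphic coordinates $Z=(z,w)\in\mathbb{C}^n\times\mathbb{C}$, vanishing at $p$, in which $M$ is defined near $p$ by $\rho=0$ with $$\rho(Z,\bar Z)=-\operatorname{Im}w+\sum_{\alpha,\beta}g_{\bar\alpha\beta}\bar z^\alpha z^\beta+2\operatorname{Re}\Big(\sum_{\alpha,\beta=1}^n\sum_{\gamma=r+s+1}^n h_{\bar\alpha\bar\beta\gamma}\bar z^\alpha\bar z^\beta z^\gamma\Big)+\tilde R(z,\bar z,\operatorname{Re}w),$$ with $\tilde R$ vanishing to weighted order $4$ at $0$, if and only if there exist a basis $L_{\bar1},\dots,L_{\bar n}$ of CR vector fields near $p$ (with $L_\alpha=\overline{L_{\bar\alpha}}$) and a nonvanishing characteristic form $\theta$ near $p$ such that $\langle\mathcal T_{L_{\bar\alpha}}\theta,L_\beta\rangle_p=g_{\bar\alpha\beta}$ for all $\alpha,\beta$ and $\langle\mathcal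 T_{L_{\bar\alpha}}\mathcal T_{L_{\bar\beta}}\theta,L_\gamma\rangle_p=h_{\bar\alpha\bar\beta\gamma}$ for $\alpha,\beta=1,\dots,n$, $\gamma=r+s+1,\dots,n$.
   Context: CR vector fields: smooth sections of $T^{0,1}M$; characteristic forms: smooth sections of $T^0M$ (real covectors annihilating $T^cM$). $\mathcal T_L\omega=\frac1{2i}L\lrcorner d\omega$; the pairing satisfies $\langle d\omega,Y\wedge Z\rangle=Y\langle\omega,Z\rangle-Z\langle\omega,Y\rangle-\langle\omega,[Y,Z]\rangle$. By Theorem 2.9 these values depend only on the values of the fields at $p$; they are the components of the Levi form (second order tensor) and of the third order tensor. Weighted order: $z,\bar z$ weight one, $\operatorname{Re}w$ weight two. *)

theory Defs
  imports "HOL-Analysis.Analysis"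
begin

type_synonym 'n amb = "(complex ^ 'n) \<times> complex"

definition Jc :: "'n::finite amb \<Rightarrow> 'n amb" where
  "Jc v = ((\<chi> j. \<i> * (fst v $ j)), \<i> * snd v)"

fun dd :: "'a::real_normed_vector list \<Rightarrow> ('a \<Rightarrow> 'b::real_normed_vector) \<Rightarrow> 'a \<Rightarrow> 'b" where
  "dd [] f = f"
| "dd (v # vs) f = (\<lambda>x. vector_derivative (\<lambda>t::real. dd vs f (x + t *\<^sub>R v)) (at 0))"

definition cinf_on :: "'a::real_normed_vector set \<Rightarrow> ('a \<Rightarrow> 'b::real_normed_vector) \<Rightarrow> bool" where
  "cinf_on U f \<longleftrightarrow> open U \<and>
     (\<forall>vs. continuous_on U (dd vs f) \<and>
        (\<forall>v. \<forall>x\<in>U. ((\<lambda>t::real. dd vs f (x + t *\<^sub>R v)) has_vector_derivative dd (v # vs) f x) (at 0)))"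

definition real_hypersurface :: "'a::real_normed_vector set \<Rightarrow> bool" where
  "real_hypersurface M \<longleftrightarrow> (\<forall>q\<in>M. \<exists>U (\<rho>::'a \<Rightarrow> real). q \<in> U \<and> cinf_on U \<rho> \<and>
       (\<forall>x\<in>U. \<exists>v. dd [v] \<rho> x \<noteq> 0) \<and> M \<inter> U = {x\<in>U. \<rho> x = 0})"

definition tangent_vec :: "'a::real_normed_vector set \<Rightarrow> 'a \<Rightarrow> 'a \<Rightarrow> bool" where
  "tangent_vec M x v \<longleftrightarrow> (\<forall>U (f::'a \<Rightarrow> real). x \<in> U \<and> cinf_on U f \<and> (\<forall>y\<in>M \<inter> U. f y = 0)
       \<longrightarrow> dd [v] f x = 0)"

text \<open>A complex vector field A + i B, given by two real vector fields (ambient extensions).\<close>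
type_synonym 'a cvf = "('a \<Rightarrow> 'a) \<times> ('a \<Rightarrow> 'a)"

definition act :: "'a::real_normed_vector cvf \<Rightarrow> ('a \<Rightarrow> complex) \<Rightarrow> 'a \<Rightarrow> complex" where
  "act X f x = dd [fst X x] f x + \<i> * dd [snd X x] f x"

definition rbr :: "('a::real_normed_vector \<Rightarrow> 'a) \<Rightarrow> ('a \<Rightarrow> 'a) \<Rightarrow> 'a \<Rightarrow> 'a" where
  "rbr A B x = dd [A x] B x - dd [B x] A x"

definition br :: "'a::real_normed_vector cvf \<Rightarrow> 'a cvf \<Rightarrow> 'a cvf" where
  "br X Y = ((\<lambda>x. rbr (fst X) (fst Y) x - rbr (snd X) (snd Y) x),
             (\<lambda>x. rbr (fst X) (snd Y) x + rbr (snd X) (fst Y) x))"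

definition cnjv :: "'a::real_normed_vector cvf \<Rightarrow> 'a cvf" where
  "cnjv X = (fst X, (\<lambda>x. - snd X x))"

text \<open>A (complex) one-form, seen through its pairing with complex vector fields.\<close>
type_synonym 'a cform = "'a cvf \<Rightarrow> 'a \<Rightarrow> complex"

definition thform :: "('a::real_inner \<Rightarrow> 'a) \<Rightarrow> 'a cform" where
  "thform c X x = Complex (c x \<bullet> fst X x) (c x \<bullet> snd X x)"

text \<open>T_L omega = (1/2i) L _| d omega, via the invariant formula for d.\<close>
definition Top :: "'a::real_normed_vector cvf \<Rightarrow> 'a cform \<Rightarrow> 'a cform" where
  "Top L \<omega> X x = (act L (\<omega> X) x - act X (\<omega> L) x - \<omega> (br L X) x) / (2 * \<i>)"

definition cscal :: "complex \<Rightarrow> 'a::real_vector \<times> 'a \<Rightarrow> 'a \<times> 'a" where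
  "cscal c ab = (Re c *\<^sub>R fst ab - Im c *\<^sub>R snd ab, Im c *\<^sub>R fst ab + Re c *\<^sub>R snd ab)"

text \<open>Smooth section of T^{0,1}M on M \<inter> U (with a smooth ambient extension on U).\<close>
definition CR_field :: "'n::finite amb set \<Rightarrow> 'n amb set \<Rightarrow> 'n amb cvf \<Rightarrow> bool" where
  "CR_field M U L \<longleftrightarrow> cinf_on U (fst L) \<and> cinf_on U (snd L) \<and>
     (\<forall>x\<in>M \<inter> U. snd L x = Jc (fst L x) \<and> tangent_vec M x (fst L x) \<and> tangent_vec M x (Jc (fst L x)))"

definition CR_basis :: "'n::finite amb set \<Rightarrow> 'n amb set \<Rightarrow> ('n \<Rightarrow> 'n amb cvf) \<Rightarrow> bool" where
  "CR_basis M U Lb \<longleftrightarrow> (\<forall>\<alpha>. CR_field M U (Lb \<alpha>)) \<and>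
     (\<forall>x\<in>M \<inter> U.
        (\<forall>c::'n \<Rightarrow> complex. (\<Sum>\<alpha>\<in>UNIV. cscal (c \<alpha>) (fst (Lb \<alpha>) x, snd (Lb \<alpha>) x)) = (0, 0)
            \<longrightarrow> (\<forall>\<alpha>. c \<alpha> = 0)) \<and>
        (\<forall>a. tangent_vec M x a \<and> tangent_vec M x (Jc a) \<longrightarrow>
            (\<exists>c::'n \<Rightarrow> complex. (\<Sum>\<alpha>\<in>UNIV. cscal (c \<alpha>) (fst (Lb \<alpha>) x, snd (Lb \<alpha>) x)) = (a, Jc a))))"

definition char_form :: "'n::finite amb set \<Rightarrow> 'n amb set \<Rightarrow> ('n amb \<Rightarrow> 'n amb) \<Rightarrow> bool" where
  "char_form M U c \<longleftrightarrow> cinf_on U c \<and>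
     (\<forall>x\<in>M \<inter> U. (\<forall>v. tangent_vec M x v \<and> tangent_vec M x (Jc v) \<longrightarrow> c x \<bullet> v = 0) \<and>
                 (\<exists>v. tangent_vec M x v \<and> c x \<bullet> v \<noteq> 0))"

definition unitary_mat :: "('n::finite \<Rightarrow> 'n \<Rightarrow> complex) \<Rightarrow> bool" where
  "unitary_mat U \<longleftrightarrow> (\<forall>i j. (\<Sum>k\<in>UNIV. cnj (U k i) * U k j) = (if i = j then 1 else 0))"

definition herm_inertia :: "('n::finite \<Rightarrow> 'n \<Rightarrow> complex) \<Rightarrow> nat \<Rightarrow> nat \<Rightarrow> bool" where
  "herm_inertia A r s \<longleftrightarrow> (\<exists>U (d::'n \<Rightarrow> real). unitary_mat U \<and>
      (\<forall>i j. A i j = (\<Sum>k\<in>UNIV. U i k * complex_of_real (d k) * cnj (U j k))) \<and>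
      card {k. d k > 0} = r \<and> card {k. d k < 0} = s)"

definition holo_on :: "'n::finite amb set \<Rightarrow> ('n amb \<Rightarrow> 'n amb) \<Rightarrow> bool" where
  "holo_on U \<Phi> \<longleftrightarrow> open U \<and>
     (\<forall>x\<in>U. \<exists>D. (\<Phi> has_derivative D) (at x) \<and> (\<forall>v. D (Jc v) = Jc (D v)))"

definition hol_coords :: "'n::finite amb set \<Rightarrow> ('n amb \<Rightarrow> 'n amb) \<Rightarrow> bool" where
  "hol_coords U \<Phi> \<longleftrightarrow> holo_on U \<Phi> \<and> inj_on \<Phi> U \<and> open (\<Phi> ` U) \<and>
     (\<exists>\<Psi>. holo_on (\<Phi> ` U) \<Psi> \<and> (\<forall>x\<in>U. \<Psi> (\<Phi> x) = x))"

text \<open>Indices 1..n are the elements of a finite linearly ordered type; pos gives the 1-based position.\<close>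
definition pos :: "'n::{finite,linorder} \<Rightarrow> nat" where
  "pos b = card {a. a \<le> b}"

definition eps :: "nat \<Rightarrow> nat \<Rightarrow> 'n::{finite,linorder} \<Rightarrow> complex" where
  "eps r s b = (if pos b \<le> r then 1 else if pos b \<le> r + s then -1 else 0)"

definition gmat :: "nat \<Rightarrow> nat \<Rightarrow> 'n::{finite,linorder} \<Rightarrow> 'n \<Rightarrow> complex" where
  "gmat r s \<alpha> \<beta> = (if \<alpha> = \<beta> then eps r s \<beta> else 0)"

text \<open>Weights: z-directions weight 1, Re w direction weight 2.\<close>
definition wt :: "(complex ^ 'n::finite) \<times> real \<Rightarrow> nat" where
  "wt v = (if snd v = 0 then 1 else 2)"

definition weighted_vanish4 :: "((complex ^ 'n::finite) \<times> real \<Rightarrow> real) \<Rightarrow> bool" where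
  "weighted_vanish4 R \<longleftrightarrow> (\<exists>U. 0 \<in> U \<and> cinf_on U R \<and>
     (\<forall>vs. set vs \<subseteq> Basis \<and> sum_list (map wt vs) < 4 \<longrightarrow> dd vs R 0 = 0))"

definition rho_model :: "nat \<Rightarrow> nat \<Rightarrow> ('n::{finite,linorder} \<Rightarrow> 'n \<Rightarrow> 'n \<Rightarrow> complex)
     \<Rightarrow> ((complex ^ 'n::{finite,linorder}) \<times> real \<Rightarrow> real) \<Rightarrow> ('n::{finite,linorder}) amb \<Rightarrow> real" where
  "rho_model r s h R Z = (let z = fst Z; w = snd Z in
      - Im w
      + Re (\<Sum>\<alpha>\<in>UNIV. \<Sum>\<beta>\<in>UNIV. gmat r s \<alpha> \<beta> * cnj (z $ \<alpha>) * z $ \<beta>)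
      + 2 * Re (\<Sum>\<alpha>\<in>UNIV. \<Sum>\<beta>\<in>UNIV. \<Sum>\<gamma>\<in>{\<gamma>. r + s < pos \<gamma>}.
                   h \<alpha> \<beta> \<gamma> * cnj (z $ \<alpha>) * cnj (z $ \<beta>) * z $ \<gamma>)
      + R (z, Re w))"

end

theory Submission
  imports Defs "HOL-Complex_Analysis.Cauchy_Integral_Formula" "HOL-Library.Landau_Symbols"
begin

text \<open>
  Let \<open>\<rho>\<close> be a local defining function. On the tangent spaces of \<open>M\<close> a characteristic form is a multiple
  \<open>\<lambda>\<close> of \<open>d\<rho> \<circ> J\<close>, and differentiating the tangency relations \<open>d\<rho> (L) = 0\<close> along \<open>M\<close> turns the
  Levi form into \<open>\<lambda> D\<^sup>2\<rho> (L, L'\<^sup>*)\<close>, where \<open>L'\<^sup>*\<close> is the conjugate of \<open>L'\<close>. If \<open>D\<^sup>2\<rho>\<close> at \<open>p\<close> pairs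
  the conjugate of \<open>L''\<close> trivially with all vectors of type (0,1), then all derivatives of the fields cancel in
  the third order tensor, and it equals \<open>\<lambda> / (2 \<i>) D\<^sup>3\<rho> (L, L', L''\<^sup>*)\<close>. These expressions only see the
  differential of a holomorphic change of coordinates, so for a hypersurface in the form of the theorem they can be
  read off the model: it yields the tensors of every frame with the right values at \<open>p\<close>.

  This proves the implication from coordinates to frames. Conversely, a linear change of coordinates adapts the
  frame and the form at \<open>p\<close>. In these coordinates \<open>M\<close> is a graph over \<open>(z, Re w)\<close>, and a polynomial change removes
  from its weighted Taylor expansion all terms of order at most three except \<open>g\<close> and some terms \<open>h'\<close> along the
  null directions. By the first part \<open>h'\<close> is the third order tensor of the given frame, that is, \<open>h' = h\<close>.
\<close>

subsection \<open>Smooth functions\<close>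

lemma dd_append: "dd (vs @ ws) f = dd vs (dd ws f)"
  by (induction vs) auto

declare dd.simps(2) [simp del]

lemma dd_Cons: "dd (v # vs) f = dd [v] (dd vs f)"
  by (simp add: dd.simps(2))

lemma has_vector_derivative_imp_dd:
  "((\<lambda>t::real. f (x + t *\<^sub>R v)) has_vector_derivative d) (at 0) \<Longrightarrow> dd [v] f x = d"
  by (simp add: dd.simps(2) vector_derivative_at)

lemma eventually_line_mem:
  fixes x v :: "'a::real_normed_vector"
  assumes "open U" "x \<in> U"
  shows "\<forall>\<^sub>F t::real in nhds 0. x + t *\<^sub>R v \<in> U"
proof -
  have "((\<lambda>t::real. x + t *\<^sub>R v) \<longlongrightarrow> x + 0 *\<^sub>R v) (nhds 0)"
    by (intro tendsto_intros filterlim_ident)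
  then show ?thesis
    using assms by (auto dest: topological_tendstoD)
qed

lemma has_vector_derivative_along_line_cong:
  fixes f g :: "'a::real_normed_vector \<Rightarrow> 'b::real_normed_vector"
  assumes "open U" "x \<in> U" and eq: "\<And>y. y \<in> U \<Longrightarrow> f y = g y"
    and der: "((\<lambda>t::real. f (x + t *\<^sub>R v)) has_vector_derivative d) (at 0)"
  shows "((\<lambda>t::real. g (x + t *\<^sub>R v)) has_vector_derivative d) (at 0)"
proof -
  have "\<forall>\<^sub>F t in nhds 0. t \<in> UNIV \<longrightarrow> f (x + t *\<^sub>R v) = g (x + t *\<^sub>R v)"
    using eventually_line_mem[OF assms(1,2), of v] by eventually_elim (use eq in auto)
  then show ?thesis
    using der eq[OF assms(2)] by (subst (asm) has_vector_derivative_cong_ev) auto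
qed

lemma dd_cong:
  assumes "open U" "\<And>x. x \<in> U \<Longrightarrow> f x = g x" "x \<in> U"
  shows "dd vs f x = dd vs g x"
  using assms(3)
proof (induction vs arbitrary: x)
  case Nil
  then show ?case using assms(2) by simp
next
  case (Cons v vs)
  have "\<forall>\<^sub>F t in nhds 0. t \<in> UNIV \<longrightarrow> dd vs f (x + t *\<^sub>R v) = dd vs g (x + t *\<^sub>R v)"
    using eventually_line_mem[OF assms(1) Cons.prems, of v] by eventually_elim (use Cons.IH in auto)
  then show ?case
    by (simp add: vector_derivative_cong_eq dd.simps(2))
qed

lemma cinf_on_open: "cinf_on U f \<Longrightarrow> open U"
  by (simp add: cinf_on_def)

lemma cinf_on_deriv:
  "cinf_on U f \<Longrightarrow> x \<in> U \<Longrightarrow> ((\<lambda>t::real. dd vs f (x + t *\<^sub>R v)) has_vector_derivative dd (v # vs) f x) (at 0)"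
  unfolding cinf_on_def by blast

lemma cinf_on_continuous_dd: "cinf_on U f \<Longrightarrow> continuous_on U (dd vs f)"
  unfolding cinf_on_def by blast

lemma cinf_on_continuous: "cinf_on U f \<Longrightarrow> continuous_on U f"
  using cinf_on_continuous_dd[of U f "[]"] by simp

lemma cinf_on_dd:
  assumes "cinf_on U f"
  shows "cinf_on U (dd ws f)"
  unfolding cinf_on_def
proof (intro conjI allI ballI)
  show "open U" using assms by (rule cinf_on_open)
  fix vs
  show "continuous_on U (dd vs (dd ws f))"
    using cinf_on_continuous_dd[OF assms, of "vs @ ws"] by (simp add: dd_append)
  fix v x
  assume "x \<in> U"
  then show "((\<lambda>t. dd vs (dd ws f) (x + t *\<^sub>R v)) has_vector_derivative dd (v # vs) (dd ws f) x) (at 0)"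
    using cinf_on_deriv[OF assms, of x "vs @ ws" v] by (simp add: dd_append flip: append_Cons)
qed

lemma cinf_on_subset:
  assumes "cinf_on U f" "open V" "V \<subseteq> U"
  shows "cinf_on V f"
  using assms unfolding cinf_on_def by (meson continuous_on_subset subsetD)

lemma cinf_on_cong:
  assumes f: "cinf_on U f" and eq: "\<And>x. x \<in> U \<Longrightarrow> f x = g x"
  shows "cinf_on U g"
  unfolding cinf_on_def
proof (intro conjI allI ballI)
  show "open U" using f by (rule cinf_on_open)
  fix vs
  have dd_eq: "dd vs f x = dd vs g x" if "x \<in> U" for x vs
    using \<open>open U\<close> eq that by (rule dd_cong)
  then show "continuous_on U (dd vs g)"
    using cinf_on_continuous_dd[OF f, of vs] by (simp cong: continuous_on_cong)
  fix v x
  assume x: "x \<in> U"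
  have "((\<lambda>t. dd vs g (x + t *\<^sub>R v)) has_vector_derivative dd (v # vs) f x) (at 0)"
    using \<open>open U\<close> x dd_eq cinf_on_deriv[OF f x]
    by (rule has_vector_derivative_along_line_cong)
  then show "((\<lambda>t. dd vs g (x + t *\<^sub>R v)) has_vector_derivative dd (v # vs) g x) (at 0)"
    using dd_eq[OF x] by simp
qed

lemma dd_closed_class:
  fixes f :: "'a::real_normed_vector \<Rightarrow> 'b::real_normed_vector"
  assumes "open U" "P f"
    and step: "\<And>g v. P g \<Longrightarrow> \<exists>g'. P g' \<and>
      (\<forall>x\<in>U. ((\<lambda>t::real. g (x + t *\<^sub>R v)) has_vector_derivative g' x) (at 0))"
  shows "\<exists>g. P g \<and> (\<forall>x\<in>U. dd vs f x = g x)"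
proof (induction vs)
  case Nil
  then show ?case using assms(2) by auto
next
  case (Cons v vs)
  then obtain g where g: "P g" "\<forall>x\<in>U. dd vs f x = g x" by blast
  obtain g' where g': "P g'" "\<forall>x\<in>U. ((\<lambda>t::real. g (x + t *\<^sub>R v)) has_vector_derivative g' x) (at 0)"
    using step[OF g(1)] by blast
  have "dd (v # vs) f x = g' x" if "x \<in> U" for x
  proof -
    have "dd (v # vs) f x = dd [v] (dd vs f) x" by (simp add: dd_Cons[of v vs])
    also have "\<dots> = dd [v] g x"
      by (rule dd_cong[OF assms(1)]) (use g that in auto)
    also have "\<dots> = g' x"
      using g'(2) that by (auto intro: has_vector_derivative_imp_dd)
    finally show ?thesis .
  qed
  then show ?case using g'(1) by blast
qed

lemma cinf_on_coinduct:
  fixes f :: "'a::real_normed_vector \<Rightarrow> 'b::real_normed_vector"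
  assumes U: "open U" and f: "P f"
    and cont: "\<And>g. P g \<Longrightarrow> continuous_on U g"
    and step: "\<And>g v. P g \<Longrightarrow> \<exists>g'. P g' \<and>
      (\<forall>x\<in>U. ((\<lambda>t::real. g (x + t *\<^sub>R v)) has_vector_derivative g' x) (at 0))"
  shows "cinf_on U f"
  unfolding cinf_on_def
proof (intro conjI allI ballI)
  show "open U" by (rule U)
  fix vs
  obtain g where g: "P g" "\<forall>x\<in>U. dd vs f x = g x"
    using dd_closed_class[of U P f vs, OF U f step] by blast
  show "continuous_on U (dd vs f)"
    using cont[OF g(1)] g(2) by (simp cong: continuous_on_cong)
  fix v x
  assume x: "x \<in> U"
  obtain g' where g': "\<forall>x\<in>U. ((\<lambda>t::real. g (x + t *\<^sub>R v)) has_vector_derivative g' x) (at 0)"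
    using step[OF g(1)] by blast
  have der: "((\<lambda>t. dd vs f (x + t *\<^sub>R v)) has_vector_derivative g' x) (at 0)"
    by (rule has_vector_derivative_along_line_cong[OF U x, of g]) (simp_all add: g(2) g' x)
  then show "((\<lambda>t. dd vs f (x + t *\<^sub>R v)) has_vector_derivative dd (v # vs) f x) (at 0)"
    using has_vector_derivative_imp_dd[OF der] by (simp add: dd_Cons[of v vs])
qed

lemma cinf_on_line_derivative:
  assumes f: "cinf_on U f" and mem: "y + t *\<^sub>R v \<in> U"
  shows "((\<lambda>s. dd vs f (y + s *\<^sub>R v)) has_vector_derivative dd (v # vs) f (y + t *\<^sub>R v)) (at t)"
proof -
  have "((\<lambda>r. dd vs f ((y + t *\<^sub>R v) + r *\<^sub>R v)) has_vector_derivative dd (v # vs) f (y + t *\<^sub>R v)) (at (t - t))"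
    using cinf_on_deriv[OF f mem, of vs v] by simp
  then have "(((\<lambda>r. dd vs f ((y + t *\<^sub>R v) + r *\<^sub>R v)) \<circ> (\<lambda>s. s - t)) has_vector_derivative
       1 *\<^sub>R dd (v # vs) f (y + t *\<^sub>R v)) (at t)"
    by (intro vector_diff_chain_at) (auto intro!: derivative_eq_intros)
  then show ?thesis by (simp add: o_def algebra_simps)
qed

subsection \<open>Continuous directional derivatives give total derivatives\<close>

lemma line_increment_bound:
  fixes f :: "'a::real_normed_vector \<Rightarrow> 'b::real_normed_vector"
  assumes f: "cinf_on U f"
    and near: "\<And>t. \<bar>t\<bar> \<le> \<bar>a\<bar> \<Longrightarrow> y + t *\<^sub>R v \<in> U \<and> norm (dd [v] f (y + t *\<^sub>R v) - d) \<le> e"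
  shows "norm (f (y + a *\<^sub>R v) - f y - a *\<^sub>R d) \<le> e * \<bar>a\<bar>"
proof -
  let ?I = "closed_segment 0 a"
  have seg: "\<bar>t\<bar> \<le> \<bar>a\<bar>" if "t \<in> ?I" for t
    using that by (auto simp: closed_segment_eq_real_ivl split: if_splits)
  have "norm ((f (y + a *\<^sub>R v) - a *\<^sub>R d) - (f (y + 0 *\<^sub>R v) - 0 *\<^sub>R d)) \<le> e * norm (a - 0)"
  proof (rule differentiable_bound[OF convex_closed_segment])
    fix t assume t: "t \<in> ?I"
    have "((\<lambda>s. f (y + s *\<^sub>R v)) has_vector_derivative dd [v] f (y + t *\<^sub>R v)) (at t)"
      using cinf_on_line_derivative[OF f, of y t v "[]"] near[OF seg[OF t]] by simp
    then have "((\<lambda>s. f (y + s *\<^sub>R v)) has_derivative (\<lambda>s. s *\<^sub>R dd [v] f (y + t *\<^sub>R v))) (at t within ?I)"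
      using has_vector_derivative_def has_derivative_at_withinI by blast
    then show "((\<lambda>t. f (y + t *\<^sub>R v) - t *\<^sub>R d) has_derivative (\<lambda>s. s *\<^sub>R (dd [v] f (y + t *\<^sub>R v) - d)))
        (at t within ?I)"
      by (auto intro!: derivative_eq_intros simp: algebra_simps)
    have "0 \<le> e"
      using order_trans[OF norm_ge_zero conjunct2[OF near[of 0]]] by simp
    then show "onorm (\<lambda>s. s *\<^sub>R (dd [v] f (y + t *\<^sub>R v) - d)) \<le> e"
      using near[OF seg[OF t]] by (intro onorm_bound) (auto simp: mult.commute[of e] mult_left_mono)
  qed auto
  then show ?thesis by (simp add: algebra_simps)
qed

lemma cinf_on_line_increment:
  fixes f :: "'a::real_normed_vector \<Rightarrow> 'b::real_normed_vector"
  assumes f: "cinf_on U f" and x: "x \<in> U" and e: "0 < e"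
  obtains r where "0 < r"
    "\<And>y a. dist y x + norm (a *\<^sub>R v) < r \<Longrightarrow> norm (f (y + a *\<^sub>R v) - f y - a *\<^sub>R dd [v] f x) \<le> e * \<bar>a\<bar>"
proof -
  have "isCont (dd [v] f) x"
    using cinf_on_continuous_dd[OF f] cinf_on_open[OF f] x by (simp add: continuous_on_eq_continuous_at)
  then obtain r\<^sub>1 where r\<^sub>1: "r\<^sub>1 > 0" "\<And>y. dist y x < r\<^sub>1 \<Longrightarrow> dist (dd [v] f y) (dd [v] f x) < e"
    using e unfolding continuous_at_eps_delta by blast
  obtain r\<^sub>2 where r\<^sub>2: "r\<^sub>2 > 0" "ball x r\<^sub>2 \<subseteq> U"
    using cinf_on_open[OF f] x by (meson open_contains_ball)
  show ?thesis
  proof (rule that[of "min r\<^sub>1 r\<^sub>2"])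
    fix y a assume small: "dist y x + norm (a *\<^sub>R v) < min r\<^sub>1 r\<^sub>2"
    have near: "dist (y + t *\<^sub>R v) x < min r\<^sub>1 r\<^sub>2" if "\<bar>t\<bar> \<le> \<bar>a\<bar>" for t
    proof -
      have "dist (y + t *\<^sub>R v) x \<le> dist y x + norm (t *\<^sub>R v)"
        using norm_triangle_ineq[of "y - x" "t *\<^sub>R v"] by (simp add: dist_norm algebra_simps)
      also have "\<dots> \<le> dist y x + norm (a *\<^sub>R v)" using that by (simp add: mult_right_mono)
      finally show ?thesis using small by simp
    qed
    show "norm (f (y + a *\<^sub>R v) - f y - a *\<^sub>R dd [v] f x) \<le> e * \<bar>a\<bar>"
    proof (rule line_increment_bound[OF f], rule conjI)
      fix t assume t: "\<bar>t\<bar> \<le> \<bar>a\<bar>"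
      show "y + t *\<^sub>R v \<in> U" using near[OF t] r\<^sub>2(2) by (auto simp: dist_commute)
      show "norm (dd [v] f (y + t *\<^sub>R v) - dd [v] f x) \<le> e"
        using near[OF t] r\<^sub>1(2)[of "y + t *\<^sub>R v"] by (simp add: dist_norm)
    qed
  qed (use r\<^sub>1 r\<^sub>2 in simp)
qed

lemma cinf_on_partial_increment:
  fixes f :: "'a::euclidean_space \<Rightarrow> 'b::real_normed_vector"
  assumes f: "cinf_on U f" and x: "x \<in> U" and "finite S" "S \<subseteq> Basis" "0 < e"
  shows "\<forall>\<^sub>F h in nhds 0.
     norm (f (x + (\<Sum>b\<in>S. (h \<bullet> b) *\<^sub>R b)) - f x - (\<Sum>b\<in>S. (h \<bullet> b) *\<^sub>R dd [b] f x)) \<le> e * norm h"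
  using assms(3,4,5)
proof (induction S arbitrary: e rule: finite_induct)
  case empty
  then show ?case by simp
next
  case (insert b S)
  define y where "y h = x + (\<Sum>b\<in>S. (h \<bullet> b) *\<^sub>R b)" for h
  obtain r where r: "0 < r" "\<And>y a. dist y x + norm (a *\<^sub>R b) < r \<Longrightarrow>
      norm (f (y + a *\<^sub>R b) - f y - a *\<^sub>R dd [b] f x) \<le> e / 2 * \<bar>a\<bar>"
    using cinf_on_line_increment[OF f x half_gt_zero[OF insert.prems(2)], of b] by blast
  have "((\<lambda>h. dist (y h) x + norm ((h \<bullet> b) *\<^sub>R b)) \<longlongrightarrow> dist (y 0) x + norm ((0 \<bullet> b) *\<^sub>R b)) (nhds 0)"
    unfolding y_def by (intro tendsto_intros filterlim_ident)
  then have small: "\<forall>\<^sub>F h in nhds 0. dist (y h) x + norm ((h \<bullet> b) *\<^sub>R b) < r"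
    using r(1) by (intro order_tendstoD) (auto simp: y_def)
  have "\<forall>\<^sub>F h in nhds 0. norm (f (y h) - f x - (\<Sum>b\<in>S. (h \<bullet> b) *\<^sub>R dd [b] f x)) \<le> e / 2 * norm h"
    using insert.IH[of "e / 2"] insert.prems by (simp add: y_def)
  with small show ?case
  proof eventually_elim
    case (elim h)
    have "e / 2 * \<bar>h \<bullet> b\<bar> \<le> e / 2 * norm h"
      using insert.prems Basis_le_norm[of b h] by (intro mult_left_mono) auto
    with r(2)[OF elim(1)] have "norm (f (y h + (h \<bullet> b) *\<^sub>R b) - f (y h) - (h \<bullet> b) *\<^sub>R dd [b] f x) \<le> e / 2 * norm h"
      by (rule order_trans)
    from norm_triangle_le[OF add_mono[OF this elim(2)]] insert.hyps show ?case
      by (simp add: y_def algebra_simps)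
  qed
qed

lemma has_derivative_along_line:
  fixes x v :: "'a::real_normed_vector"
  assumes "(f has_derivative f') (at x)"
  shows "((\<lambda>t::real. f (x + t *\<^sub>R v)) has_vector_derivative f' v) (at 0)"
proof -
  have "((\<lambda>t::real. x + t *\<^sub>R v) has_derivative (\<lambda>t. t *\<^sub>R v)) (at 0)"
    by (auto intro!: derivative_eq_intros)
  moreover have "(f has_derivative f') (at (x + 0 *\<^sub>R v))"
    using assms by simp
  ultimately have "((\<lambda>t::real. f (x + t *\<^sub>R v)) has_derivative (\<lambda>t. f' (t *\<^sub>R v))) (at 0)"
    by (rule has_derivative_compose)
  then show ?thesis
    using has_derivative_bounded_linear[OF assms]
    by (simp add: has_vector_derivative_def linear_simps)
qed

lemma has_derivative_imp_dd: "(f has_derivative f') (at x) \<Longrightarrow> dd [v] f x = f' v"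
  by (rule has_vector_derivative_imp_dd[OF has_derivative_along_line])

lemma cinf_on_has_derivative:
  fixes f :: "'a::euclidean_space \<Rightarrow> 'b::real_normed_vector"
  assumes f: "cinf_on U f" and x: "x \<in> U"
  shows "(f has_derivative (\<lambda>v. dd [v] f x)) (at x)"
proof -
  let ?D = "\<lambda>h. \<Sum>b\<in>Basis. (h \<bullet> b) *\<^sub>R dd [b] f x"
  have D: "(f has_derivative ?D) (at x)"
    unfolding has_derivative_at_alt
  proof (intro conjI allI impI)
    show "bounded_linear ?D"
      by (intro bounded_linear_sum bounded_linear_scaleR_const bounded_linear_inner_left)
    fix e :: real assume "e > 0"
    from cinf_on_partial_increment[OF f x finite_Basis order_refl this]
    obtain d where d: "d > 0" "\<And>h. norm h < d \<Longrightarrow> norm (f (x + h) - f x - ?D h) \<le> e * norm h"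
      unfolding eventually_nhds_metric by (auto simp: euclidean_representation)
    show "\<exists>d>0. \<forall>y. norm (y - x) < d \<longrightarrow> norm (f y - f x - ?D (y - x)) \<le> e * norm (y - x)"
      using d(1) d(2)[of "y - x" for y] by (intro exI[of _ d]) simp
  qed
  then have "(\<lambda>v. dd [v] f x) = ?D" by (auto intro: has_derivative_imp_dd)
  then show ?thesis using D by simp
qed

lemma linear_basis_expand:
  fixes L :: "'a::euclidean_space \<Rightarrow> 'b::real_vector"
  assumes "linear L"
  shows "L w = (\<Sum>b\<in>Basis. (w \<bullet> b) *\<^sub>R L b)"
proof -
  interpret linear L by fact
  show ?thesis by (subst euclidean_representation[of w, symmetric]) (simp only: sum scale)
qed

lemma linear_dd:
  fixes f :: "'a::euclidean_space \<Rightarrow> 'b::real_normed_vector"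
  shows "cinf_on U f \<Longrightarrow> x \<in> U \<Longrightarrow> linear (\<lambda>v. dd [v] f x)"
  using cinf_on_has_derivative has_derivative_linear by blast

subsection \<open>Closure properties of smooth functions\<close>

lemma dd_const: "dd [v] (\<lambda>x. c) = (\<lambda>x. 0)"
  by (rule ext, rule has_derivative_imp_dd) (rule has_derivative_const)

lemma dd_ident: "dd [v] (\<lambda>x. x) x = v"
  by (rule has_derivative_imp_dd) (rule has_derivative_ident)

lemma cinf_on_const: "open U \<Longrightarrow> cinf_on U (\<lambda>x. c)"
  by (rule cinf_on_coinduct[where P="\<lambda>f. \<exists>c. f = (\<lambda>x. c)"])
     (auto intro!: derivative_eq_intros exI[of _ "\<lambda>x. 0"])

lemma dd_bounded_linear_apply:
  fixes f :: "'a::real_normed_vector \<Rightarrow> 'b::real_normed_vector"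
  assumes f: "cinf_on U f" and l: "bounded_linear l"
  shows "x \<in> U \<Longrightarrow> dd vs (\<lambda>x. l (f x)) x = l (dd vs f x)"
proof (induction vs arbitrary: x)
  case Nil
  then show ?case by simp
next
  case (Cons v vs)
  have "dd (v # vs) (\<lambda>x. l (f x)) x = dd [v] (dd vs (\<lambda>x. l (f x))) x" by (simp add: dd_Cons[of v vs])
  also have "\<dots> = dd [v] (\<lambda>x. l (dd vs f x)) x"
    by (rule dd_cong[OF cinf_on_open[OF f]]) (use Cons in auto)
  also have "\<dots> = l (dd (v # vs) f x)"
    by (rule has_vector_derivative_imp_dd, rule bounded_linear.has_vector_derivative[OF l
        cinf_on_deriv[OF f Cons.prems]])
  finally show ?case .
qed

lemma cinf_on_bounded_linear_apply:
  fixes f :: "'a::real_normed_vector \<Rightarrow> 'b::real_normed_vector"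
  assumes f: "cinf_on U f" and l: "bounded_linear l"
  shows "cinf_on U (\<lambda>x. l (f x))"
proof (rule cinf_on_coinduct[where P="\<lambda>h. \<exists>g. cinf_on U g \<and> h = (\<lambda>x. l (g x))"])
  show "open U" using f by (rule cinf_on_open)
  show "\<exists>g. cinf_on U g \<and> (\<lambda>x. l (f x)) = (\<lambda>x. l (g x))" using f by blast
  fix h assume "\<exists>g. cinf_on U g \<and> h = (\<lambda>x. l (g x))"
  then obtain g where g: "cinf_on U g" "h = (\<lambda>x. l (g x))" by blast
  show "continuous_on U h"
    unfolding g(2) by (intro bounded_linear.continuous_on[OF l] cinf_on_continuous g)
  fix v
  show "\<exists>g'. (\<exists>g. cinf_on U g \<and> g' = (\<lambda>x. l (g x))) \<and>
      (\<forall>x\<in>U. ((\<lambda>t. h (x + t *\<^sub>R v)) has_vector_derivative g' x) (at 0))"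
    using bounded_linear.has_vector_derivative[OF l cinf_on_deriv[OF g(1), of _ "[]" v]] cinf_on_dd[OF g(1)]
    unfolding g(2) by (intro exI[of _ "\<lambda>x. l (dd [v] g x)"]) auto
qed

inductive sum_of_products :: "('b::real_normed_vector \<Rightarrow> 'c::real_normed_vector \<Rightarrow> 'd::real_normed_vector) \<Rightarrow>
    'a::real_normed_vector set \<Rightarrow> ('a \<Rightarrow> 'd) \<Rightarrow> bool"
  for B U where
  product: "cinf_on U f \<Longrightarrow> cinf_on U g \<Longrightarrow> sum_of_products B U (\<lambda>x. B (f x) (g x))"
| add: "sum_of_products B U f \<Longrightarrow> sum_of_products B U g \<Longrightarrow> sum_of_products B U (\<lambda>x. f x + g x)"

lemma cinf_on_bilinear:
  assumes B: "bounded_bilinear B" and f: "cinf_on U f" and g: "cinf_on U g"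
  shows "cinf_on U (\<lambda>x. B (f x) (g x))"
proof (rule cinf_on_coinduct[where P="sum_of_products B U"])
  show "open U" using f by (rule cinf_on_open)
  show "sum_of_products B U (\<lambda>x. B (f x) (g x))" using f g by (rule sum_of_products.product)
  fix h assume "sum_of_products B U h"
  then show "continuous_on U h"
    by induction (auto intro!: bounded_bilinear.continuous_on[OF B] continuous_on_add intro: cinf_on_continuous)
next
  fix h v assume "sum_of_products B U h"
  then show "\<exists>h'. sum_of_products B U h' \<and> (\<forall>x\<in>U. ((\<lambda>t. h (x + t *\<^sub>R v)) has_vector_derivative h' x) (at 0))"
  proof induction
    case (product f g)
    have "sum_of_products B U (\<lambda>x. B (f x) (dd [v] g x) + B (dd [v] f x) (g x))"
      using product by (intro sum_of_products.intros cinf_on_dd)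
    moreover have "((\<lambda>t. B (f (x + t *\<^sub>R v)) (g (x + t *\<^sub>R v))) has_vector_derivative
        B (f x) (dd [v] g x) + B (dd [v] f x) (g x)) (at 0)" if "x \<in> U" for x
      using bounded_bilinear.has_vector_derivative[OF B
          cinf_on_deriv[OF product(1) that, of "[]" v] cinf_on_deriv[OF product(2) that, of "[]" v]]
      by simp
    ultimately show ?case by blast
  next
    case (add f g)
    then obtain f' g' where "sum_of_products B U f'" "\<forall>x\<in>U. ((\<lambda>t. f (x + t *\<^sub>R v)) has_vector_derivative f' x) (at 0)"
       "sum_of_products B U g'" "\<forall>x\<in>U. ((\<lambda>t. g (x + t *\<^sub>R v)) has_vector_derivative g' x) (at 0)"
      by blast
    then show ?case
      by (intro exI[of _ "\<lambda>x. f' x + g' x"]) (auto intro!: sum_of_products.add has_vector_derivative_add)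
  qed
qed

lemma cinf_on_scaleR: "cinf_on U a \<Longrightarrow> cinf_on U f \<Longrightarrow> cinf_on U (\<lambda>x. a x *\<^sub>R f x)"
  by (rule cinf_on_bilinear[OF bounded_bilinear_scaleR])

lemma cinf_on_mult:
  fixes f g :: "'a::real_normed_vector \<Rightarrow> 'b::real_normed_algebra"
  shows "cinf_on U f \<Longrightarrow> cinf_on U g \<Longrightarrow> cinf_on U (\<lambda>x. f x * g x)"
  by (rule cinf_on_bilinear[OF bounded_bilinear_mult])

lemma cinf_on_inner: "cinf_on U f \<Longrightarrow> cinf_on U g \<Longrightarrow> cinf_on U (\<lambda>x. f x \<bullet> g x)"
  by (rule cinf_on_bilinear[OF bounded_bilinear_inner])

lemma cinf_on_add:
  fixes f g :: "'a::real_normed_vector \<Rightarrow> 'b::real_normed_vector"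
  assumes f: "cinf_on U f" and g: "cinf_on U g"
  shows "cinf_on U (\<lambda>x. f x + g x)"
proof (rule cinf_on_coinduct[where P="\<lambda>h. \<exists>f g. cinf_on U f \<and> cinf_on U g \<and> h = (\<lambda>x. f x + g x)"])
  show "open U" using f by (rule cinf_on_open)
  show "\<exists>f' g'. cinf_on U f' \<and> cinf_on U g' \<and> (\<lambda>x. f x + g x) = (\<lambda>x. f' x + g' x)" using f g by blast
  fix h assume "\<exists>f g. cinf_on U f \<and> cinf_on U g \<and> h = (\<lambda>x. f x + g x)"
  then obtain f g where h: "cinf_on U f" "cinf_on U g" "h = (\<lambda>x. f x + g x)" by blast
  show "continuous_on U h" unfolding h(3) by (intro continuous_on_add cinf_on_continuous h)
  fix v
  show "\<exists>g'. (\<exists>f g. cinf_on U f \<and> cinf_on U g \<and> g' = (\<lambda>x. f x + g x)) \<and>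
      (\<forall>x\<in>U. ((\<lambda>t. h (x + t *\<^sub>R v)) has_vector_derivative g' x) (at 0))"
    using has_vector_derivative_add[OF cinf_on_deriv[OF h(1), of _ "[]" v] cinf_on_deriv[OF h(2), of _ "[]" v]]
      cinf_on_dd[OF h(1)] cinf_on_dd[OF h(2)]
    unfolding h(3) by (intro exI[of _ "\<lambda>x. dd [v] f x + dd [v] g x"] conjI exI[of _ "dd [v] f"]
        exI[of _ "dd [v] g"]) auto
qed

lemma cinf_on_minus: "cinf_on U f \<Longrightarrow> cinf_on U (\<lambda>x. - f x)"
  by (rule cinf_on_bounded_linear_apply[OF _ bounded_linear_minus[OF bounded_linear_ident]])

lemma cinf_on_diff: "cinf_on U f \<Longrightarrow> cinf_on U g \<Longrightarrow> cinf_on U (\<lambda>x. f x - g x)"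
  using cinf_on_add[OF _ cinf_on_minus] by force

lemma cinf_on_sum:
  assumes "open U" "\<And>i. i \<in> I \<Longrightarrow> cinf_on U (f i)"
  shows "cinf_on U (\<lambda>x. \<Sum>i\<in>I. f i x)"
  using assms(2)
  by (induction I rule: infinite_finite_induct) (auto intro!: cinf_on_const cinf_on_add assms(1))

lemma cinf_on_ident: "open U \<Longrightarrow> cinf_on U (\<lambda>x. x)"
proof (rule cinf_on_coinduct[where P="\<lambda>f. f = (\<lambda>x. x) \<or> (\<exists>c. f = (\<lambda>x. c))"])
  fix g :: "'a \<Rightarrow> 'a" and v
  assume "g = (\<lambda>x. x) \<or> (\<exists>c. g = (\<lambda>x. c))"
  then show "\<exists>g'. (g' = (\<lambda>x. x) \<or> (\<exists>c. g' = (\<lambda>x. c))) \<and>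
      (\<forall>x\<in>U. ((\<lambda>t. g (x + t *\<^sub>R v)) has_vector_derivative g' x) (at 0))"
  proof
    assume "g = (\<lambda>x. x)"
    then show ?thesis
      by (intro exI[of _ "\<lambda>x. v"]) (auto intro!: derivative_eq_intros)
  next
    assume "\<exists>c. g = (\<lambda>x. c)"
    then show ?thesis
      by (intro exI[of _ "\<lambda>x. 0"]) (auto intro!: derivative_eq_intros)
  qed
qed auto

lemma cinf_on_linear:
  fixes l :: "'a::euclidean_space \<Rightarrow> 'b::real_normed_vector"
  assumes "open U" "linear l"
  shows "cinf_on U l"
  using cinf_on_bounded_linear_apply[OF cinf_on_ident[OF assms(1)]
      linear_conv_bounded_linear[THEN iffD1, OF assms(2)]] .

lemma cinf_on_Pair:
  assumes "cinf_on U f" "cinf_on U g"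
  shows "cinf_on U (\<lambda>x. (f x, g x))"
proof -
  have "cinf_on U (\<lambda>x. (f x, 0) + (0, g x))"
    by (intro cinf_on_add cinf_on_bounded_linear_apply[OF assms(1)] cinf_on_bounded_linear_apply[OF assms(2)]
        bounded_linear_Pair bounded_linear_ident bounded_linear_zero)
  then show ?thesis by simp
qed

lemma cinf_on_vec_lambda:
  fixes f :: "'i::finite \<Rightarrow> 'a::real_normed_vector \<Rightarrow> 'b::euclidean_space"
  assumes "open U" "\<And>j. cinf_on U (f j)"
  shows "cinf_on U (\<lambda>x. \<chi> j. f j x)"
proof -
  have "linear (axis j :: 'b \<Rightarrow> 'b ^ 'i)" for j
    by (rule linearI) (auto simp: axis_def vec_eq_iff)
  then have "cinf_on U (\<lambda>x. \<Sum>j\<in>UNIV. axis j (f j x))"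
    by (intro cinf_on_sum assms(1) cinf_on_bounded_linear_apply[OF assms(2)]) (simp add: linear_conv_bounded_linear)
  then show ?thesis
    by (rule cinf_on_cong) (simp add: vec_eq_iff axis_def if_distrib[of "\<lambda>f. f _"] sum.delta cong: if_cong)
qed

lemma dd_add:
  fixes f g :: "'a::real_normed_vector \<Rightarrow> 'b::real_normed_vector"
  assumes f: "cinf_on U f" and g: "cinf_on U g"
  shows "x \<in> U \<Longrightarrow> dd vs (\<lambda>x. f x + g x) x = dd vs f x + dd vs g x"
proof (induction vs arbitrary: x)
  case Nil
  then show ?case by simp
next
  case (Cons v vs)
  have "dd (v # vs) (\<lambda>x. f x + g x) x = dd [v] (dd vs (\<lambda>x. f x + g x)) x" by (simp add: dd_Cons[of v vs])
  also have "\<dots> = dd [v] (\<lambda>x. dd vs f x + dd vs g x) x"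
    by (rule dd_cong[OF cinf_on_open[OF f]]) (use Cons in auto)
  also have "\<dots> = dd (v # vs) f x + dd (v # vs) g x"
    by (rule has_vector_derivative_imp_dd,
        rule has_vector_derivative_add[OF cinf_on_deriv[OF f Cons.prems] cinf_on_deriv[OF g Cons.prems]])
  finally show ?case .
qed

lemma dd_mult:
  fixes f g :: "'a::real_normed_vector \<Rightarrow> 'b::real_normed_algebra"
  assumes f: "cinf_on U f" and g: "cinf_on U g" and x: "x \<in> U"
  shows "dd [v] (\<lambda>y. f y * g y) x = f x * dd [v] g x + dd [v] f x * g x"
  using has_vector_derivative_mult[OF cinf_on_deriv[OF f x, of "[]" v] cinf_on_deriv[OF g x, of "[]" v]]
  by (intro has_vector_derivative_imp_dd) simp

lemma cinf_on_real_inverse: "cinf_on (- {0}) (inverse :: real \<Rightarrow> real)"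
proof (rule cinf_on_coinduct[where P="\<lambda>f. \<exists>c k. f = (\<lambda>x. c * inverse x ^ k)"])
  show "\<exists>c k. (inverse :: real \<Rightarrow> real) = (\<lambda>x. c * inverse x ^ k)"
    by (intro exI[of _ 1]) auto
  fix g :: "real \<Rightarrow> real" assume "\<exists>c k. g = (\<lambda>x. c * inverse x ^ k)"
  then obtain c k where g: "g = (\<lambda>x. c * inverse x ^ k)" by blast
  show "continuous_on (- {0}) g" unfolding g by (intro continuous_intros) auto
  fix v :: real
  have "((\<lambda>t. g (x + t *\<^sub>R v)) has_vector_derivative (- c * of_nat k * v) * inverse x ^ Suc k) (at 0)"
    if "x \<in> - {0}" for x
  proof (cases k)
    case 0
    then show ?thesis by (simp add: g)
  next
    case (Suc m)
    have "((\<lambda>y. c * inverse y ^ k) has_real_derivative - c * of_nat k * inverse x ^ Suc k) (at x)"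
      using that DERIV_cmult[OF DERIV_power[OF DERIV_inverse, of x k UNIV], of c] Suc
      by (simp add: mult_ac power_inverse)
    then have "((\<lambda>y. c * inverse y ^ k) has_derivative (\<lambda>h. h * (- c * of_nat k * inverse x ^ Suc k))) (at x)"
      unfolding has_field_derivative_def by (rule has_derivative_eq_rhs) (auto simp: mult.commute)
    from has_derivative_along_line[OF this, of v] show ?thesis
      by (simp add: g mult_ac)
  qed
  then show "\<exists>g'. (\<exists>c k. g' = (\<lambda>x. c * inverse x ^ k)) \<and>
      (\<forall>x\<in>- {0}. ((\<lambda>t. g (x + t *\<^sub>R v)) has_vector_derivative g' x) (at 0))"
    by blast
qed auto

lemma
  fixes m :: "'b::euclidean_space \<Rightarrow> 'c::real_normed_vector" and P :: "'a::real_normed_vector \<Rightarrow> 'b"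
  assumes m: "cinf_on W m" and P: "cinf_on U P" and sub: "\<And>x. x \<in> U \<Longrightarrow> P x \<in> W" and x: "x \<in> U"
  shows dd_compose: "dd [v] (\<lambda>y. m (P y)) x = dd [dd [v] P x] m (P x)"
    and has_vector_derivative_compose_along_line:
      "((\<lambda>t. m (P (x + t *\<^sub>R v))) has_vector_derivative dd [dd [v] P x] m (P x)) (at 0)"
proof -
  have "((\<lambda>t. P (x + t *\<^sub>R v)) has_derivative (\<lambda>t. t *\<^sub>R dd [v] P x)) (at 0)"
    using cinf_on_deriv[OF P x, of "[]" v] by (simp add: has_vector_derivative_def)
  moreover have "(m has_derivative (\<lambda>w. dd [w] m (P x))) (at (P (x + 0 *\<^sub>R v)))"
    using cinf_on_has_derivative[OF m sub[OF x]] by simp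
  ultimately have "((\<lambda>t. m (P (x + t *\<^sub>R v))) has_derivative (\<lambda>t. dd [t *\<^sub>R dd [v] P x] m (P x))) (at 0)"
    by (rule has_derivative_compose)
  then show "((\<lambda>t. m (P (x + t *\<^sub>R v))) has_vector_derivative dd [dd [v] P x] m (P x)) (at 0)"
    by (simp add: has_vector_derivative_def linear_scale[OF linear_dd[OF m sub[OF x]]])
  then show "dd [v] (\<lambda>y. m (P y)) x = dd [dd [v] P x] m (P x)"
    by (rule has_vector_derivative_imp_dd)
qed

inductive sum_of_compositions :: "('a::real_normed_vector \<Rightarrow> 'b::real_normed_vector) \<Rightarrow> 'a set \<Rightarrow> 'b set \<Rightarrow>
    ('a \<Rightarrow> 'c::real_normed_vector) \<Rightarrow> bool"
  for f U V where
  compose: "cinf_on V h \<Longrightarrow> sum_of_compositions f U V (\<lambda>x. h (f x))"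
| scale: "cinf_on U a \<Longrightarrow> sum_of_compositions f U V g \<Longrightarrow> sum_of_compositions f U V (\<lambda>x. a x *\<^sub>R g x)"
| add: "sum_of_compositions f U V g \<Longrightarrow> sum_of_compositions f U V h \<Longrightarrow> sum_of_compositions f U V (\<lambda>x. g x + h x)"

lemma sum_of_compositions_sum:
  fixes g :: "'i \<Rightarrow> 'a::real_normed_vector \<Rightarrow> 'c::real_normed_vector"
  assumes "open V" "finite I" "\<And>i. i \<in> I \<Longrightarrow> sum_of_compositions f U V (g i)"
  shows "sum_of_compositions f U V (\<lambda>x. \<Sum>i\<in>I. g i x)"
  using assms(2,3)
proof (induction I rule: finite_induct)
  case empty
  show ?case
    using sum_of_compositions.compose[OF cinf_on_const[OF assms(1)], of f U "0::'c"] by simp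
qed (auto intro: sum_of_compositions.add)

lemma sum_of_compositions_deriv:
  fixes f :: "'a::real_normed_vector \<Rightarrow> 'b::euclidean_space" and g :: "'a \<Rightarrow> 'c::real_normed_vector"
  assumes f: "cinf_on U f" and sub: "\<And>x. x \<in> U \<Longrightarrow> f x \<in> V" and g: "sum_of_compositions f U V g"
  shows "\<exists>g'. sum_of_compositions f U V g' \<and> (\<forall>x\<in>U. ((\<lambda>t. g (x + t *\<^sub>R v)) has_vector_derivative g' x) (at 0))"
  using g
proof induction
  case (compose h)
  let ?g' = "\<lambda>x. \<Sum>b\<in>Basis. (dd [v] f x \<bullet> b) *\<^sub>R dd [b] h (f x)"
  have "sum_of_compositions f U V ?g'"
    by (intro sum_of_compositions_sum[OF cinf_on_open[OF compose]] sum_of_compositions.scale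
        sum_of_compositions.compose cinf_on_dd[OF compose]
        cinf_on_bounded_linear_apply[OF cinf_on_dd[OF f] bounded_linear_inner_left]) auto
  moreover have "((\<lambda>t. h (f (x + t *\<^sub>R v))) has_vector_derivative ?g' x) (at 0)" if x: "x \<in> U" for x
    using has_vector_derivative_compose_along_line[OF compose f sub x]
    by (simp flip: linear_basis_expand[OF linear_dd[OF compose sub[OF x]]])
  ultimately show ?case by blast
next
  case (scale a g)
  then obtain g' where g': "sum_of_compositions f U V g'"
    "\<forall>x\<in>U. ((\<lambda>t. g (x + t *\<^sub>R v)) has_vector_derivative g' x) (at 0)"
    by blast
  have "sum_of_compositions f U V (\<lambda>x. a x *\<^sub>R g' x + dd [v] a x *\<^sub>R g x)"
    using scale g' by (intro sum_of_compositions.intros cinf_on_dd)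
  moreover have "((\<lambda>t. a (x + t *\<^sub>R v) *\<^sub>R g (x + t *\<^sub>R v)) has_vector_derivative
      a x *\<^sub>R g' x + dd [v] a x *\<^sub>R g x) (at 0)" if "x \<in> U" for x
    using bounded_bilinear.has_vector_derivative[OF bounded_bilinear_scaleR
        cinf_on_deriv[OF scale(1) that, of "[]" v], of "\<lambda>t. g (x + t *\<^sub>R v)" "g' x"] g' that
    by simp
  ultimately show ?case by blast
next
  case (add g h)
  then obtain g' h' where "sum_of_compositions f U V g'"
      "\<forall>x\<in>U. ((\<lambda>t. g (x + t *\<^sub>R v)) has_vector_derivative g' x) (at 0)"
     "sum_of_compositions f U V h'" "\<forall>x\<in>U. ((\<lambda>t. h (x + t *\<^sub>R v)) has_vector_derivative h' x) (at 0)"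
    by blast
  then show ?case
    by (intro exI[of _ "\<lambda>x. g' x + h' x"]) (auto intro!: sum_of_compositions.add has_vector_derivative_add)
qed

lemma cinf_on_compose:
  fixes f :: "'a::real_normed_vector \<Rightarrow> 'b::euclidean_space" and h :: "'b \<Rightarrow> 'c::real_normed_vector"
  assumes h: "cinf_on V h" and f: "cinf_on U f" and sub: "\<And>x. x \<in> U \<Longrightarrow> f x \<in> V"
  shows "cinf_on U (\<lambda>x. h (f x))"
proof (rule cinf_on_coinduct[where P="sum_of_compositions f U V"])
  show "open U" using f by (rule cinf_on_open)
  show "sum_of_compositions f U V (\<lambda>x. h (f x))" using h by (rule sum_of_compositions.compose)
  fix g :: "'a \<Rightarrow> 'c" assume g: "sum_of_compositions f U V g"
  then show "continuous_on U g"
  proof induction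
    case (compose h)
    show ?case
      by (rule continuous_on_compose2[OF cinf_on_continuous[OF compose] cinf_on_continuous[OF f]]) (use sub in auto)
  qed (auto intro!: continuous_on_scaleR continuous_on_add intro: cinf_on_continuous)
  show "\<exists>g'. sum_of_compositions f U V g' \<and> (\<forall>x\<in>U. ((\<lambda>t. g (x + t *\<^sub>R v)) has_vector_derivative g' x) (at 0))" for v
    using f sub g by (rule sum_of_compositions_deriv)
qed

lemma cinf_on_divide:
  fixes f g :: "'a::real_normed_vector \<Rightarrow> real"
  assumes "cinf_on U f" "cinf_on U g" "\<And>x. x \<in> U \<Longrightarrow> g x \<noteq> 0"
  shows "cinf_on U (\<lambda>x. f x / g x)"
  unfolding divide_inverse
  by (intro cinf_on_mult assms(1) cinf_on_compose[OF cinf_on_real_inverse assms(2)]) (use assms(3) in auto)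

subsection \<open>Higher derivatives as symmetric multilinear forms\<close>

lemma linear_dd_slot:
  fixes f :: "'a::euclidean_space \<Rightarrow> 'b::real_normed_vector"
  assumes f: "cinf_on U f" and x: "x \<in> U"
  shows "linear (\<lambda>v. dd (us @ v # ws) f x)"
proof -
  note U = cinf_on_open[OF f] and smooth = cinf_on_dd[OF f]
  have split: "dd (us @ v # ws) f x = dd us (dd [v] (dd ws f)) x" for v
    by (simp add: dd_append dd_Cons[of v ws])
  have lin: "linear (\<lambda>v. dd [v] (dd ws f) y)" if "y \<in> U" for y
    by (rule linear_dd[OF smooth that])
  show ?thesis
    unfolding split
  proof (rule linearI)
    fix v w
    have "dd us (dd [v + w] (dd ws f)) x = dd us (\<lambda>y. dd [v] (dd ws f) y + dd [w] (dd ws f) y) x"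
      by (rule dd_cong[OF U _ x]) (rule linear_add[OF lin])
    also have "\<dots> = dd us (dd [v] (dd ws f)) x + dd us (dd [w] (dd ws f)) x"
      by (rule dd_add[OF cinf_on_dd[OF smooth] cinf_on_dd[OF smooth] x])
    finally show "dd us (dd [v + w] (dd ws f)) x = dd us (dd [v] (dd ws f)) x + dd us (dd [w] (dd ws f)) x" .
  next
    fix r :: real and v
    have "dd us (dd [r *\<^sub>R v] (dd ws f)) x = dd us (\<lambda>y. r *\<^sub>R dd [v] (dd ws f) y) x"
      by (rule dd_cong[OF U _ x]) (rule linear_scale[OF lin])
    also have "\<dots> = r *\<^sub>R dd us (dd [v] (dd ws f)) x"
      by (rule dd_bounded_linear_apply[OF cinf_on_dd[OF smooth] bounded_linear_scaleR_right x])
    finally show "dd us (dd [r *\<^sub>R v] (dd ws f)) x = r *\<^sub>R dd us (dd [v] (dd ws f)) x" .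
  qed
qed

definition trilinear ::
    "('a::real_vector \<Rightarrow> 'b::real_vector \<Rightarrow> 'c::real_vector \<Rightarrow> 'd::real_vector) \<Rightarrow> bool" where
  "trilinear T \<longleftrightarrow> (\<forall>v w. linear (\<lambda>u. T u v w)) \<and> (\<forall>u w. linear (\<lambda>v. T u v w)) \<and> (\<forall>u v. linear (\<lambda>w. T u v w))"

lemma bilinearD:
  assumes "bilinear B"
  shows "linear (\<lambda>u. B u v)" "linear (\<lambda>v. B u v)"
  using assms by (auto simp: bilinear_def)

lemma trilinearD:
  assumes "trilinear T"
  shows "linear (\<lambda>u. T u v w)" "linear (\<lambda>v. T u v w)" "linear (\<lambda>w. T u v w)"
  using assms by (auto simp: trilinear_def)

lemma bilinear_dd2:
  fixes f :: "'a::euclidean_space \<Rightarrow> 'b::real_normed_vector"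
  assumes "cinf_on U f" "x \<in> U"
  shows "bilinear (\<lambda>u v. dd [u, v] f x)"
  unfolding bilinear_def
  using linear_dd_slot[OF assms, of "[]"] linear_dd_slot[OF assms, of "[_]"] by simp

lemma trilinear_dd3:
  fixes f :: "'a::euclidean_space \<Rightarrow> 'b::real_normed_vector"
  assumes "cinf_on U f" "x \<in> U"
  shows "trilinear (\<lambda>u v w. dd [u, v, w] f x)"
  unfolding trilinear_def
  using linear_dd_slot[OF assms, of "[]"] linear_dd_slot[OF assms, of "[_]"] linear_dd_slot[OF assms, of "[_, _]"]
  by simp

lemma second_difference_mean_value:
  fixes f :: "'a::real_normed_vector \<Rightarrow> real"
  assumes f: "cinf_on U f" and "h > 0"
    and sub: "\<And>s t. 0 \<le> s \<Longrightarrow> s \<le> h \<Longrightarrow> 0 \<le> t \<Longrightarrow> t \<le> h \<Longrightarrow> x + s *\<^sub>R u + t *\<^sub>R v \<in> U"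
  shows "\<exists>s t. 0 < s \<and> s < h \<and> 0 < t \<and> t < h \<and>
    f (x + h *\<^sub>R u + h *\<^sub>R v) - f (x + h *\<^sub>R u) - f (x + h *\<^sub>R v) + f x =
      h * h * dd [v, u] f (x + s *\<^sub>R u + t *\<^sub>R v)"
proof -
  have line: "((\<lambda>s. dd vs f (y + s *\<^sub>R w)) has_real_derivative dd (w # vs) f (y + s *\<^sub>R w)) (at s)"
    if "y + s *\<^sub>R w \<in> U" for y w s vs
    using cinf_on_line_derivative[OF f that] by (simp add: has_real_derivative_iff_has_vector_derivative)
  let ?p = "\<lambda>s. f (x + h *\<^sub>R v + s *\<^sub>R u) - f (x + s *\<^sub>R u)"
  have "\<exists>s>0. s < h \<and> ?p h - ?p 0 = (h - 0) * (dd [u] f (x + h *\<^sub>R v + s *\<^sub>R u) - dd [u] f (x + s *\<^sub>R u))"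
  proof (rule MVT2[OF \<open>h > 0\<close>])
    fix s assume s: "0 \<le> s" "s \<le> h"
    have "x + h *\<^sub>R v + s *\<^sub>R u \<in> U" "x + s *\<^sub>R u \<in> U"
      using sub[OF s, of h] sub[OF s, of 0] \<open>h > 0\<close> by (auto simp: algebra_simps)
    then show "(?p has_real_derivative dd [u] f (x + h *\<^sub>R v + s *\<^sub>R u) - dd [u] f (x + s *\<^sub>R u)) (at s)"
      using line[of _ s u "[]"] by (auto intro: DERIV_diff)
  qed
  then obtain s where s: "0 < s" "s < h" "?p h - ?p 0 =
      h * (dd [u] f (x + h *\<^sub>R v + s *\<^sub>R u) - dd [u] f (x + s *\<^sub>R u))"
    by auto
  let ?q = "\<lambda>t. dd [u] f (x + s *\<^sub>R u + t *\<^sub>R v)"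
  have "\<exists>t>0. t < h \<and> ?q h - ?q 0 = (h - 0) * dd [v, u] f (x + s *\<^sub>R u + t *\<^sub>R v)"
    by (rule MVT2[OF \<open>h > 0\<close>]) (use s in \<open>auto intro!: line sub\<close>)
  then obtain t where t: "0 < t" "t < h" "?q h - ?q 0 = h * dd [v, u] f (x + s *\<^sub>R u + t *\<^sub>R v)"
    by auto
  have "f (x + h *\<^sub>R u + h *\<^sub>R v) - f (x + h *\<^sub>R u) - f (x + h *\<^sub>R v) + f x = ?p h - ?p 0"
    by (simp add: algebra_simps)
  also have "\<dots> = h * (?q h - ?q 0)"
    using s(3) by (simp add: algebra_simps)
  also have "\<dots> =
      h * h * dd [v, u] f (x + s *\<^sub>R u + t *\<^sub>R v)"
    unfolding t(3) by simp
  finally show ?thesis using s t by blast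
qed

lemma second_difference_tendsto:
  fixes f :: "'a::real_normed_vector \<Rightarrow> real"
  assumes f: "cinf_on U f" and x: "x \<in> U"
  shows "((\<lambda>h. (f (x + h *\<^sub>R u + h *\<^sub>R v) - f (x + h *\<^sub>R u) - f (x + h *\<^sub>R v) + f x) / (h * h)) \<longlongrightarrow> dd [v, u] f x)
     (at_right 0)"
    (is "(?quotient \<longlongrightarrow> _) _")
proof (rule tendstoI)
  fix e :: real assume "e > 0"
  have "isCont (dd [v, u] f) x"
    using cinf_on_continuous_dd[OF f] cinf_on_open[OF f] x by (simp add: continuous_on_eq_continuous_at)
  then obtain r\<^sub>1 where r\<^sub>1: "r\<^sub>1 > 0" "\<And>y. dist y x < r\<^sub>1 \<Longrightarrow> dist (dd [v, u] f y) (dd [v, u] f x) < e"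
    using \<open>e > 0\<close> unfolding continuous_at_eps_delta by blast
  obtain r\<^sub>2 where r\<^sub>2: "r\<^sub>2 > 0" "ball x r\<^sub>2 \<subseteq> U"
    using cinf_on_open[OF f] x by (meson open_contains_ball)
  have "((\<lambda>h. h * norm u + h * norm v) \<longlongrightarrow> 0 * norm u + 0 * norm v) (at_right 0)"
    by (intro tendsto_intros)
  then have "\<forall>\<^sub>F h in at_right 0. h * norm u + h * norm v < min r\<^sub>1 r\<^sub>2"
    using r\<^sub>1 r\<^sub>2 by (intro order_tendstoD) auto
  then show "\<forall>\<^sub>F h in at_right 0. dist (?quotient h) (dd [v, u] f x) < e"
    using eventually_at_right_less[of "0::real"]
  proof eventually_elim
    case (elim h)
    have near: "dist (x + s *\<^sub>R u + t *\<^sub>R v) x < min r\<^sub>1 r\<^sub>2" if "0 \<le> s" "s \<le> h" "0 \<le> t" "t \<le> h" for s t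
    proof -
      have "dist (x + s *\<^sub>R u + t *\<^sub>R v) x \<le> norm (s *\<^sub>R u) + norm (t *\<^sub>R v)"
        by (metis add.assoc add_diff_cancel_left' dist_norm norm_triangle_ineq)
      also have "\<dots> \<le> h * norm u + h * norm v"
        using that by (intro add_mono) (auto intro: mult_right_mono)
      finally show ?thesis using elim(1) by simp
    qed
    have "\<exists>s t. 0 < s \<and> s < h \<and> 0 < t \<and> t < h \<and>
      f (x + h *\<^sub>R u + h *\<^sub>R v) - f (x + h *\<^sub>R u) - f (x + h *\<^sub>R v) + f x =
      h * h * dd [v, u] f (x + s *\<^sub>R u + t *\<^sub>R v)"
      by (rule second_difference_mean_value[OF f elim(2)]) (use near r\<^sub>2 in \<open>force simp: dist_commute\<close>)
    then show ?case using elim(2) r\<^sub>1(2) near by (fastforce simp: less_imp_le)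
  qed
qed

lemma dd_swap_real:
  fixes f :: "'a::real_normed_vector \<Rightarrow> real"
  assumes f: "cinf_on U f" and x: "x \<in> U"
  shows "dd [u, v] f x = dd [v, u] f x"
proof (rule tendsto_unique[OF _ second_difference_tendsto[OF f x]])
  show "((\<lambda>h. (f (x + h *\<^sub>R v + h *\<^sub>R u) - f (x + h *\<^sub>R v) - f (x + h *\<^sub>R u) + f x) / (h * h)) \<longlongrightarrow> dd [v, u] f x)
      (at_right 0)"
    using second_difference_tendsto[OF f x, of u v] by (simp add: algebra_simps)
qed simp

lemma dd_swap:
  fixes f :: "'a::real_normed_vector \<Rightarrow> 'b::euclidean_space"
  assumes f: "cinf_on U f" and x: "x \<in> U"
  shows "dd [u, v] f x = dd [v, u] f x"
proof (rule euclidean_eqI)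
  fix b :: 'b
  note inner = bounded_linear_inner_left[of b]
  show "dd [u, v] f x \<bullet> b = dd [v, u] f x \<bullet> b"
    using dd_bounded_linear_apply[OF f inner x, of "[u,v]"] dd_bounded_linear_apply[OF f inner x, of "[v,u]"]
      dd_swap_real[OF cinf_on_bounded_linear_apply[OF f inner] x, of u v]
    by simp
qed

lemma dd3_swap:
  fixes f :: "'a::real_normed_vector \<Rightarrow> 'b::euclidean_space"
  assumes f: "cinf_on U f" and x: "x \<in> U"
  shows "dd [u, v, w] f x = dd [v, u, w] f x" "dd [u, v, w] f x = dd [u, w, v] f x"
proof -
  have split: "dd [u, v, w] f = dd [u, v] (dd [w] f)" "dd [u, v, w] f = dd [u] (dd [v, w] f)" for u v w
    by (simp_all add: dd.simps(2))
  show "dd [u, v, w] f x = dd [v, u, w] f x"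
    unfolding split(1) by (rule dd_swap[OF cinf_on_dd[OF f] x])
  show "dd [u, v, w] f x = dd [u, w, v] f x"
    unfolding split(2) by (rule dd_cong[OF cinf_on_open[OF f] dd_swap[OF f] x])
qed

lemma
  fixes T :: "'b::euclidean_space \<Rightarrow> 'a::euclidean_space \<Rightarrow> 'c::real_normed_vector"
  assumes T: "\<And>w. cinf_on U (T w)" and lin: "\<And>y. y \<in> U \<Longrightarrow> linear (\<lambda>w. T w y)" and A: "cinf_on U A"
  shows cinf_on_linear_family: "cinf_on U (\<lambda>y. T (A y) y)"
    and dd_linear_family: "x \<in> U \<Longrightarrow> dd [v] (\<lambda>y. T (A y) y) x = dd [v] (T (A x)) x + T (dd [v] A x) x"
proof -
  note U = cinf_on_open[OF A]
  have "cinf_on U (\<lambda>y. \<Sum>b\<in>Basis. (A y \<bullet> b) *\<^sub>R T b y)"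
    by (intro cinf_on_sum U cinf_on_scaleR T cinf_on_bounded_linear_apply[OF A bounded_linear_inner_left])
  then show "cinf_on U (\<lambda>y. T (A y) y)"
    by (rule cinf_on_cong) (rule linear_basis_expand[OF lin, symmetric])
  assume x: "x \<in> U"
  have expand: "dd [v] (\<lambda>y. T (B y) y) x = (\<Sum>b\<in>Basis. (B x \<bullet> b) *\<^sub>R dd [v] (T b) x) + T (dd [v] B x) x"
    if B: "cinf_on U B" for B
  proof -
    have "dd [v] (\<lambda>y. T (B y) y) x = dd [v] (\<lambda>y. \<Sum>b\<in>Basis. (B y \<bullet> b) *\<^sub>R T b y) x"
      by (rule dd_cong[OF U linear_basis_expand[OF lin] x])
    also have "\<dots> = (\<Sum>b\<in>Basis. (B x \<bullet> b) *\<^sub>R dd [v] (T b) x + (dd [v] B x \<bullet> b) *\<^sub>R T b x)"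
      by (rule has_derivative_imp_dd)
        (auto intro!: derivative_eq_intros cinf_on_has_derivative[OF B x] cinf_on_has_derivative[OF T x])
    finally show ?thesis by (simp add: sum.distrib flip: linear_basis_expand[OF lin[OF x]])
  qed
  show "dd [v] (\<lambda>y. T (A y) y) x = dd [v] (T (A x)) x + T (dd [v] A x) x"
    using expand[OF A] expand[OF cinf_on_const[OF U], of "A x"] by (simp add: dd_const linear_0[OF lin[OF x]])
qed

lemma
  fixes m :: "'b::euclidean_space \<Rightarrow> 'c::real_normed_vector" and P A B :: "'a::euclidean_space \<Rightarrow> 'b"
  assumes m: "cinf_on W m" and P: "cinf_on U P" and A: "cinf_on U A"
    and sub: "\<And>x. x \<in> U \<Longrightarrow> P x \<in> W"
  shows cinf_on_dd_compose: "cinf_on U (\<lambda>y. dd [A y] m (P y))"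
    and dd_dd_compose: "x \<in> U \<Longrightarrow>
      dd [v] (\<lambda>y. dd [A y] m (P y)) x = dd [dd [v] P x, A x] m (P x) + dd [dd [v] A x] m (P x)"
proof -
  note family = cinf_on_compose[OF cinf_on_dd[OF m] P sub] linear_dd[OF m sub] A
  show "cinf_on U (\<lambda>y. dd [A y] m (P y))"
    by (rule cinf_on_linear_family[OF family])
  assume x: "x \<in> U"
  show "dd [v] (\<lambda>y. dd [A y] m (P y)) x = dd [dd [v] P x, A x] m (P x) + dd [dd [v] A x] m (P x)"
    using dd_linear_family[of U "\<lambda>w y. dd [w] m (P y)", OF family x]
    by (simp add: dd_compose[OF cinf_on_dd[OF m] P sub x] dd_Cons[of _ "[_]"])
qed

lemma
  fixes m :: "'b::euclidean_space \<Rightarrow> 'c::real_normed_vector" and P A B :: "'a::euclidean_space \<Rightarrow> 'b"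
  assumes m: "cinf_on W m" and P: "cinf_on U P" and A: "cinf_on U A" and B: "cinf_on U B"
    and sub: "\<And>x. x \<in> U \<Longrightarrow> P x \<in> W"
  shows cinf_on_dd2_compose: "cinf_on U (\<lambda>y. dd [A y, B y] m (P y))"
    and dd_dd2_compose: "x \<in> U \<Longrightarrow> dd [v] (\<lambda>y. dd [A y, B y] m (P y)) x =
      dd [dd [v] P x, A x, B x] m (P x) + dd [dd [v] A x, B x] m (P x) + dd [A x, dd [v] B x] m (P x)"
proof -
  have split: "dd [a, b] m = dd [a] (dd [b] m)" "dd [a, b, c] m = dd [a, b] (dd [c] m)" for a b c
    by (simp_all add: dd.simps(2))
  have slot: "cinf_on U (\<lambda>y. dd [A y, b] m (P y))" for b
    unfolding split by (rule cinf_on_dd_compose[OF cinf_on_dd[OF m] P A sub])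
  note family = slot bilinearD(2)[OF bilinear_dd2[OF m sub]] B
  show "cinf_on U (\<lambda>y. dd [A y, B y] m (P y))"
    by (rule cinf_on_linear_family[OF family])
  assume x: "x \<in> U"
  have "dd [v] (\<lambda>y. dd [A y, B y] m (P y)) x = dd [v] (\<lambda>y. dd [A y, B x] m (P y)) x + dd [A x, dd [v] B x] m (P x)"
    by (rule dd_linear_family[of U "\<lambda>w y. dd [A y, w] m (P y)", OF family x])
  also have "dd [v] (\<lambda>y. dd [A y, B x] m (P y)) x = dd [dd [v] P x, A x, B x] m (P x) + dd [dd [v] A x, B x] m (P x)"
    unfolding split by (rule dd_dd_compose[OF cinf_on_dd[OF m] P A sub x])
  finally show "dd [v] (\<lambda>y. dd [A y, B y] m (P y)) x =
      dd [dd [v] P x, A x, B x] m (P x) + dd [dd [v] A x, B x] m (P x) + dd [A x, dd [v] B x] m (P x)" .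
qed

lemma cinf_on_dd_field:
  fixes f :: "'a::euclidean_space \<Rightarrow> 'b::real_normed_vector"
  assumes "cinf_on U A" "cinf_on U f"
  shows "cinf_on U (\<lambda>x. dd [A x] f x)"
  by (rule cinf_on_dd_compose[OF assms(2) cinf_on_ident[OF cinf_on_open[OF assms(2)]] assms(1)])

lemma dd_compose2:
  fixes m :: "'b::euclidean_space \<Rightarrow> 'c::real_normed_vector" and P :: "'a::euclidean_space \<Rightarrow> 'b"
  assumes m: "cinf_on W m" and P: "cinf_on U P" and sub: "\<And>x. x \<in> U \<Longrightarrow> P x \<in> W" and x: "x \<in> U"
  shows "dd [u, v] (\<lambda>y. m (P y)) x = dd [dd [u] P x, dd [v] P x] m (P x) + dd [dd [u, v] P x] m (P x)"
proof -
  have "dd [u, v] (\<lambda>y. m (P y)) x = dd [u] (\<lambda>y. dd [dd [v] P y] m (P y)) x"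
    unfolding dd_Cons[of u "[v]"] by (rule dd_cong[OF cinf_on_open[OF P] dd_compose[OF m P sub] x])
  also have "\<dots> = dd [dd [u] P x, dd [v] P x] m (P x) + dd [dd [u] (dd [v] P) x] m (P x)"
    by (rule dd_dd_compose[OF m P cinf_on_dd[OF P] sub x])
  finally show ?thesis by (simp add: dd_Cons[of u "[v]"])
qed

lemma dd_compose3:
  fixes m :: "'b::euclidean_space \<Rightarrow> 'c::real_normed_vector" and P :: "'a::euclidean_space \<Rightarrow> 'b"
  assumes m: "cinf_on W m" and P: "cinf_on U P" and sub: "\<And>x. x \<in> U \<Longrightarrow> P x \<in> W" and x: "x \<in> U"
  shows "dd [t, u, v] (\<lambda>y. m (P y)) x = dd [dd [t] P x, dd [u] P x, dd [v] P x] m (P x)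
       + dd [dd [t, u] P x, dd [v] P x] m (P x) + dd [dd [u] P x, dd [t, v] P x] m (P x)
       + dd [dd [t] P x, dd [u, v] P x] m (P x) + dd [dd [t, u, v] P x] m (P x)"
proof -
  note P' = cinf_on_dd[OF P]
  have "dd [t, u, v] (\<lambda>y. m (P y)) x =
     dd [t] (\<lambda>y. dd [dd [u] P y, dd [v] P y] m (P y) + dd [dd [u, v] P y] m (P y)) x"
    unfolding dd_Cons[of t "[u, v]"] by (rule dd_cong[OF cinf_on_open[OF P] dd_compose2[OF m P sub] x])
  also have "\<dots> = dd [t] (\<lambda>y. dd [dd [u] P y, dd [v] P y] m (P y)) x + dd [t] (\<lambda>y. dd [dd [u, v] P y] m (P y)) x"
    by (rule dd_add[OF cinf_on_dd2_compose[OF m P P' P' sub] cinf_on_dd_compose[OF m P P' sub] x])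
  also have "dd [t] (\<lambda>y. dd [dd [u] P y, dd [v] P y] m (P y)) x = dd [dd [t] P x, dd [u] P x, dd [v] P x] m (P x)
       + dd [dd [t] (dd [u] P) x, dd [v] P x] m (P x) + dd [dd [u] P x, dd [t] (dd [v] P) x] m (P x)"
    by (rule dd_dd2_compose[OF m P P' P' sub x])
  also have "dd [t] (\<lambda>y. dd [dd [u, v] P y] m (P y)) x =
      dd [dd [t] P x, dd [u, v] P x] m (P x) + dd [dd [t] (dd [u, v] P) x] m (P x)"
    by (rule dd_dd_compose[OF m P P' sub x])
  finally show ?thesis by (simp add: dd_Cons[of t "[_]"] dd_Cons[of t "[_, _]"])
qed

lemma dd_compose_linear:
  assumes "linear l"
  shows "dd vs (\<lambda>x. f (l x)) x = dd (map l vs) f (l x)"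
  by (induction vs arbitrary: x) (simp_all add: dd.simps(2) linear_add[OF assms] linear_scale[OF assms])

lemma dd_translate: "dd vs (\<lambda>y. f (p + y)) y = dd vs f (p + y)"
  by (induction vs arbitrary: y) (simp_all add: dd.simps(2) add.assoc)

subsection \<open>Polynomials of degree three\<close>

lemma dd_linear_form:
  fixes l :: "'a::euclidean_space \<Rightarrow> 'b::real_normed_vector"
  assumes "linear l"
  shows "dd [v] l = (\<lambda>x. l v)" "dd [u, v] l = (\<lambda>x. 0)" "dd [t, u, v] l = (\<lambda>x. 0)"
proof -
  have "bounded_linear l" using assms by (simp add: linear_conv_bounded_linear)
  then show order1: "dd [v] l = (\<lambda>x. l v)" for v
    by (intro ext has_derivative_imp_dd bounded_linear_imp_has_derivative)
  show order2: "dd [u, v] l = (\<lambda>x. 0)" for u v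
    by (simp add: dd_Cons[of u "[v]"] order1 dd_const)
  show "dd [t, u, v] l = (\<lambda>x. 0)"
    by (simp add: dd_Cons[of t "[u, v]"] order2 dd_const)
qed

lemma cinf_on_bilinear_diag:
  fixes B :: "'a::euclidean_space \<Rightarrow> 'a \<Rightarrow> 'b::real_normed_vector"
  assumes "open U" "bilinear B"
  shows "cinf_on U (\<lambda>x. B x x)"
  by (rule cinf_on_linear_family[of U B, OF cinf_on_linear[OF assms(1) bilinearD(2)[OF assms(2)]]
        bilinearD(1)[OF assms(2)] cinf_on_ident[OF assms(1)]])

lemma cinf_on_trilinear_diag:
  fixes T :: "'a::euclidean_space \<Rightarrow> 'a \<Rightarrow> 'a \<Rightarrow> 'b::real_normed_vector"
  assumes "open U" "trilinear T"
  shows "cinf_on U (\<lambda>x. T x x x)"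
proof (rule cinf_on_linear_family[of U "\<lambda>w x. T w x x"])
  show "cinf_on U (\<lambda>x. T w x x)" for w
    using assms by (intro cinf_on_bilinear_diag) (auto simp: bilinear_def trilinear_def)
qed (use assms in \<open>auto simp: cinf_on_ident trilinear_def\<close>)

lemma dd_quadratic_form:
  fixes B :: "'a::euclidean_space \<Rightarrow> 'a \<Rightarrow> 'b::real_normed_vector"
  assumes B: "bilinear B"
  shows "dd [v] (\<lambda>x. B x x) = (\<lambda>x. B v x + B x v)" "dd [u, v] (\<lambda>x. B x x) = (\<lambda>x. B v u + B u v)"
    "dd [t, u, v] (\<lambda>x. B x x) = (\<lambda>x. 0)"
proof -
  note lin = bilinearD[OF B]
  show order1: "dd [v] (\<lambda>x. B x x) = (\<lambda>x. B v x + B x v)" for v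
  proof
    fix x
    have "dd [v] (\<lambda>x. B x x) x = dd [v] (B x) x + B (dd [v] (\<lambda>x. x) x) x"
      by (rule dd_linear_family[of UNIV B, OF cinf_on_linear[OF _ lin(2)] lin(1) cinf_on_ident]) auto
    then show "dd [v] (\<lambda>x. B x x) x = B v x + B x v"
      by (simp add: dd_linear_form[OF lin(2)] dd_ident add.commute)
  qed
  have polar: "linear (\<lambda>x. B v x + B x v)" for v
    by (intro linear_compose_add lin)
  show "dd [u, v] (\<lambda>x. B x x) = (\<lambda>x. B v u + B u v)"
    unfolding dd_Cons[of u "[v]"] order1 by (rule dd_linear_form(1)[OF polar])
  have "dd [t, u, v] (\<lambda>x. B x x) = dd [t, u] (dd [v] (\<lambda>x. B x x))"
    by (simp add: dd.simps(2))
  then show "dd [t, u, v] (\<lambda>x. B x x) = (\<lambda>x. 0)"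
    unfolding order1 by (simp add: dd_linear_form(2)[OF polar])
qed

lemma dd_cubic_form:
  fixes T :: "'a::euclidean_space \<Rightarrow> 'a \<Rightarrow> 'a \<Rightarrow> 'b::real_normed_vector"
  assumes T: "trilinear T"
  shows "dd [v] (\<lambda>x. T x x x) = (\<lambda>x. T v x x + T x v x + T x x v)"
    "dd [u, v] (\<lambda>x. T x x x) = (\<lambda>x. T v u x + T v x u + T u v x + T x v u + T u x v + T x u v)"
    "dd [t, u, v] (\<lambda>x. T x x x) = (\<lambda>x. T v u t + T v t u + T u v t + T t v u + T u t v + T t u v)"
proof -
  note lin = trilinearD[OF T]
  have slice: "bilinear (T x)" for x
    using lin by (simp add: bilinear_def)
  show order1: "dd [v] (\<lambda>x. T x x x) = (\<lambda>x. T v x x + T x v x + T x x v)" for v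
  proof
    fix x
    have "dd [v] (\<lambda>x. T x x x) x = dd [v] (\<lambda>y. T x y y) x + T (dd [v] (\<lambda>x. x) x) x x"
      by (rule dd_linear_family[of UNIV "\<lambda>w x. T w x x", OF cinf_on_bilinear_diag[OF _ slice] lin(1)
          cinf_on_ident]) auto
    then show "dd [v] (\<lambda>x. T x x x) x = T v x x + T x v x + T x x v"
      by (simp add: dd_quadratic_form[OF slice] dd_ident add.assoc add.commute)
  qed
  have polar: "bilinear (\<lambda>x y. T v x y + T x v y + T x y v)" for v
    unfolding bilinear_def by (intro conjI allI linear_compose_add lin)
  show "dd [u, v] (\<lambda>x. T x x x) = (\<lambda>x. T v u x + T v x u + T u v x + T x v u + T u x v + T x u v)"
    unfolding dd_Cons[of u "[v]"] order1 dd_quadratic_form(1)[OF polar] by (simp add: add_ac)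
  have "dd [t, u, v] (\<lambda>x. T x x x) = dd [t, u] (dd [v] (\<lambda>x. T x x x))"
    by (simp add: dd.simps(2))
  also have "\<dots> = (\<lambda>x. T v u t + T v t u + T u v t + T t v u + T u t v + T t u v)"
    unfolding order1 dd_quadratic_form(2)[OF polar] by (simp add: add_ac)
  finally show "dd [t, u, v] (\<lambda>x. T x x x) = (\<lambda>x. T v u t + T v t u + T u v t + T t v u + T u t v + T t u v)" .
qed

subsection \<open>Taylor's formula\<close>

lemma dd_replicate_bound:
  fixes f :: "'a::euclidean_space \<Rightarrow> real"
  assumes "cinf_on U f" "compact K" "K \<subseteq> U"
  shows "\<exists>C\<ge>0. \<forall>y\<in>K. \<forall>v. \<bar>dd (replicate k v) f y\<bar> \<le> C * norm v ^ k"
  using assms(1)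
proof (induction k arbitrary: f)
  case 0
  have "bounded (f ` K)"
    by (intro compact_imp_bounded compact_continuous_image continuous_on_subset[OF cinf_on_continuous[OF 0]] assms)
  then obtain C where "C > 0" "\<forall>y\<in>K. norm (f y) \<le> C" by (auto simp: bounded_pos)
  then show ?case by (intro exI[of _ C]) auto
next
  case (Suc k)
  have "\<forall>b. \<exists>C\<ge>0. \<forall>y\<in>K. \<forall>v. \<bar>dd (replicate k v) (dd [b] f) y\<bar> \<le> C * norm v ^ k"
    using Suc.IH[OF cinf_on_dd[OF Suc.prems]] by blast
  then obtain C where C: "\<And>b. C b \<ge> 0" "\<And>b y v. y \<in> K \<Longrightarrow> \<bar>dd (replicate k v) (dd [b] f) y\<bar> \<le> C b * norm v ^ k"
    by metis
  show ?case
  proof (intro exI[of _ "\<Sum>b\<in>Basis. C b"] conjI ballI allI)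
    show "(\<Sum>b\<in>Basis. C b) \<ge> 0" using C(1) by (rule sum_nonneg)
    fix y v assume y: "y \<in> K"
    have "linear (\<lambda>w. dd (replicate k v @ w # []) f y)"
      by (rule linear_dd_slot[OF Suc.prems]) (use y assms in auto)
    then have "dd (replicate (Suc k) v) f y = (\<Sum>b\<in>Basis. (v \<bullet> b) *\<^sub>R dd (replicate k v) (dd [b] f) y)"
      using linear_basis_expand[of "\<lambda>w. dd (replicate k v @ w # []) f y" v]
      by (simp add: dd_append flip: replicate_append_same)
    also have "\<bar>\<dots>\<bar> \<le> (\<Sum>b\<in>Basis. \<bar>(v \<bullet> b) *\<^sub>R dd (replicate k v) (dd [b] f) y\<bar>)"
      by (rule sum_abs)
    also have "\<dots> \<le> (\<Sum>b\<in>Basis. norm v * (C b * norm v ^ k))"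
      unfolding real_scaleR_def abs_mult
      by (intro sum_mono mult_mono C y Basis_le_norm) auto
    also have "\<dots> = (\<Sum>b\<in>Basis. C b) * norm v ^ Suc k"
      by (simp add: sum_distrib_left sum_distrib_right mult_ac)
    finally show "\<bar>dd (replicate (Suc k) v) f y\<bar> \<le> (\<Sum>b\<in>Basis. C b) * norm v ^ Suc k" .
  qed
qed

lemma Taylor_dd:
  fixes f :: "'a::euclidean_space \<Rightarrow> real"
  assumes f: "cinf_on U f" and p: "p \<in> U" and n: "0 < n"
  shows "\<exists>C. \<forall>\<^sub>F v in nhds 0. \<bar>f (p + v) - (\<Sum>m<n. dd (replicate m v) f p / fact m)\<bar> \<le> C * norm v ^ n"
proof -
  obtain d where d: "d > 0" "cball p d \<subseteq> U"
    using cinf_on_open[OF f] p by (meson open_contains_cball)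
  obtain C where C: "\<forall>y\<in>cball p d. \<forall>v. \<bar>dd (replicate n v) f y\<bar> \<le> C * norm v ^ n"
    using dd_replicate_bound[OF f compact_cball d(2)] by blast
  have "\<bar>f (p + v) - (\<Sum>m<n. dd (replicate m v) f p / fact m)\<bar> \<le> C / fact n * norm v ^ n"
    if v: "norm v < d" for v
  proof -
    have mem: "p + t *\<^sub>R v \<in> cball p d" if "0 \<le> t" "t \<le> 1" for t :: real
      using that v mult_left_le_one_le[of "norm v" t] by (auto simp: dist_norm)
    have "\<exists>t>0. t < 1 \<and> f (p + 1 *\<^sub>R v) =
        (\<Sum>m<n. dd (replicate m v) f (p + 0 *\<^sub>R v) / fact m * 1 ^ m) + dd (replicate n v) f (p + t *\<^sub>R v) /
            fact n * 1 ^ n"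
    proof (rule Maclaurin)
      show "\<forall>m t. m < n \<and> 0 \<le> t \<and> t \<le> 1 \<longrightarrow>
         ((\<lambda>t. dd (replicate m v) f (p + t *\<^sub>R v)) has_real_derivative dd (replicate (Suc m) v) f
             (p + t *\<^sub>R v)) (at t)"
        using mem d(2) cinf_on_line_derivative[OF f]
        by (simp add: has_real_derivative_iff_has_vector_derivative subset_iff)
    qed (use n in auto)
    then obtain t where t: "0 < t" "t < 1" "f (p + v) =
        (\<Sum>m<n. dd (replicate m v) f p / fact m) + dd (replicate n v) f (p + t *\<^sub>R v) / fact n"
      by auto
    have "\<bar>dd (replicate n v) f (p + t *\<^sub>R v)\<bar> \<le> C * norm v ^ n"
      using C mem[of t] t by auto
    then show ?thesis
      unfolding t(3) by (simp add: divide_right_mono)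
  qed
  then show ?thesis
    unfolding eventually_nhds_metric using d(1) by (intro exI[of _ "C / fact n"] exI[of _ d]) auto
qed

subsection \<open>The complex structure of the ambient space\<close>

definition scaleC :: "complex \<Rightarrow> 'n::finite amb \<Rightarrow> 'n amb" (infixr "*\<^sub>C" 75) where
  "c *\<^sub>C v = ((\<chi> j. c * fst v $ j), c * snd v)"

lemma fst_scaleC_nth [simp]: "fst (c *\<^sub>C v) $ j = c * fst v $ j"
  and snd_scaleC [simp]: "snd (c *\<^sub>C v) = c * snd v"
  by (simp_all add: scaleC_def)

lemma fst_Jc_nth [simp]: "fst (Jc v) $ j = \<i> * fst v $ j"
  and snd_Jc [simp]: "snd (Jc v) = \<i> * snd v"
  by (simp_all add: Jc_def)

lemma amb_eq_iff: "x = y \<longleftrightarrow> (\<forall>j. fst x $ j = fst y $ j) \<and> snd x = snd (y :: 'n::finite amb)"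
  by (auto simp: prod_eq_iff vec_eq_iff)

lemma Jc_eq_scaleC: "Jc v = \<i> *\<^sub>C v"
  by (simp add: amb_eq_iff)

lemma scaleC_eq_Jc: "c *\<^sub>C v = Re c *\<^sub>R v + Im c *\<^sub>R Jc v"
  by (simp add: amb_eq_iff complex_eq_iff)

lemma scaleC_simps:
  "(a + b) *\<^sub>C v = a *\<^sub>C v + b *\<^sub>C v" "(a - b) *\<^sub>C v = a *\<^sub>C v - b *\<^sub>C v" "(- a) *\<^sub>C v = - (a *\<^sub>C v)"
  "a *\<^sub>C (v + w) = a *\<^sub>C v + a *\<^sub>C w" "a *\<^sub>C (v - w) = a *\<^sub>C v - a *\<^sub>C w" "a *\<^sub>C (- v) = - (a *\<^sub>C v)"
  "a *\<^sub>C (r *\<^sub>R v) = r *\<^sub>R (a *\<^sub>C v)" "0 *\<^sub>C v = 0" "a *\<^sub>C 0 = 0" "1 *\<^sub>C v = v" "of_real r *\<^sub>C v = r *\<^sub>R v"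
  "a *\<^sub>C b *\<^sub>C v = (a * b) *\<^sub>C v"
  by (simp_all add: amb_eq_iff complex_eq_iff algebra_simps)

lemma bounded_linear_scaleC: "bounded_linear ((*\<^sub>C) a :: 'n::finite amb \<Rightarrow> 'n amb)"
  unfolding linear_conv_bounded_linear[symmetric] by (rule linearI) (simp_all add: scaleC_simps)

lemma bounded_linear_scaleC_left: "bounded_linear (\<lambda>a. a *\<^sub>C v)"
  unfolding linear_conv_bounded_linear[symmetric]
  by (rule linearI) (simp_all add: amb_eq_iff complex_eq_iff algebra_simps)

lemma bounded_linear_Jc: "bounded_linear Jc"
  using bounded_linear_scaleC[of \<i>] by (simp add: Jc_eq_scaleC[abs_def])

lemma linear_Jc: "linear Jc"
  by (rule bounded_linear.linear[OF bounded_linear_Jc])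

lemma Jc_simps:
  "Jc (v + w) = Jc v + Jc w" "Jc (v - w) = Jc v - Jc w" "Jc (- v) = - Jc v"
  "Jc (r *\<^sub>R v) = r *\<^sub>R Jc v" "Jc 0 = 0" "Jc (Jc v) = - v" "Jc (a *\<^sub>C v) = a *\<^sub>C Jc v"
  by (simp_all add: amb_eq_iff algebra_simps)

lemma inner_amb: "x \<bullet> y = Re ((\<Sum>j\<in>UNIV. cnj (fst x $ j) * fst y $ j) + cnj (snd x) * snd y)"
  for x y :: "'n::finite amb"
  by (simp add: inner_prod_def inner_vec_def inner_complex_def)

lemma inner_Jc_Jc: "Jc x \<bullet> Jc y = x \<bullet> y"
  by (simp add: inner_amb)

lemma inner_Jc_left: "Jc x \<bullet> y = - (x \<bullet> Jc y)"
  using inner_Jc_Jc[of x "Jc y"] by (simp add: Jc_simps)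

lemma inner_Jc_self: "x \<bullet> Jc x = 0" "Jc x \<bullet> x = 0"
  using inner_Jc_left[of x x] by (simp_all add: inner_commute)

lemma norm_scaleC: "norm (c *\<^sub>C v) = cmod c * norm v"
proof -
  have "c *\<^sub>C v \<bullet> c *\<^sub>C v = (cmod c)\<^sup>2 * (v \<bullet> v)"
    by (simp add: scaleC_eq_Jc inner_add_left inner_add_right inner_Jc_Jc inner_Jc_left cmod_def
        Jc_simps power2_eq_square algebra_simps)
  then show ?thesis by (simp add: norm_eq_sqrt_inner real_sqrt_mult)
qed

lemma complex_linear_scaleC:
  assumes "linear D" "\<And>v. D (Jc v) = Jc (D v)"
  shows "D (c *\<^sub>C v) = c *\<^sub>C D v"
  using assms by (simp add: scaleC_eq_Jc linear_add linear_scale)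

lemma complex_linear_functional_scaleC:
  fixes D :: "'n::finite amb \<Rightarrow> complex"
  assumes "linear D" "\<And>v. D (Jc v) = \<i> * D v"
  shows "D (c *\<^sub>C v) = c * D v"
  using assms by (simp add: scaleC_eq_Jc linear_add linear_scale complex_eq_iff)

lemma cinf_on_Jc: "cinf_on U A \<Longrightarrow> cinf_on U (\<lambda>x. Jc (A x))"
  by (rule cinf_on_bounded_linear_apply[OF _ bounded_linear_Jc])

lemma dd_Jc: "cinf_on U A \<Longrightarrow> x \<in> U \<Longrightarrow> dd vs (\<lambda>x. Jc (A x)) x = Jc (dd vs A x)"
  by (rule dd_bounded_linear_apply[OF _ bounded_linear_Jc])

lemma cinf_on_amb:
  fixes f :: "'a::real_normed_vector \<Rightarrow> 'n::finite amb"
  assumes "\<And>j. cinf_on U (\<lambda>x. fst (f x) $ j)" "cinf_on U (\<lambda>x. snd (f x))"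
  shows "cinf_on U f"
  using cinf_on_Pair[OF cinf_on_vec_lambda[where f="\<lambda>j x. fst (f x) $ j", OF cinf_on_open[OF assms(2)]
      assms(1)] assms(2)]
  by simp

subsection \<open>Holomorphic maps are smooth\<close>

text \<open>The following class is closed under directional derivatives, because Cauchy's formula expresses
  a directional derivative as an integral of the function itself.\<close>

definition line_holomorphic_on :: "'n::finite amb set \<Rightarrow> ('n amb \<Rightarrow> complex) \<Rightarrow> bool" where
  "line_holomorphic_on U f \<longleftrightarrow> open U \<and> continuous_on U f \<and>
     (\<forall>x\<in>U. \<forall>v. (\<lambda>c. f (x + c *\<^sub>C v)) field_differentiable at 0)"

definition line_deriv :: "'n::finite amb \<Rightarrow> ('n amb \<Rightarrow> complex) \<Rightarrow> 'n amb \<Rightarrow> complex" where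
  "line_deriv v f x = deriv (\<lambda>c. f (x + c *\<^sub>C v)) 0"

definition Cauchy_integrand ::
    "('n::finite amb \<Rightarrow> complex) \<Rightarrow> 'n amb \<Rightarrow> real \<Rightarrow> 'n amb \<Rightarrow> real \<Rightarrow> complex" where
  "Cauchy_integrand f v r x s = f (x + (of_real r * exp (2 * of_real pi * \<i> * of_real s)) *\<^sub>C v) *
     (exp (- (2 * of_real pi * \<i> * of_real s)) / of_real r)"

lemma line_holomorphic_on_has_field_derivative:
  assumes f: "line_holomorphic_on U f" and x: "x + c *\<^sub>C v \<in> U"
  shows "((\<lambda>c. f (x + c *\<^sub>C v)) has_field_derivative line_deriv v f (x + c *\<^sub>C v)) (at c)"
proof -
  have "((\<lambda>b. f ((x + c *\<^sub>C v) + b *\<^sub>C v)) has_field_derivative line_deriv v f (x + c *\<^sub>C v)) (at 0)"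
    using f x unfolding line_holomorphic_on_def line_deriv_def by (blast intro: field_differentiable_derivI)
  then have "((\<lambda>b. f ((x + c *\<^sub>C v) + b *\<^sub>C v)) has_field_derivative line_deriv v f (x + c *\<^sub>C v)) (at (c + - c))"
    by simp
  then have "((\<lambda>b. f ((x + c *\<^sub>C v) + (b + - c) *\<^sub>C v)) has_field_derivative line_deriv v f (x + c *\<^sub>C v)) (at c)"
    unfolding DERIV_shift .
  then show ?thesis by (simp add: scaleC_simps algebra_simps)
qed

lemma line_deriv_Cauchy:
  assumes f: "line_holomorphic_on U f" and r: "r > 0" and sub: "\<And>c. cmod c \<le> r \<Longrightarrow> x + c *\<^sub>C v \<in> U"
  shows "line_deriv v f x = integral (cbox 0 1) (Cauchy_integrand f v r x)"
proof -
  let ?g = "\<lambda>c. f (x + c *\<^sub>C v)"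
  have hol: "?g holomorphic_on cball 0 r"
    unfolding holomorphic_on_def field_differentiable_def
    using has_field_derivative_at_within[OF line_holomorphic_on_has_field_derivative[OF f sub]] by fastforce
  have "(?g has_field_derivative (1 / (2 * of_real pi * \<i>) * contour_integral(circlepath 0 r)
      (\<lambda>u. ?g u / (u-0)^2))) (at 0)"
    by (rule Cauchy_derivative_integral_circlepath(2)) (use hol r
        in \<open>auto intro: holomorphic_on_imp_continuous_on holomorphic_on_subset\<close>)
  moreover have "(?g has_field_derivative line_deriv v f x) (at 0)"
    using line_holomorphic_on_has_field_derivative[OF f, of x 0 v] sub[of 0] r by (simp add: scaleC_simps)
  ultimately have "line_deriv v f x = 1 / (2 * of_real pi * \<i>) * contour_integral(circlepath 0 r) (\<lambda>u. ?g u / u^2)"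
    by (auto dest: DERIV_unique)
  also have "contour_integral(circlepath 0 r) (\<lambda>u. ?g u / u^2) =
      integral {0..1} (\<lambda>s. ?g (circlepath 0 r s) / (circlepath 0 r s)^2 * vector_derivative (circlepath 0 r) (at s))"
    by (simp add: contour_integral_integral)
  also have "1 / (2 * of_real pi * \<i>) * \<dots> = integral {0..1} (\<lambda>s. 1 / (2 * of_real pi * \<i>) *
       (?g (circlepath 0 r s) / (circlepath 0 r s)^2 * vector_derivative (circlepath 0 r) (at s)))"
    by (rule integral_mult_right[symmetric])
  also have "\<dots> = integral {0..1} (Cauchy_integrand f v r x)"
    unfolding vector_derivative_circlepath Cauchy_integrand_def using r
    by (intro integral_cong) (auto simp: circlepath power2_eq_square divide_simps exp_minus)
  finally show ?thesis by simp
qed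

lemma complex_disc_neighbourhood:
  assumes "open U" "x\<^sub>0 \<in> (U :: 'n::finite amb set)"
  obtains d r where "d > 0" "r > 0" "\<And>x c. x \<in> ball x\<^sub>0 d \<Longrightarrow> cmod c \<le> r \<Longrightarrow> x + c *\<^sub>C v \<in> U"
proof -
  obtain e where e: "e > 0" "ball x\<^sub>0 e \<subseteq> U" using assms by (meson open_contains_ball)
  define r where "r = e / (2 * (norm v + 1))"
  have pos: "norm v + 1 > 0" by (simp add: add_nonneg_pos)
  show ?thesis
  proof
    show "e / 2 > 0" using e by simp
    show "r > 0" using e pos by (simp add: r_def)
    fix x c assume x: "x \<in> ball x\<^sub>0 (e / 2)" and c: "cmod c \<le> r"
    have "norm (c *\<^sub>C v) \<le> r * (norm v + 1)"
      unfolding norm_scaleC using c pos e by (intro mult_mono) (auto simp: r_def)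
    also have "\<dots> = e / 2" using pos by (simp add: r_def field_simps)
    finally have "dist x\<^sub>0 (x + c *\<^sub>C v) < e"
      using x norm_triangle_ineq[of "x - x\<^sub>0" "c *\<^sub>C v"] by (simp add: dist_norm norm_minus_commute algebra_simps)
    then show "x + c *\<^sub>C v \<in> U" using e by auto
  qed
qed

lemma complex_bidisc_neighbourhood:
  assumes U: "open U" and x: "x \<in> (U :: 'n::finite amb set)"
  obtains R r where "R > 0" "r > 0" "\<And>b c. b \<in> ball 0 R \<Longrightarrow> cmod c \<le> r \<Longrightarrow> x + b *\<^sub>C w + c *\<^sub>C v \<in> U"
proof -
  obtain d r where d: "d > 0" "r > 0" "\<And>y c. y \<in> ball x d \<Longrightarrow> cmod c \<le> r \<Longrightarrow> y + c *\<^sub>C v \<in> U"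
    using complex_disc_neighbourhood[OF U x] by metis
  obtain d' R where R: "d' > 0" "R > 0" "\<And>y c. y \<in> ball x d' \<Longrightarrow> cmod c \<le> R \<Longrightarrow> y + c *\<^sub>C w \<in> ball x d"
    using complex_disc_neighbourhood[OF open_ball, of x x d] d(1) by (metis centre_in_ball)
  have "x + b *\<^sub>C w + c *\<^sub>C v \<in> U" if "b \<in> ball 0 R" "cmod c \<le> r" for b c
    using d(3)[OF R(3)[of x b] that(2)] R(1) that(1) by (auto simp: less_imp_le)
  then show ?thesis by (rule that[OF R(2) d(2)])
qed

lemma continuous_on_Cauchy_integrand:
  fixes f :: "'n::finite amb \<Rightarrow> complex"
  assumes f: "continuous_on U f" and g: "continuous_on V g" and r: "r > 0"
    and sub: "\<And>x c. x \<in> V \<Longrightarrow> cmod c \<le> r \<Longrightarrow> g x + c *\<^sub>C v \<in> U"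
  shows "continuous_on (V \<times> cbox 0 1) (\<lambda>(x, s). Cauchy_integrand f v r (g x) s)"
proof -
  have "continuous_on (V \<times> cbox 0 1)
      (\<lambda>y. f (g (fst y) + (of_real r * exp (2 * of_real pi * \<i> * of_real (snd y))) *\<^sub>C v))"
    by (rule continuous_on_compose2[OF f])
      (use r in \<open>auto intro!: continuous_intros sub continuous_on_compose2[OF g]
         bounded_linear.continuous_on[OF bounded_linear_scaleC_left] simp: norm_mult\<close>)
  then show ?thesis
    using r by (auto simp: split_beta Cauchy_integrand_def intro!: continuous_intros)
qed

lemma continuous_on_line_deriv:
  assumes f: "line_holomorphic_on U f"
  shows "continuous_on U (line_deriv v f)"
proof -
  have U: "open U" and cont: "continuous_on U f" using f by (auto simp: line_holomorphic_on_def)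
  have "isCont (line_deriv v f) x\<^sub>0" if x\<^sub>0: "x\<^sub>0 \<in> U" for x\<^sub>0
  proof -
    obtain d r where disc: "d > 0" "r > 0" "\<And>x c. x \<in> ball x\<^sub>0 d \<Longrightarrow> cmod c \<le> r \<Longrightarrow> x + c *\<^sub>C v \<in> U"
      using complex_disc_neighbourhood[OF U x\<^sub>0] by metis
    have "continuous_on (ball x\<^sub>0 d) (\<lambda>x. integral (cbox 0 1) (Cauchy_integrand f v r x))"
      by (rule integral_continuous_on_param[OF continuous_on_Cauchy_integrand[OF cont continuous_on_id disc(2,3)]])
    then have "continuous_on (ball x\<^sub>0 d) (line_deriv v f)"
      by (rule continuous_on_eq) (rule line_deriv_Cauchy[OF f disc(2) disc(3), symmetric])
    then show ?thesis using disc(1) by (simp add: continuous_on_eq_continuous_at)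
  qed
  then show ?thesis by (simp add: continuous_at_imp_continuous_on)
qed

lemma Cauchy_integrand_has_field_derivative:
  assumes f: "line_holomorphic_on U f" and r: "r > 0"
    and sub: "\<And>c. cmod c \<le> r \<Longrightarrow> (x + b *\<^sub>C w) + c *\<^sub>C v \<in> U"
  shows "((\<lambda>b. Cauchy_integrand f v r (x + b *\<^sub>C w) s) has_field_derivative
    Cauchy_integrand (line_deriv w f) v r (x + b *\<^sub>C w) s) (at b)"
proof -
  let ?c = "of_real r * exp (2 * of_real pi * \<i> * of_real s) :: complex"
  have "(x + ?c *\<^sub>C v) + b *\<^sub>C w \<in> U"
    using sub[of ?c] r by (simp add: norm_mult algebra_simps)
  from line_holomorphic_on_has_field_derivative[OF f this]
  have "((\<lambda>b. f (x + b *\<^sub>C w + ?c *\<^sub>C v)) has_field_derivative line_deriv w f (x + b *\<^sub>C w + ?c *\<^sub>C v)) (at b)"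
    by (simp add: algebra_simps)
  then show ?thesis unfolding Cauchy_integrand_def by (rule DERIV_cmult_right)
qed

lemma line_holomorphic_on_line_deriv:
  assumes f: "line_holomorphic_on U f"
  shows "line_holomorphic_on U (line_deriv v f)"
  unfolding line_holomorphic_on_def
proof (intro conjI ballI allI)
  show U: "open U" using f by (simp add: line_holomorphic_on_def)
  show "continuous_on U (line_deriv v f)" by (rule continuous_on_line_deriv[OF f])
  have cont: "continuous_on U f" using f by (simp add: line_holomorphic_on_def)
  fix x\<^sub>0 w assume x\<^sub>0: "x\<^sub>0 \<in> U"
  obtain R r where R: "R > 0" and r: "r > 0"
    and mem: "\<And>b c. b \<in> ball 0 R \<Longrightarrow> cmod c \<le> r \<Longrightarrow> x\<^sub>0 + b *\<^sub>C w + c *\<^sub>C v \<in> U"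
    by (rule complex_bidisc_neighbourhood[OF U x\<^sub>0]) blast
  have segment: "continuous_on (ball 0 R) (\<lambda>b. x\<^sub>0 + b *\<^sub>C w)"
    by (intro continuous_intros bounded_linear.continuous_on[OF bounded_linear_scaleC_left])
  have "((\<lambda>b. integral (cbox 0 1) (Cauchy_integrand f v r (x\<^sub>0 + b *\<^sub>C w))) has_field_derivative
       integral (cbox 0 1) (Cauchy_integrand (line_deriv w f) v r (x\<^sub>0 + 0 *\<^sub>C w))) (at 0 within ball 0 R)"
  proof (rule leibniz_rule_field_derivative)
    fix b :: complex and s :: real assume "b \<in> ball 0 R"
    then show "((\<lambda>b. Cauchy_integrand f v r (x\<^sub>0 + b *\<^sub>C w) s) has_field_derivative
         Cauchy_integrand (line_deriv w f) v r (x\<^sub>0 + b *\<^sub>C w) s) (at b within ball 0 R)"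
      by (intro has_field_derivative_at_within[OF Cauchy_integrand_has_field_derivative[OF f r]] mem)
  next
    fix b :: complex assume b: "b \<in> ball 0 R"
    have "continuous_on ({b} \<times> cbox 0 1) (\<lambda>(b, s). Cauchy_integrand f v r (x\<^sub>0 + b *\<^sub>C w) s)"
      using b by (intro continuous_on_Cauchy_integrand[OF cont continuous_on_subset[OF segment] r] mem) auto
    then have "continuous_on (cbox 0 1) (\<lambda>s. (\<lambda>(b, s). Cauchy_integrand f v r (x\<^sub>0 + b *\<^sub>C w) s) (b, s))"
      by (rule continuous_on_compose2) (auto intro!: continuous_intros)
    then show "Cauchy_integrand f v r (x\<^sub>0 + b *\<^sub>C w) integrable_on cbox 0 1"
      by (intro integrable_continuous) simp
  next
    show "continuous_on (ball 0 R \<times> cbox 0 1) (\<lambda>(b, s). Cauchy_integrand (line_deriv w f) v r (x\<^sub>0 + b *\<^sub>C w) s)"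
      by (rule continuous_on_Cauchy_integrand[OF continuous_on_line_deriv[OF f] segment r mem])
  qed (use R in auto)
  then have "((\<lambda>b. line_deriv v f (x\<^sub>0 + b *\<^sub>C w)) has_field_derivative
       integral (cbox 0 1) (Cauchy_integrand (line_deriv w f) v r (x\<^sub>0 + 0 *\<^sub>C w))) (at 0 within ball 0 R)"
    by (rule has_field_derivative_transform_within[OF _ R _ line_deriv_Cauchy[OF f r mem, symmetric]])
      (use R in auto)
  then show "(\<lambda>c. line_deriv v f (x\<^sub>0 + c *\<^sub>C w)) field_differentiable at 0"
    using R at_within_open[of "0::complex" "ball 0 R"] by (auto simp: field_differentiable_def)
qed

lemma cinf_on_line_holomorphic:
  assumes "line_holomorphic_on U f"
  shows "cinf_on U f"
proof (rule cinf_on_coinduct[where P="line_holomorphic_on U"])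
  fix g v assume g: "line_holomorphic_on U g"
  have "((\<lambda>t. g (x + t *\<^sub>R v)) has_vector_derivative line_deriv v g x) (at 0)" if "x \<in> U" for x
  proof -
    have "((\<lambda>c. g (x + c *\<^sub>C v)) has_field_derivative line_deriv v g x) (at (of_real 0))"
      using line_holomorphic_on_has_field_derivative[OF g, of x 0 v] that by (simp add: scaleC_simps)
    from has_vector_derivative_real_field[OF this] show ?thesis by (simp add: scaleC_simps)
  qed
  then show "\<exists>g'. line_holomorphic_on U g' \<and> (\<forall>x\<in>U. ((\<lambda>t. g (x + t *\<^sub>R v)) has_vector_derivative g' x) (at 0))"
    using line_holomorphic_on_line_deriv[OF g] by blast
qed (use assms in \<open>auto simp: line_holomorphic_on_def\<close>)

lemma line_holomorphic_on_functional:
  fixes \<pi> :: "'n::finite amb \<Rightarrow> complex"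
  assumes \<Phi>: "holo_on U \<Phi>" and \<pi>: "linear \<pi>" "\<And>v. \<pi> (Jc v) = \<i> * \<pi> v"
  shows "line_holomorphic_on U (\<lambda>x. \<pi> (\<Phi> x))"
  unfolding line_holomorphic_on_def
proof (intro conjI ballI allI)
  show "open U" using \<Phi> by (simp add: holo_on_def)
  have \<pi>': "bounded_linear \<pi>" using \<pi>(1) by (simp add: linear_conv_bounded_linear)
  have "continuous_on U \<Phi>"
    using \<Phi> unfolding holo_on_def
    by (metis continuous_at_imp_continuous_on has_derivative_continuous)
  then show "continuous_on U (\<lambda>x. \<pi> (\<Phi> x))"
    by (rule bounded_linear.continuous_on[OF \<pi>'])
  fix x v assume "x \<in> U"
  then obtain D where D: "(\<Phi> has_derivative D) (at x)" "\<And>v. D (Jc v) = Jc (D v)"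
    using \<Phi> unfolding holo_on_def by blast
  have "((\<lambda>c. x + c *\<^sub>C v) has_derivative (\<lambda>c. c *\<^sub>C v)) (at 0)"
    using has_derivative_add[OF has_derivative_const bounded_linear_imp_has_derivative[OF bounded_linear_scaleC_left]]
    by simp
  moreover have "(\<Phi> has_derivative D) (at (x + 0 *\<^sub>C v))" using D by (simp add: scaleC_simps)
  ultimately have "((\<lambda>c. \<Phi> (x + c *\<^sub>C v)) has_derivative (\<lambda>c. D (c *\<^sub>C v))) (at 0)"
    by (rule has_derivative_compose)
  then have "((\<lambda>c. \<pi> (\<Phi> (x + c *\<^sub>C v))) has_derivative (\<lambda>c. \<pi> (D (c *\<^sub>C v)))) (at 0)"
    by (rule bounded_linear.has_derivative[OF \<pi>'])
  also have "(\<lambda>c. \<pi> (D (c *\<^sub>C v))) = (*) (\<pi> (D v))"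
    using complex_linear_scaleC[OF has_derivative_linear[OF D(1)] D(2)] complex_linear_functional_scaleC[OF \<pi>]
    by (simp add: mult.commute fun_eq_iff)
  finally show "(\<lambda>c. \<pi> (\<Phi> (x + c *\<^sub>C v))) field_differentiable at 0"
    unfolding field_differentiable_def has_field_derivative_def by blast
qed

lemma cinf_on_holo:
  assumes "holo_on U \<Phi>"
  shows "cinf_on U \<Phi>"
  by (rule cinf_on_amb; rule cinf_on_line_holomorphic, rule line_holomorphic_on_functional[OF assms])
    (auto intro!: linearI)

lemma holo_onI:
  assumes \<Phi>: "cinf_on U \<Phi>" and Jc: "\<And>x v. x \<in> U \<Longrightarrow> dd [Jc v] \<Phi> x = Jc (dd [v] \<Phi> x)"
  shows "holo_on U \<Phi>"
  unfolding holo_on_def using cinf_on_open[OF \<Phi>] cinf_on_has_derivative[OF \<Phi>] Jc by blast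

lemma holo_on_subset: "holo_on U \<Phi> \<Longrightarrow> open V \<Longrightarrow> V \<subseteq> U \<Longrightarrow> holo_on V \<Phi>"
  unfolding holo_on_def by blast

lemma holo_dd_Jc_Cons:
  assumes \<Phi>: "holo_on U \<Phi>"
  shows "x \<in> U \<Longrightarrow> dd (Jc v # ws) \<Phi> x = Jc (dd (v # ws) \<Phi> x)"
proof (induction ws arbitrary: x)
  case Nil
  then show ?case using \<Phi> unfolding holo_on_def by (metis has_derivative_imp_dd)
next
  case (Cons w ws)
  note smooth = cinf_on_dd[OF cinf_on_holo[OF \<Phi>], of ws]
  have split: "dd (u # w # ws) \<Phi> = dd [u, w] (dd ws \<Phi>)" "dd (u # ws) \<Phi> = dd [u] (dd ws \<Phi>)" for u
    by (simp_all add: dd.simps(2))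
  have "dd [Jc v, w] (dd ws \<Phi>) x = dd [w, Jc v] (dd ws \<Phi>) x"
    by (rule dd_swap[OF smooth Cons.prems])
  also have "\<dots> = dd [w] (\<lambda>x. Jc (dd [v] (dd ws \<Phi>) x)) x"
    unfolding dd_Cons[of w "[_]"]
    by (rule dd_cong[OF cinf_on_open[OF smooth] _ Cons.prems]) (use Cons.IH in \<open>simp add: split\<close>)
  also have "\<dots> = Jc (dd [w, v] (dd ws \<Phi>) x)"
    by (simp add: dd_Jc[OF cinf_on_dd[OF smooth] Cons.prems] dd_Cons[of w "[_]"])
  also have "dd [w, v] (dd ws \<Phi>) x = dd [v, w] (dd ws \<Phi>) x"
    by (rule dd_swap[OF smooth Cons.prems])
  finally show ?case by (simp add: split)
qed

lemma holo_dd_Jc: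
  assumes \<Phi>: "holo_on U \<Phi>"
  shows "x \<in> U \<Longrightarrow> dd (us @ Jc v # ws) \<Phi> x = Jc (dd (us @ v # ws) \<Phi> x)"
proof -
  assume x: "x \<in> U"
  note smooth = cinf_on_holo[OF \<Phi>]
  have "dd us (dd (Jc v # ws) \<Phi>) x = dd us (\<lambda>x. Jc (dd (v # ws) \<Phi> x)) x"
    by (rule dd_cong[OF cinf_on_open[OF smooth] holo_dd_Jc_Cons[OF \<Phi>] x])
  then show ?thesis
    by (simp add: dd_append dd_Jc[OF cinf_on_dd[OF smooth] x])
qed

lemmas holo_dd1_Jc = holo_dd_Jc[where us="[]" and ws="[]", simplified append.simps]
lemmas holo_dd2_Jc =
  holo_dd_Jc[where us="[]" and ws="[w]", simplified append.simps]
  holo_dd_Jc[where us="[u]" and ws="[]", simplified append.simps] for u w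
lemmas holo_dd3_Jc =
  holo_dd_Jc[where us="[]" and ws="[w, w']", simplified append.simps]
  holo_dd_Jc[where us="[u]" and ws="[w]", simplified append.simps]
  holo_dd_Jc[where us="[u, u']" and ws="[]", simplified append.simps] for u u' w w'

subsection \<open>Holomorphic functions on the ambient space\<close>

definition holo_fun :: "('n::finite amb \<Rightarrow> complex) \<Rightarrow> bool" where
  "holo_fun f \<longleftrightarrow> cinf_on UNIV f \<and> (\<forall>x v. dd [Jc v] f x = \<i> * dd [v] f x)"

lemma holo_fun_add: "holo_fun f \<Longrightarrow> holo_fun g \<Longrightarrow> holo_fun (\<lambda>x. f x + g x)"
  unfolding holo_fun_def by (simp add: cinf_on_add dd_add[of UNIV] distrib_left)

lemma holo_fun_mult: "holo_fun f \<Longrightarrow> holo_fun g \<Longrightarrow> holo_fun (\<lambda>x. f x * g x)"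
  unfolding holo_fun_def by (simp add: cinf_on_mult dd_mult[of UNIV] algebra_simps)

lemma holo_fun_linear: "linear l \<Longrightarrow> (\<And>v. l (Jc v) = \<i> * l v) \<Longrightarrow> holo_fun l"
  unfolding holo_fun_def by (simp add: cinf_on_linear dd_linear_form)

lemma holo_fun_quadratic:
  assumes "bilinear B"
    and "\<And>u v. B (Jc u) v = \<i> * B u v" "\<And>u v. B u (Jc v) = \<i> * B u v"
  shows "holo_fun (\<lambda>x. B x x)"
  unfolding holo_fun_def using assms by (simp add: cinf_on_bilinear_diag dd_quadratic_form distrib_left)

lemma holo_fun_cubic:
  assumes "trilinear T"
    and "\<And>u v w. T (Jc u) v w = \<i> * T u v w" "\<And>u v w. T u (Jc v) w = \<i> * T u v w" "\<And>u v w. T u v (Jc w) = \<i> * T u v w"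
  shows "holo_fun (\<lambda>x. T x x x)"
  unfolding holo_fun_def using assms by (simp add: cinf_on_trilinear_diag dd_cubic_form distrib_left)

lemma holo_on_components:
  fixes F :: "'n::finite amb \<Rightarrow> 'n amb"
  assumes U: "open U" and components: "\<And>j. holo_fun (\<lambda>x. fst (F x) $ j)" "holo_fun (\<lambda>x. snd (F x))"
  shows "holo_on U F"
proof -
  have F: "cinf_on UNIV F"
    by (rule cinf_on_amb) (use components in \<open>simp_all add: holo_fun_def\<close>)
  have "bounded_linear (\<lambda>x :: 'n amb. fst x $ j)" "bounded_linear (\<lambda>x :: 'n amb. snd x)" for j
    by (auto intro!: linearI simp flip: linear_conv_bounded_linear)
  note dd_component = this[THEN dd_bounded_linear_apply[OF F], OF UNIV_I]
  have "dd [Jc v] F x = Jc (dd [v] F x)" for v x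
    using components by (simp add: amb_eq_iff holo_fun_def del: split_paired_All flip: dd_component)
  then show ?thesis
    by (intro holo_onI cinf_on_subset[OF F U]) auto
qed

subsection \<open>Local inverses and level sets\<close>

lemma smooth_local_inverse:
  fixes f :: "'a::euclidean_space \<Rightarrow> 'a"
  assumes f: "cinf_on U f" and x: "x \<in> U" and bij: "bij (\<lambda>v. dd [v] f x)"
  obtains U' V g where "open U'" "U' \<subseteq> U" "x \<in> U'" "open V" "homeomorphism U' V f g"
    "\<And>y. y \<in> V \<Longrightarrow> bij (\<lambda>v. dd [v] f (g y))"
    "\<And>y. y \<in> V \<Longrightarrow> (g has_derivative inv (\<lambda>v. dd [v] f (g y))) (at y)"
proof -
  define f' where "f' x = Blinfun (\<lambda>v. dd [v] f x)" for x
  have apply_f': "blinfun_apply (f' x) = (\<lambda>v. dd [v] f x)" if "x \<in> U" for x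
    unfolding f'_def by (rule bounded_linear_Blinfun_apply)
      (rule has_derivative_bounded_linear[OF cinf_on_has_derivative[OF f that]])
  have "continuous_on U f'"
  proof (rule continuous_on_blinfun_componentwise)
    show "continuous_on U (\<lambda>x. blinfun_apply (f' x) i)" for i
      by (rule continuous_on_eq[OF cinf_on_continuous_dd[OF f, of "[i]"]]) (simp add: apply_f')
  qed
  moreover have "(f has_derivative blinfun_apply (f' x)) (at x)" if "x \<in> U" for x
    unfolding apply_f'[OF that] by (rule cinf_on_has_derivative[OF f that])
  moreover have "Blinfun (inv (\<lambda>v. dd [v] f x)) o\<^sub>L f' x = id_blinfun"
  proof (rule blinfun_eqI)
    fix v
    have "linear (inv (\<lambda>v. dd [v] f x))"
      by (rule inj_linear_imp_inv_linear[OF linear_dd[OF f x] bij_is_inj[OF bij]])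
    then have "blinfun_apply (Blinfun (inv (\<lambda>v. dd [v] f x))) = inv (\<lambda>v. dd [v] f x)"
      by (intro bounded_linear_Blinfun_apply) (simp add: linear_conv_bounded_linear)
    then show "blinfun_apply (Blinfun (inv (\<lambda>v. dd [v] f x)) o\<^sub>L f' x) v = blinfun_apply id_blinfun v"
      using inv_f_f[OF bij_is_inj[OF bij], of v] by (simp add: apply_f'[OF x])
  qed
  ultimately obtain U' V g g' where inverse: "open U'" "U' \<subseteq> U" "x \<in> U'" "open V" "homeomorphism U' V f g"
    "\<And>y. y \<in> V \<Longrightarrow> (g has_derivative (g' y)) (at y)"
    "\<And>y. y \<in> V \<Longrightarrow> g' y = inv (blinfun_apply (f'(g y)))"
    "\<And>y. y \<in> V \<Longrightarrow> bij (blinfun_apply (f'(g y)))"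
    using inverse_function_theorem[OF cinf_on_open[OF f] _ _ x, of f f' "Blinfun (inv (\<lambda>v. dd [v] f x))"] by metis
  have "g y \<in> U" if "y \<in> V" for y
    using inverse(2,5) that unfolding homeomorphism_def by blast
  then show ?thesis using that[OF inverse(1-5)] inverse(6-8) by (simp add: apply_f')
qed

lemma hol_coords_local:
  assumes \<Phi>: "holo_on U \<Phi>" and p: "p \<in> U" and bij: "bij (\<lambda>v. dd [v] \<Phi> p)"
  obtains U' where "p \<in> U'" "U' \<subseteq> U" "hol_coords U' \<Phi>"
proof -
  obtain U' V g where U': "open U'" "U' \<subseteq> U" "p \<in> U'" and V: "open V" and hom: "homeomorphism U' V \<Phi> g"
    and d\<Phi>: "\<And>y. y \<in> V \<Longrightarrow> bij (\<lambda>v. dd [v] \<Phi> (g y))"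
    and dg: "\<And>y. y \<in> V \<Longrightarrow> (g has_derivative inv (\<lambda>v. dd [v] \<Phi> (g y))) (at y)"
    using smooth_local_inverse[OF cinf_on_holo[OF \<Phi>] p bij] by metis
  have img: "\<Phi> ` U' = V" and g: "\<And>x. x \<in> U' \<Longrightarrow> g (\<Phi> x) = x" "\<And>y. y \<in> V \<Longrightarrow> g y \<in> U'"
    using hom by (auto simp: homeomorphism_def)
  have "holo_on V g"
    unfolding holo_on_def
  proof (intro conjI ballI)
    fix y assume y: "y \<in> V"
    let ?D = "\<lambda>v. dd [v] \<Phi> (g y)"
    have "inv ?D (Jc v) = Jc (inv ?D v)" for v
    proof -
      have "?D (Jc (inv ?D v)) = Jc (?D (inv ?D v))"
        by (rule holo_dd1_Jc[OF \<Phi>]) (use g(2)[OF y] U'(2) in blast)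
      also have "?D (inv ?D v) = v" by (rule surj_f_inv_f[OF bij_is_surj[OF d\<Phi>[OF y]]])
      finally show ?thesis using inv_f_f[OF bij_is_inj[OF d\<Phi>[OF y]]] by metis
    qed
    then show "\<exists>D. (g has_derivative D) (at y) \<and> (\<forall>v. D (Jc v) = Jc (D v))"
      using dg[OF y] by blast
  qed (rule V)
  moreover have "inj_on \<Phi> U'" using g(1) by (rule inj_on_inverseI)
  ultimately have "hol_coords U' \<Phi>"
    unfolding hol_coords_def img using holo_on_subset[OF \<Phi> U'(1,2)] V g(1) by blast
  then show ?thesis using that U'(2,3) by blast
qed

lemma rank_one_perturbation_inverse:
  fixes \<phi> l :: "'a::real_vector \<Rightarrow> real"
  assumes "linear \<phi>" "linear l" "l e = 1" "\<phi> e \<noteq> 0"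
  defines "D \<equiv> \<lambda>v. v + (\<phi> v - l v) *\<^sub>R e" and "E \<equiv> \<lambda>v. v + ((l v - \<phi> v) / \<phi> e) *\<^sub>R e"
  shows "bij D" "inv D = E"
proof -
  note expand = linear_add[OF assms(1)] linear_scale[OF assms(1)] linear_add[OF assms(2)] linear_scale[OF assms(2)]
  have right_inverse: "D (E v) = v" for v
    using assms(3,4) by (simp add: D_def E_def expand flip: scaleR_add_left)
  moreover have left_inverse: "E (D v) = v" for v
    using assms(3,4) by (simp add: D_def E_def expand add_divide_distrib diff_divide_distrib flip: scaleR_add_left)
  ultimately show "bij D" by (intro bij_betw_byWitness[of _ E]) auto
  show "inv D = E" by (rule inv_equality) (simp_all add: left_inverse right_inverse)
qed

lemma cinf_on_autonomous:
  fixes g :: "'a::real_normed_vector \<Rightarrow> 'b::euclidean_space"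
  assumes V: "open V" and U: "open U" and mem: "\<And>y. y \<in> V \<Longrightarrow> g y \<in> U"
    and der: "\<And>y. y \<in> V \<Longrightarrow> (g has_derivative (\<lambda>v. H v (g y))) (at y)" and H: "\<And>v. cinf_on U (H v)"
  shows "cinf_on V g"
proof (rule cinf_on_coinduct[where P="\<lambda>h. \<exists>k. cinf_on U k \<and> h = (\<lambda>y. k (g y))"])
  show "\<exists>k. cinf_on U k \<and> g = (\<lambda>y. k (g y))" using cinf_on_ident[OF U] by blast
  fix h :: "'a \<Rightarrow> 'b" assume "\<exists>k. cinf_on U k \<and> h = (\<lambda>y. k (g y))"
  then obtain k where k: "cinf_on U k" "h = (\<lambda>y. k (g y))" by blast
  have "continuous_on V g"
    using der has_derivative_continuous continuous_at_imp_continuous_on by blast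
  then show "continuous_on V h"
    unfolding k(2) by (rule continuous_on_compose2[OF cinf_on_continuous[OF k(1)]]) (use mem in auto)
  fix v
  have "((\<lambda>t. h (y + t *\<^sub>R v)) has_vector_derivative dd [H v (g y)] k (g y)) (at 0)" if y: "y \<in> V" for y
    unfolding k(2) using has_derivative_along_line[OF has_derivative_compose[OF der[OF y]
        cinf_on_has_derivative[OF k(1) mem[OF y]]]] .
  moreover have "cinf_on U (\<lambda>z. dd [H v z] k z)" by (rule cinf_on_dd_field[OF H k(1)])
  ultimately show "\<exists>h'. (\<exists>k. cinf_on U k \<and> h' = (\<lambda>y. k (g y))) \<and>
      (\<forall>y\<in>V. ((\<lambda>t. h (y + t *\<^sub>R v)) has_vector_derivative h' y) (at 0))"
    by (intro exI[of _ "\<lambda>y. dd [H v (g y)] k (g y)"]) blast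
qed (rule V)

lemma
  fixes f l :: "'a::euclidean_space \<Rightarrow> real"
  assumes f: "cinf_on U f" and l: "linear l"
  shows cinf_on_level_chart: "cinf_on U (\<lambda>y. y + (f y - l y) *\<^sub>R e)"
    and dd_level_chart: "x \<in> U \<Longrightarrow> dd [v] (\<lambda>y. y + (f y - l y) *\<^sub>R e) x = v + (dd [v] f x - l v) *\<^sub>R e"
proof -
  note U = cinf_on_open[OF f]
  show "cinf_on U (\<lambda>y. y + (f y - l y) *\<^sub>R e)"
    by (intro cinf_on_add cinf_on_ident cinf_on_scaleR cinf_on_diff f cinf_on_linear l cinf_on_const U)
  have "bounded_linear l" using l by (simp add: linear_conv_bounded_linear)
  then show "dd [v] (\<lambda>y. y + (f y - l y) *\<^sub>R e) x = v + (dd [v] f x - l v) *\<^sub>R e" if "x \<in> U"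
    by (intro has_derivative_imp_dd)
      (auto intro!: derivative_eq_intros cinf_on_has_derivative[OF f that] bounded_linear_imp_has_derivative)
qed

lemma level_set_straightening:
  fixes f :: "'a::euclidean_space \<Rightarrow> real"
  assumes f: "cinf_on U f" and x: "x \<in> U" and l: "linear l" "l e = 1" and transversal: "dd [e] f x \<noteq> 0"
  obtains U' V g where "open U'" "U' \<subseteq> U" "x \<in> U'" "open V"
    "homeomorphism U' V (\<lambda>y. y + (f y - l y) *\<^sub>R e) g" "cinf_on V g"
proof -
  define G where "G = (\<lambda>y. y + (f y - l y) *\<^sub>R e)"
  define W where "W = dd [e] f -` (- {0}) \<inter> U"
  have W: "open W" "W \<subseteq> U" "x \<in> W"
    using continuous_on_open_vimage[OF cinf_on_open[OF f]] cinf_on_continuous_dd[OF f] x transversal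
      open_Compl[OF closed_singleton] unfolding W_def by blast+
  have smooth: "cinf_on W f" by (rule cinf_on_subset[OF f W(1,2)])
  note G = cinf_on_level_chart[OF smooth l(1), of e, folded G_def]
      dd_level_chart[OF smooth l(1), where e=e, folded G_def]
  have inverse_dG: "bij (\<lambda>v. dd [v] G y)"
    "inv (\<lambda>v. dd [v] G y) = (\<lambda>v. v + ((l v - dd [v] f y) / dd [e] f y) *\<^sub>R e)" if "y \<in> W" for y
    using rank_one_perturbation_inverse[OF linear_dd[OF smooth that] l] that by (simp_all add: G(2) W_def)
  obtain U' V g where U': "open U'" "U' \<subseteq> W" "x \<in> U'" and V: "open V" and hom: "homeomorphism U' V G g"
    and dg: "\<And>y. y \<in> V \<Longrightarrow> (g has_derivative inv (\<lambda>v. dd [v] G (g y))) (at y)"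
    using smooth_local_inverse[OF G(1) W(3) inverse_dG(1)[OF W(3)]] by metis
  have range: "g y \<in> U'" "g y \<in> W" if "y \<in> V" for y
    using hom U'(2) that by (auto simp: homeomorphism_def)
  have "cinf_on V g"
  proof (rule cinf_on_autonomous[OF V U'(1) range(1)])
    show "(g has_derivative (\<lambda>v. v + ((l v - dd [v] f (g y)) / dd [e] f (g y)) *\<^sub>R e)) (at y)" if "y \<in> V" for y
      using dg[OF that] by (simp add: inverse_dG(2)[OF range(2)[OF that]])
    show "cinf_on U' (\<lambda>z. v + ((l v - dd [v] f z) / dd [e] f z) *\<^sub>R e)" for v
      by (intro cinf_on_add cinf_on_scaleR cinf_on_divide cinf_on_diff cinf_on_const cinf_on_dd
          cinf_on_subset[OF smooth U'(1,2)] U'(1)) (use U'(2) in \<open>auto simp: W_def\<close>)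
  qed
  then show ?thesis using that[of U' V g] U' V hom W(2) by (auto simp: G_def)
qed

definition graph_base :: "'n::finite amb \<Rightarrow> (complex ^ 'n) \<times> real" where
  "graph_base Z = (fst Z, Re (snd Z))"

definition graph_point :: "((complex ^ 'n::finite) \<times> real \<Rightarrow> real) \<Rightarrow> (complex ^ 'n) \<times> real \<Rightarrow> 'n amb" where
  "graph_point \<phi> x = (fst x, Complex (snd x) (\<phi> x))"

lemma linear_graph_base: "linear graph_base"
  by (rule linearI) (auto simp: graph_base_def)

lemma graph_base_0 [simp]: "graph_base 0 = 0"
  by (rule linear_0[OF linear_graph_base])

lemma open_vimage_graph_base:
  assumes "open D"
  shows "open (graph_base -` D)"
  using assms linear_continuous_on linear_graph_base
  by (intro open_vimage) (simp_all add: linear_conv_bounded_linear)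

lemma graph_point_graph_base: "graph_point \<phi> (graph_base Z) = Z \<longleftrightarrow> Im (snd Z) = \<phi> (graph_base Z)"
  by (auto simp: graph_point_def graph_base_def prod_eq_iff complex_eq_iff)

definition vertical_straightening :: "('n::finite amb \<Rightarrow> real) \<Rightarrow> 'n amb \<Rightarrow> 'n amb" where
  "vertical_straightening f Z = Z + (f Z - Im (snd Z)) *\<^sub>R (0, \<i>)"

lemma vertical_straightening_eq_iff:
  "vertical_straightening f Z = graph_point (\<lambda>x. 0) x \<longleftrightarrow> graph_base Z = x \<and> f Z = 0"
  by (auto simp: vertical_straightening_def graph_point_def graph_base_def prod_eq_iff complex_eq_iff)

definition implicit_height :: "('n::finite amb \<Rightarrow> 'n amb) \<Rightarrow> (complex ^ 'n) \<times> real \<Rightarrow> real" where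
  "implicit_height g x = Im (snd (g (graph_point (\<lambda>x. 0) x)))"

lemma
  assumes hom: "homeomorphism U V (vertical_straightening f) g"
  shows implicit_height_point: "graph_point (\<lambda>x. 0) x \<in> V \<Longrightarrow>
      graph_point (implicit_height g) x \<in> U \<and> f (graph_point (implicit_height g) x) = 0"
    and vertical_straightening_zero: "Z \<in> U \<Longrightarrow> f Z = 0 \<Longrightarrow>
      graph_point (\<lambda>x. 0) (graph_base Z) \<in> V \<and> implicit_height g (graph_base Z) = Im (snd Z)"
proof -
  show "graph_point (implicit_height g) x \<in> U \<and> f (graph_point (implicit_height g) x) = 0"
      if x: "graph_point (\<lambda>x. 0) x \<in> V"
  proof -
    let ?Z = "g (graph_point (\<lambda>x. 0) x)"
    have Z: "?Z \<in> U" "vertical_straightening f ?Z = graph_point (\<lambda>x. 0) x"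
      using hom x by (auto simp: homeomorphism_def)
    then have "graph_base ?Z = x" "f ?Z = 0" by (simp_all add: vertical_straightening_eq_iff)
    moreover from this have "graph_point (implicit_height g) x = ?Z"
      using graph_point_graph_base[of "implicit_height g" ?Z] by (simp add: implicit_height_def)
    ultimately show ?thesis using Z(1) by simp
  qed
  show "graph_point (\<lambda>x. 0) (graph_base Z) \<in> V \<and> implicit_height g (graph_base Z) = Im (snd Z)"
      if Z: "Z \<in> U" "f Z = 0"
  proof -
    have "vertical_straightening f Z = graph_point (\<lambda>x. 0) (graph_base Z)"
      by (simp add: vertical_straightening_eq_iff Z(2))
    moreover have "vertical_straightening f Z \<in> V" "g (vertical_straightening f Z) = Z"
      using hom Z(1) by (auto simp: homeomorphism_def)
    ultimately show ?thesis by (simp add: implicit_height_def)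
  qed
qed

lemma implicit_graph:
  fixes f :: "'n::finite amb \<Rightarrow> real"
  assumes f: "cinf_on V f" and mem: "0 \<in> V" and f_0: "f 0 = 0" and transversal: "dd [(0, \<i>)] f 0 \<noteq> 0"
  obtains U D \<phi> where "open U" "0 \<in> U" "U \<subseteq> V" "cinf_on D \<phi>" "0 \<in> D" "\<phi> 0 = 0"
    "\<And>x. x \<in> D \<Longrightarrow> graph_point \<phi> x \<in> V" "\<And>x. x \<in> D \<Longrightarrow> f (graph_point \<phi> x) = 0"
    "\<And>Z. Z \<in> U \<Longrightarrow> graph_base Z \<in> D"
    "\<And>Z. Z \<in> U \<Longrightarrow> f Z = 0 \<longleftrightarrow> Im (snd Z) = \<phi> (graph_base Z)"
proof -
  have height: "linear (\<lambda>Z :: 'n amb. Im (snd Z))" by (rule linearI) auto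
  from level_set_straightening[OF f mem this, of "(0, \<i>)"] transversal
  obtain U' V' g where U': "open U'" "U' \<subseteq> V" "0 \<in> U'" and V': "open V'"
    and hom: "homeomorphism U' V' (vertical_straightening f) g" and g: "cinf_on V' g"
    by (auto simp: vertical_straightening_def[abs_def])
  define \<iota> where "\<iota> = graph_point (\<lambda>x :: (complex ^ 'n) \<times> real. 0)"
  have \<iota>: "linear \<iota>" by (rule linearI) (simp_all add: \<iota>_def graph_point_def complex_eq_iff)
  define D where "D = \<iota> -` V'"
  have D: "open D" unfolding D_def
    by (rule open_vimage[OF V']) (use linear_continuous_on \<iota> in \<open>simp add: linear_conv_bounded_linear\<close>)
  define \<phi> where "\<phi> = implicit_height g"
  have \<phi>: "cinf_on D \<phi>"
    unfolding \<phi>_def implicit_height_def[abs_def] \<iota>_def[symmetric]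
    by (intro cinf_on_compose[OF cinf_on_linear[OF open_UNIV height]] cinf_on_compose[OF g cinf_on_linear[OF D \<iota>]])
      (simp_all add: D_def)
  have graph: "graph_point \<phi> x \<in> U'" "f (graph_point \<phi> x) = 0" if "x \<in> D" for x
    using implicit_height_point[OF hom, of x] that by (simp_all add: D_def \<iota>_def \<phi>_def)
  have "0 \<in> D" "\<phi> 0 = 0"
    using vertical_straightening_zero[OF hom U'(3) f_0] by (simp_all add: D_def \<iota>_def \<phi>_def)
  moreover have "f Z = 0 \<longleftrightarrow> Im (snd Z) = \<phi> (graph_base Z)" if "Z \<in> U' \<inter> graph_base -` D" for Z
  proof
    show "Im (snd Z) = \<phi> (graph_base Z)" if "f Z = 0"
      using vertical_straightening_zero[OF hom _ that] \<open>Z \<in> _\<close> by (simp add: \<phi>_def)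
    assume "Im (snd Z) = \<phi> (graph_base Z)"
    then have "graph_point \<phi> (graph_base Z) = Z" by (simp add: graph_point_graph_base)
    then show "f Z = 0" using graph(2)[of "graph_base Z"] that by simp
  qed
  moreover have "graph_point \<phi> x \<in> V" if "x \<in> D" for x using graph(1)[OF that] U'(2) by blast
  moreover have "open (U' \<inter> graph_base -` D)" "0 \<in> U' \<inter> graph_base -` D" "U' \<inter> graph_base -` D \<subseteq> V"
    using U' \<open>0 \<in> D\<close> open_vimage_graph_base[OF D] by auto
  ultimately show ?thesis using that[of "U' \<inter> graph_base -` D" D \<phi>] \<phi> graph(2) by blast
qed

subsection \<open>Complex parts of real multilinear forms\<close>

text \<open>For the complex multilinear extensions of \<open>B\<close> and \<open>T\<close>, \<open>hol_bilinear B u v\<close> is the value at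
  \<open>u - \<i> J u\<close>, \<open>v - \<i> J v\<close>, \<open>levi_form B u v\<close> the value at \<open>u + \<i> J u\<close>, \<open>v - \<i> J v\<close>, and
  \<open>levi_cubic T u v w\<close> the value at \<open>u + \<i> J u\<close>, \<open>v + \<i> J v\<close>, \<open>w - \<i> J w\<close>.\<close>

definition hol_linear :: "('n::finite amb \<Rightarrow> real) \<Rightarrow> 'n amb \<Rightarrow> complex" where
  "hol_linear l u = Complex (l u) (- l (Jc u))"

definition hol_bilinear :: "('n::finite amb \<Rightarrow> 'n amb \<Rightarrow> real) \<Rightarrow> 'n amb \<Rightarrow> 'n amb \<Rightarrow> complex" where
  "hol_bilinear B u v = hol_linear (B u) v - \<i> * hol_linear (B (Jc u)) v"

definition hol_trilinear :: "('n::finite amb \<Rightarrow> 'n amb \<Rightarrow> 'n amb \<Rightarrow> real) \<Rightarrow> 'n amb \<Rightarrow> 'n amb \<Rightarrow> 'n amb \<Rightarrow> complex" where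
  "hol_trilinear T u v w = hol_bilinear (T u) v w - \<i> * hol_bilinear (T (Jc u)) v w"

definition levi_form :: "('n::finite amb \<Rightarrow> 'n amb \<Rightarrow> real) \<Rightarrow> 'n amb \<Rightarrow> 'n amb \<Rightarrow> complex" where
  "levi_form B u v = hol_linear (B u) v + \<i> * hol_linear (B (Jc u)) v"

definition levi_cubic :: "('n::finite amb \<Rightarrow> 'n amb \<Rightarrow> 'n amb \<Rightarrow> real) \<Rightarrow> 'n amb \<Rightarrow> 'n amb \<Rightarrow> 'n amb \<Rightarrow> complex" where
  "levi_cubic T u v w = levi_form (T u) v w + \<i> * levi_form (T (Jc u)) v w"

lemmas bilinear_simps =
  bilinear_ladd bilinear_radd bilinear_lsub bilinear_rsub bilinear_lneg bilinear_rneg bilinear_lmul bilinear_rmul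

lemma trilinear_simps:
  assumes "trilinear T"
  shows "T (t + t') u v = T t u v + T t' u v" "T t (u + u') v = T t u v + T t u' v"
      "T t u (v + v') = T t u v + T t u v'"
    "T (r *\<^sub>R t) u v = r *\<^sub>R T t u v" "T t (r *\<^sub>R u) v = r *\<^sub>R T t u v" "T t u (r *\<^sub>R v) = r *\<^sub>R T t u v"
    "T (- t) u v = - T t u v" "T t (- u) v = - T t u v" "T t u (- v) = - T t u v"
  by (simp_all add: linear_add[OF trilinearD(1)[OF assms]] linear_add[OF trilinearD(2)[OF assms]]
      linear_add[OF trilinearD(3)[OF assms]] linear_scale[OF trilinearD(1)[OF assms]]
      linear_scale[OF trilinearD(2)[OF assms]] linear_scale[OF trilinearD(3)[OF assms]]
      linear_neg[OF trilinearD(1)[OF assms]] linear_neg[OF trilinearD(2)[OF assms]]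
      linear_neg[OF trilinearD(3)[OF assms]])

lemma linear_hol_linear: "linear l \<Longrightarrow> linear (hol_linear l)"
  by (rule linearI) (simp_all add: hol_linear_def Jc_simps linear_add linear_scale complex_eq_iff)

lemma hol_linear_Jc: "linear l \<Longrightarrow> hol_linear l (Jc u) = \<i> * hol_linear l u"
  by (simp add: hol_linear_def Jc_simps linear_neg complex_eq_iff)

lemma levi_form_eq: "levi_form B u v = Complex (B u v + B (Jc u) (Jc v)) (B (Jc u) v - B u (Jc v))"
  by (simp add: levi_form_def hol_linear_def complex_eq_iff)

lemma bilinear_levi_form: "bilinear B \<Longrightarrow> bilinear (levi_form B)"
  unfolding bilinear_def[of "levi_form B"]
  by (intro conjI allI linearI) (simp_all add: levi_form_eq Jc_simps bilinear_simps complex_eq_iff algebra_simps)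

lemma bilinear_hol_bilinear: "bilinear B \<Longrightarrow> bilinear (hol_bilinear B)"
  unfolding bilinear_def[of "hol_bilinear B"]
  by (intro conjI allI linearI)
    (simp_all add: hol_bilinear_def hol_linear_def Jc_simps bilinear_simps complex_eq_iff algebra_simps)

lemma levi_form_Jc:
  assumes "bilinear B"
  shows "levi_form B (Jc u) v = - \<i> * levi_form B u v" "levi_form B u (Jc v) = \<i> * levi_form B u v"
  by (simp_all add: levi_form_eq Jc_simps bilinear_simps[OF assms] complex_eq_iff)

lemma hol_bilinear_Jc:
  assumes "bilinear B"
  shows "hol_bilinear B (Jc u) v = \<i> * hol_bilinear B u v" "hol_bilinear B u (Jc v) = \<i> * hol_bilinear B u v"
  by (simp_all add: hol_bilinear_def hol_linear_def Jc_simps bilinear_simps[OF assms] complex_eq_iff)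

lemma levi_form_hermitian:
  assumes "\<And>u v. B u v = B v u"
  shows "levi_form B v u = cnj (levi_form B u v)"
  using assms[of u "Jc v"] assms[of "Jc u"] assms[of u v] by (simp add: levi_form_eq complex_eq_iff)

lemma bilinear_form_decomposition:
  "B u u = Re (hol_bilinear B u u) / 2 + Re (levi_form B u u) / 2"
  by (simp add: hol_bilinear_def hol_linear_def levi_form_eq field_simps)

lemma trilinear_levi_cubic:
  assumes "trilinear T"
  shows "trilinear (levi_cubic T)"
  unfolding trilinear_def[of "levi_cubic T"]
  by (intro conjI allI linearI)
    (simp_all add: levi_cubic_def levi_form_eq Jc_simps trilinear_simps[OF assms] complex_eq_iff algebra_simps)

lemma trilinear_hol_trilinear:
  assumes "trilinear T"
  shows "trilinear (hol_trilinear T)"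
  unfolding trilinear_def[of "hol_trilinear T"]
  by (intro conjI allI linearI)
    (simp_all add: hol_trilinear_def hol_bilinear_def hol_linear_def Jc_simps trilinear_simps[OF assms]
        complex_eq_iff algebra_simps)

lemma levi_cubic_Jc:
  assumes "trilinear T"
  shows "levi_cubic T (Jc u) v w = - \<i> * levi_cubic T u v w" "levi_cubic T u (Jc v) w = - \<i> * levi_cubic T u v w"
    "levi_cubic T u v (Jc w) = \<i> * levi_cubic T u v w"
  by (simp_all add: levi_cubic_def levi_form_eq Jc_simps trilinear_simps[OF assms] complex_eq_iff)

lemma hol_trilinear_Jc:
  assumes "trilinear T"
  shows "hol_trilinear T (Jc u) v w = \<i> * hol_trilinear T u v w"
      "hol_trilinear T u (Jc v) w = \<i> * hol_trilinear T u v w"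
    "hol_trilinear T u v (Jc w) = \<i> * hol_trilinear T u v w"
  by (simp_all add: hol_trilinear_def hol_bilinear_def hol_linear_def Jc_simps trilinear_simps[OF assms]
      complex_eq_iff)

lemma trilinear_form_decomposition:
  assumes "\<And>u v w. T u v w = T v u w" "\<And>u v w. T u v w = T u w v"
  shows "T u u u = Re (hol_trilinear T u u u) / 4 + 3 / 4 * Re (levi_cubic T u u u)"
proof -
  have "T (Jc u) u (Jc u) = T (Jc u) (Jc u) u" "T u (Jc u) (Jc u) = T (Jc u) (Jc u) u"
    using assms by metis+
  then show ?thesis
    by (simp add: hol_trilinear_def hol_bilinear_def hol_linear_def levi_cubic_def levi_form_eq field_simps)
qed

lemma levi_form_scaleC:
  assumes "bilinear B"
  shows "levi_form B (a *\<^sub>C u) v = cnj a * levi_form B u v" "levi_form B u (a *\<^sub>C v) = a * levi_form B u v"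
  by (simp_all add: scaleC_eq_Jc bilinear_simps[OF bilinear_levi_form[OF assms]] levi_form_Jc[OF assms]
      complex_eq_iff)

lemma levi_form_sum_scaleC:
  assumes B: "bilinear B"
  shows "levi_form B (\<Sum>i\<in>I. a i *\<^sub>C u i) (\<Sum>j\<in>J. b j *\<^sub>C v j) =
    (\<Sum>i\<in>I. \<Sum>j\<in>J. cnj (a i) * b j * levi_form B (u i) (v j))"
  unfolding linear_sum[OF bilinearD(1)[OF bilinear_levi_form[OF B]]]
  unfolding linear_sum[OF bilinearD(2)[OF bilinear_levi_form[OF B]]]
  by (simp add: levi_form_scaleC[OF B] mult_ac)

lemma levi_cubic_scaleC:
  assumes "trilinear T"
  shows "levi_cubic T (a *\<^sub>C u) v w = cnj a * levi_cubic T u v w"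
      "levi_cubic T u (a *\<^sub>C v) w = cnj a * levi_cubic T u v w"
    "levi_cubic T u v (a *\<^sub>C w) = a * levi_cubic T u v w"
  by (simp_all add: scaleC_eq_Jc trilinear_simps[OF trilinear_levi_cubic[OF assms]] levi_cubic_Jc[OF assms]
      complex_eq_iff)

lemma levi_cubic_sum_scaleC:
  assumes T: "trilinear T"
  shows "levi_cubic T (\<Sum>i\<in>I. a i *\<^sub>C u i) (\<Sum>j\<in>J. b j *\<^sub>C v j) (\<Sum>k\<in>K. c k *\<^sub>C w k) =
    (\<Sum>i\<in>I. \<Sum>j\<in>J. \<Sum>k\<in>K. levi_cubic T (u i) (v j) (w k) * cnj (a i) * cnj (b j) * c k)"
  unfolding linear_sum[OF trilinearD(1)[OF trilinear_levi_cubic[OF T]]]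
  unfolding linear_sum[OF trilinearD(2)[OF trilinear_levi_cubic[OF T]]]
  unfolding linear_sum[OF trilinearD(3)[OF trilinear_levi_cubic[OF T]]]
  by (simp add: levi_cubic_scaleC[OF T] mult_ac)

lemma levi_cubic_symmetric:
  assumes "\<And>u v w. T u v w = T v u w"
  shows "levi_cubic T v u w = levi_cubic T u v w"
  using assms[of "Jc u" v] assms[of u "Jc v"] assms[of u v] assms[of "Jc u" "Jc v"]
  by (simp add: levi_cubic_def levi_form_eq complex_eq_iff)

lemma amb_axis_sum: "(z, 0) = (\<Sum>\<alpha>\<in>UNIV. z $ \<alpha> *\<^sub>C (axis \<alpha> 1, 0))"
  by (simp add: amb_eq_iff fst_sum snd_sum axis_def if_distrib[of "(*) _"] cong: if_cong)

subsection \<open>Smoothness of the operators on vector fields and forms\<close>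

lemma cinf_on_Complex:
  fixes a b :: "'a::real_normed_vector \<Rightarrow> real"
  assumes "cinf_on U a" "cinf_on U b"
  shows "cinf_on U (\<lambda>y. Complex (a y) (b y))"
  unfolding Complex_eq
  by (intro cinf_on_add cinf_on_mult cinf_on_const cinf_on_open[OF assms(1)]
      cinf_on_bounded_linear_apply[OF _ bounded_linear_of_real] assms)

lemma dd_Complex:
  fixes a b :: "'a::euclidean_space \<Rightarrow> real"
  assumes "cinf_on U a" "cinf_on U b" "x \<in> U"
  shows "dd [v] (\<lambda>y. Complex (a y) (b y)) x = Complex (dd [v] a x) (dd [v] b x)"
  unfolding Complex_eq
  by (rule has_derivative_imp_dd)
    (intro has_derivative_add has_derivative_mult_right has_derivative_of_real
      cinf_on_has_derivative[OF assms(1,3)] cinf_on_has_derivative[OF assms(2,3)])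

lemma thform_eq: "thform c X = (\<lambda>y. Complex (c y \<bullet> fst X y) (c y \<bullet> snd X y))"
  by (rule ext) (simp add: thform_def)

lemma cinf_on_thform: "cinf_on U c \<Longrightarrow> cinf_on U (fst X) \<Longrightarrow> cinf_on U (snd X) \<Longrightarrow> cinf_on U (thform c X)"
  unfolding thform_eq by (intro cinf_on_Complex cinf_on_inner)

lemma cinf_on_act:
  fixes f :: "'a::euclidean_space \<Rightarrow> complex"
  assumes "cinf_on U (fst X)" "cinf_on U (snd X)" "cinf_on U f"
  shows "cinf_on U (act X f)"
  unfolding act_def[abs_def]
  by (intro cinf_on_add cinf_on_mult cinf_on_const cinf_on_open[OF assms(1)] cinf_on_dd_field assms)

lemma cinf_on_rbr:
  fixes V W :: "'a::euclidean_space \<Rightarrow> 'a"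
  shows "cinf_on U V \<Longrightarrow> cinf_on U W \<Longrightarrow> cinf_on U (rbr V W)"
  unfolding rbr_def[abs_def] by (intro cinf_on_diff cinf_on_dd_field)

lemma cinf_on_br:
  fixes X Y :: "'a::euclidean_space cvf"
  assumes "cinf_on U (fst X)" "cinf_on U (snd X)" "cinf_on U (fst Y)" "cinf_on U (snd Y)"
  shows "cinf_on U (fst (br X Y))" "cinf_on U (snd (br X Y))"
  unfolding br_def fst_conv snd_conv by (intro cinf_on_add cinf_on_diff cinf_on_rbr assms)+

lemma cinf_on_Top:
  fixes L X :: "'a::euclidean_space cvf"
  assumes "cinf_on U c" "cinf_on U (fst L)" "cinf_on U (snd L)" "cinf_on U (fst X)" "cinf_on U (snd X)"
  shows "cinf_on U (Top L (thform c) X)"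
proof -
  have "cinf_on U (\<lambda>x. (act L (thform c X) x - act X (thform c L) x - thform c (br L X) x) * inverse (2 * \<i>))"
    by (intro cinf_on_mult cinf_on_diff cinf_on_act cinf_on_thform cinf_on_br cinf_on_const
        cinf_on_open[OF assms(1)] assms)
  then show ?thesis unfolding Top_def[abs_def] divide_inverse .
qed

definition ext_deriv :: "('a::real_inner \<Rightarrow> 'a) \<Rightarrow> ('a \<Rightarrow> 'a) \<Rightarrow> ('a \<Rightarrow> 'a) \<Rightarrow> 'a \<Rightarrow> real" where
  "ext_deriv c V W x = dd [V x] (\<lambda>y. c y \<bullet> W y) x - dd [W x] (\<lambda>y. c y \<bullet> V y) x - c x \<bullet> rbr V W x"

lemma Top_thform_eq_ext_deriv:
  fixes c :: "'a::euclidean_space \<Rightarrow> 'a"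
  assumes c: "cinf_on U c" and L: "cinf_on U (fst L)" "cinf_on U (snd L)"
    and X: "cinf_on U (fst X)" "cinf_on U (snd X)" and x: "x \<in> U"
  shows "2 * \<i> * Top L (thform c) X x =
    Complex (ext_deriv c (fst L) (fst X) x - ext_deriv c (snd L) (snd X) x)
      (ext_deriv c (fst L) (snd X) x + ext_deriv c (snd L) (fst X) x)"
proof -
  have "dd [v] (thform c Y) x = Complex (dd [v] (\<lambda>y. c y \<bullet> fst Y y) x) (dd [v] (\<lambda>y. c y \<bullet> snd Y y) x)"
    if "cinf_on U (fst Y)" "cinf_on U (snd Y)" for v Y
    unfolding thform_eq by (intro dd_Complex[OF _ _ x] cinf_on_inner c that)
  then show ?thesis
    using L X by (simp add: Top_def act_def thform_def br_def ext_deriv_def complex_eq_iff inner_diff_right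
        inner_add_right)
qed

subsection \<open>Tangent vectors of a level set\<close>

definition grad :: "('a::euclidean_space \<Rightarrow> real) \<Rightarrow> 'a \<Rightarrow> 'a" where
  "grad f x = (\<Sum>b\<in>Basis. dd [b] f x *\<^sub>R b)"

lemma grad_inner: "cinf_on U f \<Longrightarrow> x \<in> U \<Longrightarrow> grad f x \<bullet> v = dd [v] f x"
  using linear_basis_expand[OF linear_dd, of U f x v]
  by (simp add: grad_def inner_sum_left mult.commute) (simp add: inner_commute)

lemma cinf_on_grad: "cinf_on U f \<Longrightarrow> cinf_on U (grad f)"
  unfolding grad_def by (intro cinf_on_sum cinf_on_scaleR cinf_on_dd cinf_on_const) (auto dest: cinf_on_open)

lemma level_set_curve:
  fixes \<rho> :: "'a::euclidean_space \<Rightarrow> real"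
  assumes \<rho>: "cinf_on U \<rho>" and x: "x \<in> U" and n: "dd [n] \<rho> x \<noteq> 0" and v: "dd [v] \<rho> x = 0"
  obtains \<gamma> where "\<gamma> 0 = x" "(\<gamma> has_vector_derivative v) (at 0)" "\<forall>\<^sub>F t in nhds 0. \<gamma> t \<in> U \<and> \<rho> (\<gamma> t) = \<rho> x"
proof -
  define l where "l = (\<lambda>v. dd [v] \<rho> x)"
  have l: "linear l" unfolding l_def by (rule linear_dd[OF \<rho> x])
  define e where "e = (1 / l n) *\<^sub>R n"
  have e: "l e = 1" using n by (simp add: e_def l_def linear_scale[OF l, unfolded l_def])
  define G where "G = (\<lambda>y. y + (\<rho> y - l y) *\<^sub>R e)"
  obtain U' V g where U': "open U'" "U' \<subseteq> U" "x \<in> U'" and V: "open V" and hom: "homeomorphism U' V G g"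
      and g: "cinf_on V g"
    using level_set_straightening[OF \<rho> x l e, folded G_def] e by (metis l_def zero_neq_one)
  have left_inverse: "g (G y) = y" "G y \<in> V" if "y \<in> U'" for y using hom that by (auto simp: homeomorphism_def)
  have right_inverse: "G (g y) = y" "g y \<in> U" if "y \<in> V" for y using hom U' that by (auto simp: homeomorphism_def)
  have l_G: "l (G y) = \<rho> y" for y by (simp add: G_def linear_add[OF l] linear_scale[OF l] e)
  note \<rho>' = cinf_on_subset[OF \<rho> U'(1,2)]
  have "dd [v] G x = v"
    unfolding G_def dd_level_chart[OF \<rho> l x] by (simp add: l_def)
  moreover have "dd [dd [v] G x] g (G x) = dd [v] (\<lambda>y. g (G y)) x"
    using dd_compose[OF g cinf_on_level_chart[OF \<rho>' l, of e, folded G_def] left_inverse(2) U'(3)] by simp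
  ultimately have "dd [v] g (G x) = v"
    using dd_cong[OF U'(1) left_inverse(1) U'(3), where vs="[v]"] by (simp add: dd_ident)
  then have derivative: "((\<lambda>t. g (G x + t *\<^sub>R v)) has_vector_derivative v) (at 0)"
    using cinf_on_deriv[OF g left_inverse(2)[OF U'(3)], of "[]" v] by simp
  show ?thesis
  proof (rule that[OF _ derivative])
    show "g (G x + 0 *\<^sub>R v) = x" by (simp add: left_inverse(1)[OF U'(3)])
    show "\<forall>\<^sub>F t in nhds 0. g (G x + t *\<^sub>R v) \<in> U \<and> \<rho> (g (G x + t *\<^sub>R v)) = \<rho> x"
      using eventually_line_mem[OF V left_inverse(2)[OF U'(3)], of v]
    proof eventually_elim
      case (elim t)
      have "\<rho> (g (G x + t *\<^sub>R v)) = l (G x + t *\<^sub>R v)" using l_G right_inverse(1)[OF elim] by metis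
      then show ?case using v right_inverse(2)[OF elim]
        by (simp add: linear_add[OF l] linear_scale[OF l] l_G) (simp add: l_def)
    qed
  qed
qed

definition tangent_field :: "'a::real_normed_vector set \<Rightarrow> 'a set \<Rightarrow> ('a \<Rightarrow> 'a) \<Rightarrow> bool" where
  "tangent_field M U F \<longleftrightarrow> cinf_on U F \<and> (\<forall>x\<in>M \<inter> U. tangent_vec M x (F x))"

lemma tangent_fieldD:
  assumes "tangent_field M U F"
  shows "cinf_on U F" "x \<in> M \<inter> U \<Longrightarrow> tangent_vec M x (F x)"
  using assms by (auto simp: tangent_field_def)

lemma char_form_subset: "char_form M U c \<Longrightarrow> open V \<Longrightarrow> V \<subseteq> U \<Longrightarrow> char_form M V c"
  unfolding char_form_def by (blast intro: cinf_on_subset)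

lemma CR_field_subset: "CR_field M U L \<Longrightarrow> open V \<Longrightarrow> V \<subseteq> U \<Longrightarrow> CR_field M V L"
  unfolding CR_field_def by (blast intro: cinf_on_subset)

lemma CR_fieldD:
  assumes "CR_field M U L"
  shows "tangent_field M U (fst L)" "tangent_field M U (\<lambda>x. Jc (fst L x))" "cinf_on U (snd L)"
    "x \<in> M \<inter> U \<Longrightarrow> snd L x = Jc (fst L x)"
  using assms by (auto simp: CR_field_def tangent_field_def cinf_on_Jc)

locale hypersurface_nbhd =
  fixes M U :: "'n::finite amb set" and \<rho> :: "'n amb \<Rightarrow> real"
  assumes smooth: "cinf_on U \<rho>"
    and nondeg: "x \<in> U \<Longrightarrow> \<exists>v. dd [v] \<rho> x \<noteq> 0"
    and zero: "M \<inter> U = {x \<in> U. \<rho> x = 0}"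
begin

abbreviation "hessian x \<equiv> (\<lambda>u v. dd [u, v] \<rho> x)"
abbreviation "third_deriv x \<equiv> (\<lambda>u v w. dd [u, v, w] \<rho> x)"

lemma open_U: "open U"
  by (rule cinf_on_open[OF smooth])

lemma mem_iff: "x \<in> U \<Longrightarrow> x \<in> M \<longleftrightarrow> \<rho> x = 0"
  using zero by blast

lemma tangent_if_dd_zero:
  assumes x: "x \<in> M \<inter> U" and v: "dd [v] \<rho> x = 0"
  shows "tangent_vec M x v"
  unfolding tangent_vec_def
proof (intro allI impI)
  fix W :: "'n amb set" and f :: "'n amb \<Rightarrow> real"
  assume "x \<in> W \<and> cinf_on W f \<and> (\<forall>y\<in>M \<inter> W. f y = 0)"
  then have W: "x \<in> W" "cinf_on W f" "\<And>y. y \<in> M \<inter> W \<Longrightarrow> f y = 0" by blast+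
  have xU: "x \<in> U" and "\<rho> x = 0" using x mem_iff[of x] by auto
  obtain n where n: "dd [n] \<rho> x \<noteq> 0" using nondeg[OF xU] by blast
  obtain \<gamma> where \<gamma>: "\<gamma> 0 = x" "(\<gamma> has_vector_derivative v) (at 0)" "\<forall>\<^sub>F t in nhds 0. \<gamma> t \<in> U \<and> \<rho> (\<gamma> t) = \<rho> x"
    by (rule level_set_curve[OF smooth xU n v])
  have "(f has_derivative (\<lambda>v. dd [v] f x)) (at (\<gamma> 0))"
    using cinf_on_has_derivative[OF W(2,1)] by (simp add: \<gamma>(1))
  from has_derivative_compose[OF \<gamma>(2)[unfolded has_vector_derivative_def] this]
  have "((\<lambda>t. f (\<gamma> t)) has_vector_derivative dd [v] f x) (at 0)"
    by (simp add: has_vector_derivative_def linear_scale[OF linear_dd[OF W(2,1)]])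
  moreover have "(\<gamma> \<longlongrightarrow> \<gamma> 0) (nhds 0)"
    using has_vector_derivative_continuous[OF \<gamma>(2)] by (simp only: continuous_at tendsto_at_iff_tendsto_nhds)
  then have "\<forall>\<^sub>F t in nhds 0. \<gamma> t \<in> W"
    by (rule topological_tendstoD) (simp_all add: \<gamma>(1) W(1) cinf_on_open[OF W(2)])
  with \<gamma>(3) have "\<forall>\<^sub>F t in nhds 0. t \<in> UNIV \<longrightarrow> f (\<gamma> t) = 0"
    by eventually_elim (simp add: W(3) mem_iff \<open>\<rho> x = 0\<close>)
  ultimately have "((\<lambda>t. 0) has_vector_derivative dd [v] f x) (at 0)"
    using has_vector_derivative_cong_ev[where f="\<lambda>t. f (\<gamma> t)" and g="\<lambda>t. 0" and S=UNIV and x=0] W(1,3) x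
    by (simp add: \<gamma>(1))
  then show "dd [v] f x = 0"
    by (rule vector_derivative_unique_at) (rule has_vector_derivative_const)
qed

lemma tangent_iff: "x \<in> M \<inter> U \<Longrightarrow> tangent_vec M x v \<longleftrightarrow> dd [v] \<rho> x = 0"
proof
  assume x: "x \<in> M \<inter> U" and "tangent_vec M x v"
  moreover have "\<forall>y\<in>M \<inter> U. \<rho> y = 0" using zero by blast
  ultimately show "dd [v] \<rho> x = 0" using smooth unfolding tangent_vec_def by blast
qed (rule tangent_if_dd_zero)

lemma tangent_add_diff_neg:
  assumes "x \<in> M \<inter> U" "tangent_vec M x v"
  shows "tangent_vec M x w \<Longrightarrow> tangent_vec M x (v + w)" "tangent_vec M x w \<Longrightarrow> tangent_vec M x (v - w)"
    "tangent_vec M x (- v)"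
  using assms linear_add[OF linear_dd[OF smooth]] linear_diff[OF linear_dd[OF smooth]]
      linear_neg[OF linear_dd[OF smooth]]
  by (auto simp: tangent_iff)

lemma dd_tangent_zero:
  fixes F :: "'n amb \<Rightarrow> 'b::euclidean_space"
  assumes F: "cinf_on U F" and zero: "\<And>y. y \<in> M \<inter> U \<Longrightarrow> F y = 0" and x: "x \<in> M \<inter> U" and v: "tangent_vec M x v"
  shows "dd [v] F x = 0"
proof (rule euclidean_eqI)
  fix b :: 'b
  have "cinf_on U (\<lambda>y. F y \<bullet> b)" "\<forall>y\<in>M \<inter> U. F y \<bullet> b = 0"
    using cinf_on_bounded_linear_apply[OF F bounded_linear_inner_left] zero by simp_all
  then have "dd [v] (\<lambda>y. F y \<bullet> b) x = 0"
    using v x unfolding tangent_vec_def by blast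
  then show "dd [v] F x \<bullet> b = 0 \<bullet> b"
    using dd_bounded_linear_apply[OF F bounded_linear_inner_left] x by simp
qed

lemma dd_tangent_cong:
  fixes F G :: "'n amb \<Rightarrow> 'b::euclidean_space"
  assumes F: "cinf_on U F" and G: "cinf_on U G" and eq: "\<And>y. y \<in> M \<inter> U \<Longrightarrow> F y = G y"
    and x: "x \<in> M \<inter> U" and v: "tangent_vec M x v"
  shows "dd [v] F x = dd [v] G x"
proof -
  note diff = cinf_on_diff[OF F G]
  have "dd [v] F x = dd [v] (\<lambda>y. F y - G y) x + dd [v] G x"
    using dd_add[OF diff G, of x "[v]"] x by simp
  also have "dd [v] (\<lambda>y. F y - G y) x = 0"
    by (rule dd_tangent_zero[OF diff _ x v]) (simp add: eq)
  finally show ?thesis by simp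
qed

lemma dd_dd_field:
  assumes "cinf_on U A" "x \<in> U"
  shows "dd [v] (\<lambda>y. dd [A y] \<rho> y) x = dd [v, A x] \<rho> x + dd [dd [v] A x] \<rho> x"
  using dd_dd_compose[OF smooth cinf_on_ident[OF open_U] assms(1) _ assms(2)] by (simp add: dd_ident)

lemma dd_dd_tangent_field:
  assumes F: "tangent_field M U F" and x: "x \<in> M \<inter> U" and v: "tangent_vec M x v"
  shows "dd [dd [v] F x] \<rho> x = - dd [v, F x] \<rho> x"
proof -
  have "dd [F y] \<rho> y = 0" if "y \<in> M \<inter> U" for y
    using tangent_fieldD(2)[OF F that] tangent_iff[OF that] by simp
  then have "dd [v] (\<lambda>y. dd [F y] \<rho> y) x = 0"
    by (rule dd_tangent_zero[OF cinf_on_dd_field[OF tangent_fieldD(1)[OF F] smooth] _ x v])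
  then show ?thesis using dd_dd_field[OF tangent_fieldD(1)[OF F], of x v] x by simp
qed

lemma tangent_field_rbr:
  assumes V: "tangent_field M U V" and W: "tangent_field M U W"
  shows "tangent_field M U (rbr V W)"
  unfolding tangent_field_def
proof (intro conjI ballI)
  show "cinf_on U (rbr V W)" using tangent_fieldD(1)[OF V] tangent_fieldD(1)[OF W] by (rule cinf_on_rbr)
  fix x assume x: "x \<in> M \<inter> U"
  then have xU: "x \<in> U" by blast
  have "dd [dd [V x] W x] \<rho> x = - dd [V x, W x] \<rho> x" "dd [dd [W x] V x] \<rho> x = - dd [W x, V x] \<rho> x"
    using dd_dd_tangent_field[OF W x tangent_fieldD(2)[OF V x]] dd_dd_tangent_field[OF V x tangent_fieldD(2)[OF W x]]
    by simp_all
  then show "tangent_vec M x (rbr V W x)"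
    unfolding rbr_def tangent_iff[OF x] linear_diff[OF linear_dd[OF smooth xU]]
    using dd_swap[OF smooth xU, of "V x" "W x"] by simp
qed

lemma tangent_field_add_diff_minus:
  assumes "tangent_field M U V"
  shows "tangent_field M U W \<Longrightarrow> tangent_field M U (\<lambda>x. V x + W x)"
    "tangent_field M U W \<Longrightarrow> tangent_field M U (\<lambda>x. V x - W x)" "tangent_field M U (\<lambda>x. - V x)"
  using assms by (simp_all add: tangent_field_def cinf_on_add cinf_on_diff cinf_on_minus tangent_add_diff_neg)

lemma tangent_field_snd_CR_field:
  assumes L: "CR_field M U L"
  shows "tangent_field M U (snd L)" "tangent_field M U (\<lambda>x. Jc (snd L x))"
  using CR_fieldD[OF L] tangent_field_add_diff_minus(3)[OF CR_fieldD(1)[OF L]]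
  by (simp_all add: tangent_field_def cinf_on_Jc Jc_simps)

lemma tangent_field_br:
  assumes "tangent_field M U (fst X)" "tangent_field M U (snd X)" "tangent_field M U (fst Y)"
      "tangent_field M U (snd Y)"
  shows "tangent_field M U (fst (br X Y))" "tangent_field M U (snd (br X Y))"
  using assms by (simp_all add: br_def tangent_field_add_diff_minus(1,2) tangent_field_rbr)

lemma tangent_field_cnjv:
  assumes "CR_field M U L"
  shows "tangent_field M U (fst (cnjv L))" "tangent_field M U (snd (cnjv L))"
  using CR_fieldD(1)[OF assms] tangent_field_add_diff_minus(3)[OF tangent_field_snd_CR_field(1)[OF assms]]
  by (simp_all add: cnjv_def)

end

subsection \<open>The Levi form of a hypersurface\<close>

definition char_coeff :: "('n::finite amb \<Rightarrow> real) \<Rightarrow> ('n amb \<Rightarrow> 'n amb) \<Rightarrow> 'n amb \<Rightarrow> real" where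
  "char_coeff \<rho> c x = (c x \<bullet> (- Jc (grad \<rho> x))) / (grad \<rho> x \<bullet> grad \<rho> x)"

context hypersurface_nbhd
begin

lemma grad_nonzero: "x \<in> U \<Longrightarrow> grad \<rho> x \<noteq> 0"
  using nondeg[of x] grad_inner[OF smooth, of x] by force

lemma bilinear_hessian: "x \<in> U \<Longrightarrow> bilinear (hessian x)"
  by (rule bilinear_dd2[OF smooth])

lemma levi_form_hessian_swap: "x \<in> U \<Longrightarrow> levi_form (hessian x) v u = cnj (levi_form (hessian x) u v)"
  by (rule levi_form_hermitian) (rule dd_swap[OF smooth])

end

locale hypersurface_form = hypersurface_nbhd M U \<rho> for M U :: "'n::finite amb set" and \<rho> +
  fixes c :: "'n amb \<Rightarrow> 'n amb"
  assumes char: "char_form M U c"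
begin

abbreviation "lam \<equiv> char_coeff \<rho> c"

lemma smooth_c: "cinf_on U c"
  using char by (simp add: char_form_def)

lemma smooth_lam: "cinf_on U lam"
  unfolding char_coeff_def[abs_def]
  by (intro cinf_on_divide cinf_on_inner smooth_c cinf_on_minus cinf_on_Jc cinf_on_grad smooth)
     (use grad_nonzero in auto)

lemma char_tangent:
  assumes x: "x \<in> M \<inter> U" and v: "tangent_vec M x v"
  shows "c x \<bullet> v = lam x * dd [Jc v] \<rho> x"
proof -
  have xU: "x \<in> U" using x by blast
  define n where "n = grad \<rho> x"
  have d\<rho>: "dd [w] \<rho> x = n \<bullet> w" for w using grad_inner[OF smooth xU] by (simp add: n_def)
  have n: "n \<bullet> n \<noteq> 0" using grad_nonzero[OF xU] by (simp add: n_def)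
  define k where "k = (n \<bullet> Jc v) / (n \<bullet> n)"
  have orthogonal: "n \<bullet> v = 0" using v tangent_iff[OF x] d\<rho> by simp
  have "tangent_vec M x (v + k *\<^sub>R Jc n)" "tangent_vec M x (Jc (v + k *\<^sub>R Jc n))"
    unfolding tangent_iff[OF x] d\<rho> using orthogonal n
    by (simp_all add: inner_add_right Jc_simps inner_Jc_self k_def inner_diff_right)
  then have "c x \<bullet> (v + k *\<^sub>R Jc n) = 0"
    using char x unfolding char_form_def by blast
  then show ?thesis
    using n by (simp add: char_coeff_def n_def[symmetric] d\<rho> k_def inner_add_right inner_diff_right mult.commute)
qed

lemma lam_nonzero:
  assumes x: "x \<in> M \<inter> U"
  shows "lam x \<noteq> 0"
proof -
  obtain v where "tangent_vec M x v" "c x \<bullet> v \<noteq> 0" using char x unfolding char_form_def by blast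
  then show ?thesis using char_tangent[OF x] by auto
qed

lemma ext_deriv_tangent:
  assumes V: "tangent_field M U V" and JV: "tangent_field M U (\<lambda>y. Jc (V y))" and W: "tangent_field M U W"
      and x: "x \<in> M \<inter> U"
  shows "ext_deriv c V W x =
     dd [V x] lam x * dd [Jc (W x)] \<rho> x + lam x * (dd [V x, Jc (W x)] \<rho> x - dd [W x, Jc (V x)] \<rho> x)"
proof -
  have xU: "x \<in> U" using x by blast
  note smooth_V = tangent_fieldD(1)[OF V] and smooth_W = tangent_fieldD(1)[OF W]
  note smooth_JW = cinf_on_Jc[OF smooth_W]
  have dJW: "cinf_on U (\<lambda>y. dd [Jc (W y)] \<rho> y)" by (rule cinf_on_dd_field[OF smooth_JW smooth])
  have "dd [V x] (\<lambda>y. c y \<bullet> W y) x = dd [V x] (\<lambda>y. lam y * dd [Jc (W y)] \<rho> y) x"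
    by (rule dd_tangent_cong[OF cinf_on_inner[OF smooth_c smooth_W] cinf_on_mult[OF smooth_lam dJW]
          char_tangent[OF _ tangent_fieldD(2)[OF W]] x tangent_fieldD(2)[OF V x]])
  also have "\<dots> = lam x * (dd [V x, Jc (W x)] \<rho> x + dd [Jc (dd [V x] W x)] \<rho> x) + dd [V x] lam x * dd [Jc (W x)] \<rho> x"
    by (simp add: dd_mult[OF smooth_lam dJW xU] dd_dd_field[OF smooth_JW xU] dd_Jc[OF smooth_W xU])
  finally have derivative: "dd [V x] (\<lambda>y. c y \<bullet> W y) x = \<dots>" .
  have "c y \<bullet> V y = 0" if "y \<in> M \<inter> U" for y
    using char tangent_fieldD(2)[OF V that] tangent_fieldD(2)[OF JV that] that unfolding char_form_def by blast
  then have vanishing: "dd [W x] (\<lambda>y. c y \<bullet> V y) x = 0"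
    by (rule dd_tangent_zero[OF cinf_on_inner[OF smooth_c smooth_V] _ x tangent_fieldD(2)[OF W x]])
  have "dd [Jc (dd [W x] V x)] \<rho> x = - dd [W x, Jc (V x)] \<rho> x"
    using dd_dd_tangent_field[OF JV x tangent_fieldD(2)[OF W x]] by (simp add: dd_Jc[OF smooth_V xU])
  moreover have "c x \<bullet> rbr V W x = lam x * dd [Jc (rbr V W x)] \<rho> x"
    by (rule char_tangent[OF x tangent_fieldD(2)[OF tangent_field_rbr[OF V W] x]])
  ultimately have bracket: "c x \<bullet> rbr V W x = lam x * (dd [Jc (dd [V x] W x)] \<rho> x + dd [W x, Jc (V x)] \<rho> x)"
    by (simp add: rbr_def Jc_simps linear_diff[OF linear_dd[OF smooth xU]])
  show ?thesis unfolding ext_deriv_def derivative vanishing bracket by (simp add: algebra_simps)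
qed

text \<open>Only the (1,0) part \<open>e\<close> of a complex tangent vector \<open>(e - \<i> J e) + (f + \<i> J f)\<close> contributes.\<close>

lemma Top_thform_eq_levi_form:
  assumes L: "CR_field M U L" and X: "tangent_field M U (fst X)" "tangent_field M U (snd X)" and x: "x \<in> M \<inter> U"
    and type_parts: "fst X x = e + f" "snd X x = Jc f - Jc e"
    and Jtangent: "dd [Jc (fst X x)] \<rho> x = 0" "dd [Jc (snd X x)] \<rho> x = 0"
  shows "Top L (thform c) X x = of_real (lam x) * levi_form (hessian x) (fst L x) e"
proof -
  have xU: "x \<in> U" using x by blast
  note fst_L = CR_fieldD(1,2)[OF L] and snd_L = tangent_field_snd_CR_field[OF L]
  have swap: "dd [e, w] \<rho> x = dd [w, e] \<rho> x" "dd [f, w] \<rho> x = dd [w, f] \<rho> x"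
    "dd [Jc e, w] \<rho> x = dd [w, Jc e] \<rho> x" "dd [Jc f, w] \<rho> x = dd [w, Jc f] \<rho> x"
    if "w = fst L x \<or> w = Jc (fst L x)" for w
    by (rule dd_swap[OF smooth xU])+
  have "2 * \<i> * Top L (thform c) X x = 2 * \<i> * (of_real (lam x) * levi_form (hessian x) (fst L x) e)"
    unfolding Top_thform_eq_ext_deriv[OF smooth_c fst_L(1)[THEN tangent_fieldD(1)] snd_L(1)[THEN tangent_fieldD(1)]
        X[THEN tangent_fieldD(1)] xU]
      ext_deriv_tangent[OF fst_L X(1) x] ext_deriv_tangent[OF fst_L X(2) x]
      ext_deriv_tangent[OF snd_L X(1) x] ext_deriv_tangent[OF snd_L X(2) x]
      Jtangent CR_fieldD(4)[OF L x]
    unfolding type_parts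
    by (simp add: swap levi_form_eq complex_eq_iff Jc_simps bilinear_simps[OF bilinear_hessian[OF xU]] algebra_simps)
  then show ?thesis by simp
qed

lemma Top_cnjv:
  assumes L: "CR_field M U L" and L': "CR_field M U L'" and x: "x \<in> M \<inter> U"
  shows "Top L (thform c) (cnjv L') x = of_real (lam x) * levi_form (hessian x) (fst L x) (fst L' x)"
proof (rule Top_thform_eq_levi_form[OF L tangent_field_cnjv[OF L'] x, where f=0])
  have tangent: "tangent_vec M x (fst L' x)" "tangent_vec M x (Jc (fst L' x))"
    using CR_fieldD(1,2)[OF L', THEN tangent_fieldD(2), OF x] .
  then show "dd [Jc (fst (cnjv L') x)] \<rho> x = 0" "dd [Jc (snd (cnjv L') x)] \<rho> x = 0"
    using tangent by (simp_all add: cnjv_def CR_fieldD(4)[OF L' x] Jc_simps tangent_iff[OF x])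
qed (simp_all add: cnjv_def CR_fieldD(4)[OF L' x] Jc_simps)

lemma Top_CR_zero:
  assumes L: "CR_field M U L" and L': "CR_field M U L'" and x: "x \<in> M \<inter> U"
  shows "Top L (thform c) L' x = 0"
proof -
  have "tangent_vec M x (- fst L' x)" "tangent_vec M x (Jc (fst L' x))"
    using CR_fieldD(1,2)[OF L', THEN tangent_fieldD(2), OF x] tangent_add_diff_neg(3)[OF x] by simp_all
  then have "Top L (thform c) L' x = of_real (lam x) * levi_form (hessian x) (fst L x) 0"
    using CR_fieldD(4)[OF L' x] CR_fieldD(1)[OF L'] tangent_field_snd_CR_field(1)[OF L']
    by (intro Top_thform_eq_levi_form[OF L _ _ x, where f="fst L' x"]) (simp_all add: Jc_simps tangent_iff[OF x])
  then show ?thesis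
    using x by (simp add: bilinear_rzero bilinear_levi_form bilinear_hessian)
qed

end

subsection \<open>The third order tensor\<close>

definition antihol_deriv :: "'n::finite amb \<Rightarrow> ('n amb \<Rightarrow> 'n amb) \<Rightarrow> 'n amb \<Rightarrow> 'n amb" where
  "antihol_deriv v F x = dd [v] F x + Jc (dd [Jc v] F x)"

context hypersurface_nbhd
begin

lemma dd_antihol_deriv:
  assumes F: "tangent_field M U F" and JF: "tangent_field M U (\<lambda>y. Jc (F y))"
    and x: "x \<in> M \<inter> U" and v: "tangent_vec M x v" "tangent_vec M x (Jc v)"
  shows "dd [antihol_deriv v F x] \<rho> x = - Re (levi_form (hessian x) v (F x))"
    "dd [Jc (antihol_deriv v F x)] \<rho> x = Im (levi_form (hessian x) v (F x))"
proof -
  have xU: "x \<in> U" using x by blast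
  have "dd [dd [w] F x] \<rho> x = - dd [w, F x] \<rho> x" "dd [Jc (dd [w] F x)] \<rho> x = - dd [w, Jc (F x)] \<rho> x"
    if "tangent_vec M x w" for w
    using dd_dd_tangent_field[OF F x that] dd_dd_tangent_field[OF JF x that]
    by (simp_all add: dd_Jc[OF tangent_fieldD(1)[OF F] xU])
  then show "dd [antihol_deriv v F x] \<rho> x = - Re (levi_form (hessian x) v (F x))"
    "dd [Jc (antihol_deriv v F x)] \<rho> x = Im (levi_form (hessian x) v (F x))"
    using v by (simp_all add: antihol_deriv_def Jc_simps levi_form_eq linear_add[OF linear_dd[OF smooth xU]]
        linear_neg[OF linear_dd[OF smooth xU]] linear_diff[OF linear_dd[OF smooth xU]])
qed

lemma br_cnjv_type_parts:
  assumes L: "CR_field M U L" and L': "CR_field M U L'" and x: "x \<in> M \<inter> U"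
  defines "e \<equiv> antihol_deriv (fst L x) (fst L') x" and "f \<equiv> - antihol_deriv (fst L' x) (fst L) x"
  shows "fst (br L (cnjv L')) x = e + f" "snd (br L (cnjv L')) x = Jc f - Jc e"
proof -
  have xU: "x \<in> U" using x by blast
  have deriv_snd: "dd [v] (snd K) x = Jc (dd [v] (fst K) x)" if K: "CR_field M U K" and v: "tangent_vec M x v" for K v
  proof -
    note smooth_fst = tangent_fieldD(1)[OF CR_fieldD(1)[OF K]]
    show ?thesis
      using dd_tangent_cong[OF CR_fieldD(3)[OF K] cinf_on_Jc[OF smooth_fst] CR_fieldD(4)[OF K] x v]
      by (simp add: dd_Jc[OF smooth_fst xU])
  qed
  have minus: "dd [v] (\<lambda>x. - snd L' x) x = - dd [v] (snd L') x" for v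
    by (rule dd_bounded_linear_apply[OF CR_fieldD(3)[OF L'] bounded_linear_minus[OF bounded_linear_ident] xU])
  have neg: "dd [- v] (fst L) x = - dd [v] (fst L) x" "dd [- v] (snd L) x = - dd [v] (snd L) x" for v
    using tangent_fieldD(1)[OF CR_fieldD(1)[OF L]] CR_fieldD(3)[OF L]
    by (simp_all add: linear_neg[OF linear_dd[OF _ xU]])
  note tangent = CR_fieldD(1,2)[OF L, THEN tangent_fieldD(2), OF x]
      CR_fieldD(1,2)[OF L', THEN tangent_fieldD(2), OF x]
  show "fst (br L (cnjv L')) x = e + f" "snd (br L (cnjv L')) x = Jc f - Jc e"
    using tangent
    by (simp_all add: br_def cnjv_def rbr_def minus neg deriv_snd[OF L] deriv_snd[OF L'] CR_fieldD(4)[OF L x]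
        CR_fieldD(4)[OF L' x] e_def f_def antihol_deriv_def Jc_simps)
qed

lemma cinf_on_dd2_field:
  assumes "cinf_on U A" "cinf_on U B"
  shows "cinf_on U (\<lambda>y. dd [A y, B y] \<rho> y)"
  using cinf_on_dd2_compose[OF smooth cinf_on_ident[OF open_U] assms] by simp

lemma dd_dd2_field:
  assumes "cinf_on U A" "cinf_on U B" "x \<in> U"
  shows "dd [v] (\<lambda>y. dd [A y, B y] \<rho> y) x =
     dd [v, A x, B x] \<rho> x + dd [dd [v] A x, B x] \<rho> x + dd [A x, dd [v] B x] \<rho> x"
  using dd_dd2_compose[OF smooth cinf_on_ident[OF open_U] assms(1,2) _ assms(3)] by (simp add: dd_ident)

lemma
  assumes A: "cinf_on U A" and B: "cinf_on U B"
  shows cinf_on_levi_form_hessian: "cinf_on U (\<lambda>y. levi_form (hessian y) (A y) (B y))"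
    and dd_levi_form_hessian: "x \<in> U \<Longrightarrow> dd [v] (\<lambda>y. levi_form (hessian y) (A y) (B y)) x =
      levi_form (third_deriv x v) (A x) (B x) + levi_form (hessian x) (dd [v] A x) (B x)
        + levi_form (hessian x) (A x) (dd [v] B x)"
proof -
  note fields = A cinf_on_Jc[OF A] B cinf_on_Jc[OF B]
  have smooth_Re: "cinf_on U (\<lambda>y. dd [A y, B y] \<rho> y + dd [Jc (A y), Jc (B y)] \<rho> y)"
    and smooth_Im: "cinf_on U (\<lambda>y. dd [Jc (A y), B y] \<rho> y - dd [A y, Jc (B y)] \<rho> y)"
    by (intro cinf_on_add cinf_on_diff cinf_on_dd2_field fields)+
  then show "cinf_on U (\<lambda>y. levi_form (hessian y) (A y) (B y))"
    unfolding levi_form_eq by (rule cinf_on_Complex)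
  assume x: "x \<in> U"
  note D = cinf_on_has_derivative[OF cinf_on_dd2_field x]
  have "dd [v] (\<lambda>y. dd [A y, B y] \<rho> y + dd [Jc (A y), Jc (B y)] \<rho> y) x =
      dd [v] (\<lambda>y. dd [A y, B y] \<rho> y) x + dd [v] (\<lambda>y. dd [Jc (A y), Jc (B y)] \<rho> y) x"
    by (intro has_derivative_imp_dd has_derivative_add D fields)
  moreover have "dd [v] (\<lambda>y. dd [Jc (A y), B y] \<rho> y - dd [A y, Jc (B y)] \<rho> y) x =
      dd [v] (\<lambda>y. dd [Jc (A y), B y] \<rho> y) x - dd [v] (\<lambda>y. dd [A y, Jc (B y)] \<rho> y) x"
    by (intro has_derivative_imp_dd has_derivative_diff D fields)
  ultimately show "dd [v] (\<lambda>y. levi_form (hessian y) (A y) (B y)) x =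
      levi_form (third_deriv x v) (A x) (B x) + levi_form (hessian x) (dd [v] A x) (B x)
        + levi_form (hessian x) (A x) (dd [v] B x)"
    unfolding levi_form_eq dd_Complex[OF smooth_Re smooth_Im x]
    by (simp add: dd_dd2_field[OF _ _ x] fields dd_Jc[OF _ x] complex_eq_iff)
qed

end

context hypersurface_form
begin

lemma Top_br_cnjv_null:
  assumes La: "CR_field M U La" and Lb: "CR_field M U Lb" and Lg: "CR_field M U Lg" and p: "p \<in> M \<inter> U"
    and null: "levi_form (hessian p) (fst La p) (fst Lg p) = 0"
  shows "Top Lb (thform c) (br La (cnjv Lg)) p =
    of_real (lam p) * levi_form (hessian p) (fst Lb p) (antihol_deriv (fst La p) (fst Lg) p)"
proof -
  have pU: "p \<in> U" using p by blast
  note fields_a = CR_fieldD(1,2)[OF La] and fields_g = CR_fieldD(1,2)[OF Lg]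
  define e f where "e = antihol_deriv (fst La p) (fst Lg) p" and "f = - antihol_deriv (fst Lg p) (fst La) p"
  note type_parts = br_cnjv_type_parts[OF La Lg p, folded e_def f_def]
  have "levi_form (hessian p) (fst Lg p) (fst La p) = 0"
    using levi_form_hessian_swap[OF pU, of "fst Lg p" "fst La p"] null by simp
  with null have "dd [e] \<rho> p = 0" "dd [Jc e] \<rho> p = 0" "dd [f] \<rho> p = 0" "dd [Jc f] \<rho> p = 0"
    using dd_antihol_deriv[OF fields_g p fields_a[THEN tangent_fieldD(2), OF p]]
      dd_antihol_deriv[OF fields_a p fields_g[THEN tangent_fieldD(2), OF p]]
    by (simp_all add: e_def f_def Jc_simps linear_neg[OF linear_dd[OF smooth pU]])
  then have "dd [Jc (e + f)] \<rho> p = 0" "dd [Jc (Jc f - Jc e)] \<rho> p = 0"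
    by (simp_all add: Jc_simps linear_add[OF linear_dd[OF smooth pU]] linear_diff[OF linear_dd[OF smooth pU]]
        linear_neg[OF linear_dd[OF smooth pU]])
  then show ?thesis
    unfolding e_def[symmetric]
    by (intro Top_thform_eq_levi_form[OF Lb _ _ p type_parts] tangent_field_br fields_a fields_g
        tangent_field_snd_CR_field[OF La] tangent_field_cnjv[OF Lg]) (simp_all add: type_parts)
qed

lemma dd_Top_cnjv:
  assumes Lb: "CR_field M U Lb" and Lg: "CR_field M U Lg" and p: "p \<in> M \<inter> U" and v: "tangent_vec M p v"
    and null: "\<And>v. levi_form (hessian p) v (fst Lg p) = 0"
  shows "dd [v] (Top Lb (thform c) (cnjv Lg)) p = of_real (lam p) *
    (levi_form (third_deriv p v) (fst Lb p) (fst Lg p) + levi_form (hessian p) (fst Lb p) (dd [v] (fst Lg) p))"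
proof -
  have pU: "p \<in> U" using p by blast
  let ?levi = "\<lambda>y. levi_form (hessian y) (fst Lb y) (fst Lg y)"
  note smooth_fst = tangent_fieldD(1)[OF CR_fieldD(1)]
  note smooth_levi = cinf_on_levi_form_hessian[OF smooth_fst[OF Lb] smooth_fst[OF Lg]]
  have smooth_lam': "cinf_on U (\<lambda>y. complex_of_real (lam y))"
    by (rule cinf_on_bounded_linear_apply[OF smooth_lam bounded_linear_of_real])
  have "dd [v] (Top Lb (thform c) (cnjv Lg)) p = dd [v] (\<lambda>y. complex_of_real (lam y) * ?levi y) p"
    by (rule dd_tangent_cong[OF _ _ Top_cnjv[OF Lb Lg] p v])
      (intro cinf_on_Top cinf_on_mult smooth_c smooth_lam' smooth_levi smooth_fst[OF Lb] CR_fieldD(3)[OF Lb]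
        tangent_field_cnjv[OF Lg, THEN tangent_fieldD(1)])+
  also have "\<dots> = of_real (lam p) * dd [v] ?levi p"
    using null by (simp add: dd_mult[OF smooth_lam' smooth_levi pU])
  finally show ?thesis
    by (simp add: dd_levi_form_hessian[OF smooth_fst[OF Lb] smooth_fst[OF Lg] pU] null)
qed

lemma Top_Top_cnjv:
  assumes La: "CR_field M U La" and Lb: "CR_field M U Lb" and Lg: "CR_field M U Lg" and p: "p \<in> M \<inter> U"
    and null: "\<And>v. levi_form (hessian p) v (fst Lg p) = 0"
  shows "Top La (Top Lb (thform c)) (cnjv Lg) p =
    of_real (lam p) * levi_cubic (third_deriv p) (fst La p) (fst Lb p) (fst Lg p) / (2 * \<i>)"
proof -
  have pU: "p \<in> U" using p by blast
  note smooth_fst = tangent_fieldD(1)[OF CR_fieldD(1)]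
  have "act La (Top Lb (thform c) (cnjv Lg)) p = of_real (lam p) *
     (levi_cubic (third_deriv p) (fst La p) (fst Lb p) (fst Lg p)
       + levi_form (hessian p) (fst Lb p) (antihol_deriv (fst La p) (fst Lg) p))"
    using CR_fieldD(1,2)[OF La, THEN tangent_fieldD(2), OF p]
    by (simp add: act_def CR_fieldD(4)[OF La p] dd_Top_cnjv[OF Lb Lg p _ null] levi_cubic_def
        antihol_deriv_def algebra_simps
        bilinear_radd[OF bilinear_levi_form[OF bilinear_hessian[OF pU]]] levi_form_Jc[OF bilinear_hessian[OF pU]])
  moreover have "dd [v] (Top Lb (thform c) La) p = 0" if "tangent_vec M p v" for v
    by (rule dd_tangent_zero[OF cinf_on_Top[OF smooth_c smooth_fst[OF Lb] CR_fieldD(3)[OF Lb]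
        smooth_fst[OF La] CR_fieldD(3)[OF La]]
          Top_CR_zero[OF Lb La] p that])
  then have "act (cnjv Lg) (Top Lb (thform c) La) p = 0"
    using tangent_field_cnjv[OF Lg, THEN tangent_fieldD(2), OF p] by (simp add: act_def)
  moreover have "Top Lb (thform c) (br La (cnjv Lg)) p =
      of_real (lam p) * levi_form (hessian p) (fst Lb p) (antihol_deriv (fst La p) (fst Lg) p)"
    by (rule Top_br_cnjv_null[OF La Lb Lg p null])
  ultimately show ?thesis
    unfolding Top_def[of La] by (simp add: algebra_simps)
qed

end

subsection \<open>Pulling back by holomorphic maps\<close>

lemma levi_form_compose_holo:
  fixes m :: "'n::finite amb \<Rightarrow> real"
  assumes \<Phi>: "holo_on U \<Phi>" and x: "x \<in> U" and m: "cinf_on W m" and sub: "\<And>x. x \<in> U \<Longrightarrow> \<Phi> x \<in> W"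
  shows "levi_form (\<lambda>u v. dd [u, v] (\<lambda>y. m (\<Phi> y)) x) A C =
      levi_form (\<lambda>u v. dd [u, v] m (\<Phi> x)) (dd [A] \<Phi> x) (dd [C] \<Phi> x)"
  by (simp add: levi_form_eq dd_compose2[OF m cinf_on_holo[OF \<Phi>] sub x] holo_dd1_Jc[OF \<Phi> x] holo_dd2_Jc[OF \<Phi> x]
      Jc_simps linear_neg[OF linear_dd[OF m sub[OF x]]])

text \<open>The second derivative of \<open>\<Phi>\<close> vanishes on pairs of vectors of opposite type; its one remaining
  contribution to \<open>levi_cubic\<close> is a value of \<open>levi_form\<close> at the null direction.\<close>

lemma levi_cubic_compose_holo:
  fixes m :: "'n::finite amb \<Rightarrow> real"
  assumes \<Phi>: "holo_on U \<Phi>" and x: "x \<in> U" and m: "cinf_on W m" and sub: "\<And>x. x \<in> U \<Longrightarrow> \<Phi> x \<in> W"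
    and null: "\<And>v. levi_form (\<lambda>u v. dd [u, v] m (\<Phi> x)) v (dd [C] \<Phi> x) = 0"
  shows "levi_cubic (\<lambda>t u v. dd [t, u, v] (\<lambda>y. m (\<Phi> y)) x) A B C =
      levi_cubic (\<lambda>t u v. dd [t, u, v] m (\<Phi> x)) (dd [A] \<Phi> x) (dd [B] \<Phi> x) (dd [C] \<Phi> x)"
proof -
  define E where "E = dd [A, B] \<Phi> x"
  have "dd [Jc E, Jc (dd [C] \<Phi> x)] m (\<Phi> x) = - dd [E, dd [C] \<Phi> x] m (\<Phi> x)"
    "dd [Jc E, dd [C] \<Phi> x] m (\<Phi> x) = dd [E, Jc (dd [C] \<Phi> x)] m (\<Phi> x)"
    using null[of E] by (simp_all add: levi_form_eq complex_eq_iff)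
  then show ?thesis
    by (simp add: levi_cubic_def levi_form_eq dd_compose3[OF m cinf_on_holo[OF \<Phi>] sub x] holo_dd1_Jc[OF \<Phi> x]
        holo_dd2_Jc[OF \<Phi> x] holo_dd3_Jc[OF \<Phi> x] Jc_simps linear_neg[OF linear_dd[OF m sub[OF x]]]
        bilinear_simps[OF bilinear_dd2[OF m sub[OF x]]] complex_eq_iff E_def[symmetric])
qed

subsection \<open>The model equation\<close>

definition model_form :: "nat \<Rightarrow> nat \<Rightarrow> ('n::{finite,linorder}) amb \<Rightarrow> ('n::{finite,linorder}) amb \<Rightarrow> complex" where
  "model_form r s u v = (\<Sum>\<alpha>\<in>UNIV. \<Sum>\<beta>\<in>UNIV. gmat r s \<alpha> \<beta> * cnj (fst u $ \<alpha>) * fst v $ \<beta>)"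

definition model_cubic :: "nat \<Rightarrow> nat \<Rightarrow> ('n \<Rightarrow> 'n \<Rightarrow> 'n \<Rightarrow> complex) \<Rightarrow>
    ('n::{finite,linorder}) amb \<Rightarrow> ('n::{finite,linorder}) amb \<Rightarrow> ('n::{finite,linorder}) amb \<Rightarrow> complex" where
  "model_cubic r s h u v w = (\<Sum>\<alpha>\<in>UNIV. \<Sum>\<beta>\<in>UNIV. \<Sum>\<gamma>\<in>{\<gamma>. r + s < pos \<gamma>}.
     h \<alpha> \<beta> \<gamma> * cnj (fst u $ \<alpha>) * cnj (fst v $ \<beta>) * fst w $ \<gamma>)"

lemma rho_model_eq:
  "rho_model r s h R Z = - Im (snd Z) + Re (model_form r s Z Z) + 2 * Re (model_cubic r s h Z Z Z) + R (graph_base Z)"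
  by (simp add: rho_model_def model_form_def model_cubic_def graph_base_def Let_def)

lemma rho_model_cong:
  assumes "\<And>\<alpha> \<beta> \<gamma>. r + s < pos \<gamma> \<Longrightarrow> h \<alpha> \<beta> \<gamma> = h' \<alpha> \<beta> \<gamma>"
  shows "rho_model r s h R Z = rho_model r s h' R Z"
  unfolding rho_model_eq model_cubic_def using assms by simp

lemma bilinear_model_form: "bilinear (model_form r s)"
  unfolding bilinear_def
  by (intro conjI allI linearI)
    (simp_all add: model_form_def algebra_simps sum.distrib scaleR_sum_right)

lemma trilinear_model_cubic: "trilinear (model_cubic r s h)"
  unfolding trilinear_def
  by (intro conjI allI linearI)
    (simp_all add: model_cubic_def algebra_simps sum.distrib scaleR_sum_right)

lemma model_form_Jc:
  "model_form r s (Jc u) v = - \<i> * model_form r s u v" "model_form r s u (Jc v) = \<i> * model_form r s u v"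
  by (simp_all add: model_form_def algebra_simps sum_distrib_left sum_negf)

lemma model_cubic_Jc:
  "model_cubic r s h (Jc u) v w = - \<i> * model_cubic r s h u v w"
      "model_cubic r s h u (Jc v) w = - \<i> * model_cubic r s h u v w"
  "model_cubic r s h u v (Jc w) = \<i> * model_cubic r s h u v w"
  by (simp_all add: model_cubic_def algebra_simps sum_distrib_left sum_negf)

lemma model_form_hermitian: "model_form r s v u = cnj (model_form r s u v)"
proof -
  have "cnj (gmat r s \<alpha> \<beta>) = gmat r s \<beta> \<alpha>" for \<alpha> \<beta> :: 'a
    by (auto simp: gmat_def eps_def)
  then have "cnj (model_form r s u v) = (\<Sum>\<alpha>\<in>UNIV. \<Sum>\<beta>\<in>UNIV. gmat r s \<beta> \<alpha> * fst u $ \<alpha> * cnj (fst v $ \<beta>))"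
    by (simp add: model_form_def)
  also have "\<dots> = (\<Sum>\<beta>\<in>UNIV. \<Sum>\<alpha>\<in>UNIV. gmat r s \<beta> \<alpha> * fst u $ \<alpha> * cnj (fst v $ \<beta>))"
    by (rule sum.swap)
  finally show ?thesis by (simp add: model_form_def mult_ac)
qed

lemma model_cubic_symmetric:
  assumes "\<forall>\<alpha> \<beta> \<gamma>. r + s < pos \<gamma> \<longrightarrow> h \<alpha> \<beta> \<gamma> = h \<beta> \<alpha> \<gamma>"
  shows "model_cubic r s h v u w = model_cubic r s h u v w"
proof -
  have "model_cubic r s h v u w =
      (\<Sum>\<beta>\<in>UNIV. \<Sum>\<alpha>\<in>UNIV. \<Sum>\<gamma>\<in>{\<gamma>. r + s < pos \<gamma>}. h \<alpha> \<beta> \<gamma> * cnj (fst v $ \<alpha>) * cnj (fst u $ \<beta>) * fst w $ \<gamma>)"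
    unfolding model_cubic_def by (rule sum.swap)
  also have "\<dots> = model_cubic r s h u v w"
    unfolding model_cubic_def using assms by (intro sum.cong) (auto simp: mult_ac)
  finally show ?thesis .
qed

lemma sum_mult_axis:
  fixes f :: "'n::finite \<Rightarrow> complex"
  shows "(\<Sum>j\<in>S. f j * axis k a $ j) = (if k \<in> S then f k * a else 0)"
    "(\<Sum>j\<in>S. f j * cnj (axis k a $ j)) = (if k \<in> S then f k * cnj a else 0)"
  by (simp_all add: axis_def if_distrib[of cnj] if_distrib[of "(*) _"] sum.delta' cong: if_cong)

lemma model_form_axis: "model_form r s (axis \<alpha> a, a') (axis \<beta> b, b') = gmat r s \<alpha> \<beta> * cnj a * b"
  by (simp add: model_form_def sum_mult_axis flip: sum_distrib_right)

lemma model_form_axis_null: "r + s < pos \<gamma> \<Longrightarrow> model_form r s u (axis \<gamma> b, b') = 0"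
  by (auto simp: model_form_def sum_mult_axis gmat_def eps_def intro!: sum.neutral)

lemma model_cubic_axis:
  assumes "r + s < pos \<gamma>"
  shows "model_cubic r s h (axis \<alpha> a, a') (axis \<beta> b, b') (axis \<gamma> d, d') = h \<alpha> \<beta> \<gamma> * cnj a * cnj b * d"
  using assms by (simp add: model_cubic_def sum_mult_axis flip: sum_distrib_right)

lemma linear_zero_on_z_directions:
  fixes L :: "(complex ^ 'n::finite) \<times> real \<Rightarrow> real"
  assumes L: "linear L" and z: "\<And>b. b \<in> Basis \<Longrightarrow> snd b = 0 \<Longrightarrow> L b = 0"
  shows "L (z, 0) = 0"
proof -
  have "L (z, 0) = (\<Sum>b\<in>Basis. ((z, 0) \<bullet> b) *\<^sub>R L b)" by (rule linear_basis_expand[OF L])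
  also have "\<dots> = 0"
  proof (intro sum.neutral ballI)
    fix b :: "(complex ^ 'n) \<times> real" assume b: "b \<in> Basis"
    show "((z, 0) \<bullet> b) *\<^sub>R L b = 0"
    proof (cases "snd b = 0")
      case True
      then show ?thesis using z[OF b] by simp
    next
      case False
      then have "fst b = 0" using b by (auto simp: Basis_prod_def)
      then show ?thesis by (simp add: inner_prod_def)
    qed
  qed
  finally show ?thesis .
qed

definition weighted_vanish4_on ::
    "((complex ^ 'n::finite) \<times> real) set \<Rightarrow> ((complex ^ 'n) \<times> real \<Rightarrow> real) \<Rightarrow> bool" where
  "weighted_vanish4_on W R \<longleftrightarrow> 0 \<in> W \<and> cinf_on W R \<and>
     (\<forall>vs. set vs \<subseteq> Basis \<and> sum_list (map wt vs) < 4 \<longrightarrow> dd vs R 0 = 0)"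

lemma weighted_vanish4_iff: "weighted_vanish4 R \<longleftrightarrow> (\<exists>W. weighted_vanish4_on W R)"
  by (simp add: weighted_vanish4_def weighted_vanish4_on_def)

lemma weighted_vanish4_onD:
  assumes "weighted_vanish4_on W R"
  shows "0 \<in> W" "cinf_on W R" "set vs \<subseteq> Basis \<Longrightarrow> sum_list (map wt vs) < 4 \<Longrightarrow> dd vs R 0 = 0"
  using assms unfolding weighted_vanish4_on_def by blast+

context
  fixes R :: "(complex ^ 'n::{finite,linorder}) \<times> real \<Rightarrow> real" and W
  assumes weighted_vanish: "weighted_vanish4_on W R"
begin

lemmas zero_mem = weighted_vanish4_onD(1)[OF weighted_vanish]
  and R = weighted_vanish4_onD(2)[OF weighted_vanish]
  and vanish = weighted_vanish4_onD(3)[OF weighted_vanish]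

lemma remainder_jets:
  "dd [v] R 0 = 0" "dd [(z, 0), v] R 0 = 0" "dd [v, (z, 0)] R 0 = 0" "dd [(z, 0), (z', 0), (z'', 0)] R 0 = 0"
proof -
  have basis1: "dd [b] R 0 = 0" if "b \<in> Basis" for b
    using vanish[of "[b]"] that by (simp add: wt_def)
  have basis2: "dd [b, b'] R 0 = 0" if "b \<in> Basis" "b' \<in> Basis" "snd b = 0" for b b'
    using vanish[of "[b, b']"] that by (simp add: wt_def)
  have basis3: "dd [b, b', b''] R 0 = 0"
    if "b \<in> Basis" "b' \<in> Basis" "b'' \<in> Basis" "snd b = 0" "snd b' = 0" "snd b'' = 0" for b b' b''
    using vanish[of "[b, b', b'']"] that by (simp add: wt_def)
  note bilinear = bilinearD[OF bilinear_dd2[OF R zero_mem]] and trilinear = trilinearD[OF trilinear_dd3[OF R zero_mem]]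
  show "dd [v] R 0 = 0"
    using linear_basis_expand[OF linear_dd[OF R zero_mem], of v] basis1 by simp
  show left: "dd [(z, 0), v] R 0 = 0" for v
  proof (rule linear_zero_on_z_directions[OF bilinear(1)])
    show "dd [b, v] R 0 = 0" if b: "b \<in> Basis" "snd b = 0" for b
      using linear_basis_expand[OF bilinear(2), of b v] basis2[OF b(1) _ b(2)] by simp
  qed
  show "dd [v, (z, 0)] R 0 = 0"
    using left[of v] dd_swap[OF R zero_mem] by metis
  show "dd [(z, 0), (z', 0), (z'', 0)] R 0 = 0"
    by (intro linear_zero_on_z_directions[OF trilinear(1)] linear_zero_on_z_directions[OF trilinear(2)]
        linear_zero_on_z_directions[OF trilinear(3)] basis3)
qed

lemma
  fixes h :: "'n \<Rightarrow> 'n \<Rightarrow> 'n \<Rightarrow> complex"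
  shows cinf_on_rho_model: "cinf_on (graph_base -` W) (rho_model r s h R)"
    and dd_rho_model: "dd vs (rho_model r s h R) 0 =
      dd vs (\<lambda>Z. - Im (snd Z)) 0 + dd vs (\<lambda>Z. Re (model_form r s Z Z)) 0
        + dd vs (\<lambda>Z. 2 * Re (model_cubic r s h Z Z Z)) 0 + dd (map graph_base vs) R 0"
proof -
  have V: "open (graph_base -` W)" and vimage_mem: "0 \<in> (graph_base -` W :: 'n amb set)"
    using open_vimage_graph_base[OF cinf_on_open[OF R]] zero_mem by auto
  have linear_part: "cinf_on (graph_base -` W) (\<lambda>Z :: 'n amb. - Im (snd Z))"
    by (intro cinf_on_linear[OF V] linearI) simp_all
  have quadratic_part: "cinf_on (graph_base -` W) (\<lambda>Z :: 'n amb. Re (model_form r s Z Z))"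
    by (rule cinf_on_bounded_linear_apply[OF cinf_on_bilinear_diag[OF V bilinear_model_form] bounded_linear_Re])
  have cubic_part: "cinf_on (graph_base -` W) (\<lambda>Z :: 'n amb. 2 * Re (model_cubic r s h Z Z Z))"
    by (intro cinf_on_mult cinf_on_const V
        cinf_on_bounded_linear_apply[OF cinf_on_trilinear_diag[OF V trilinear_model_cubic] bounded_linear_Re])
  have remainder: "cinf_on (graph_base -` W) (\<lambda>Z. R (graph_base Z))"
    by (rule cinf_on_compose[OF R cinf_on_linear[OF V linear_graph_base]]) simp
  note sums = cinf_on_add[OF linear_part quadratic_part]
      cinf_on_add[OF cinf_on_add[OF linear_part quadratic_part] cubic_part]
  have eq: "rho_model r s h R = (\<lambda>Z. - Im (snd Z) + Re (model_form r s Z Z) + 2 * Re (model_cubic r s h Z Z Z)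
      + R (graph_base Z))"
    by (rule ext) (rule rho_model_eq)
  show "cinf_on (graph_base -` W) (rho_model r s h R)"
    unfolding eq by (rule cinf_on_add[OF sums(2) remainder])
  show "dd vs (rho_model r s h R) 0 =
      dd vs (\<lambda>Z. - Im (snd Z)) 0 + dd vs (\<lambda>Z. Re (model_form r s Z Z)) 0
        + dd vs (\<lambda>Z. 2 * Re (model_cubic r s h Z Z Z)) 0 + dd (map graph_base vs) R 0"
    unfolding eq dd_add[OF sums(2) remainder vimage_mem] dd_add[OF sums(1) cubic_part vimage_mem]
        dd_add[OF linear_part quadratic_part vimage_mem]
    using dd_compose_linear[OF linear_graph_base, of vs R 0] by simp
qed

lemma rho_model_parts_multilinear:
  "linear (\<lambda>Z :: 'n amb. - Im (snd Z))"
  "bilinear (\<lambda>u v :: 'n amb. Re (model_form r s u v))"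
  "trilinear (\<lambda>t u v :: 'n amb. 2 * Re (model_cubic r s h t u v))"
proof -
  show "linear (\<lambda>Z :: 'n amb. - Im (snd Z))"
    by (rule linearI) simp_all
  show "bilinear (\<lambda>u v :: 'n amb. Re (model_form r s u v))"
    unfolding bilinear_def
    by (intro conjI allI linearI) (simp_all add: bilinear_simps[OF bilinear_model_form])
  show "trilinear (\<lambda>t u v :: 'n amb. 2 * Re (model_cubic r s h t u v))"
    unfolding trilinear_def
    by (intro conjI allI linearI) (simp_all add: trilinear_simps[OF trilinear_model_cubic])
qed

lemmas rho_model_parts_jets =
  dd_linear_form[OF rho_model_parts_multilinear(1)] dd_quadratic_form[OF rho_model_parts_multilinear(2)]
  dd_cubic_form[OF rho_model_parts_multilinear(3)]

lemma dd1_rho_model: "dd [v] (rho_model r s h R) 0 = - Im (snd v)"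
  by (simp add: dd_rho_model rho_model_parts_jets remainder_jets bilinear_lzero[OF bilinear_model_form]
      bilinear_rzero[OF bilinear_model_form] linear_0[OF trilinearD(1)[OF trilinear_model_cubic]]
      linear_0[OF trilinearD(2)[OF trilinear_model_cubic]])

lemma levi_form_rho_model:
  assumes "snd C = 0"
  shows "levi_form (\<lambda>u v. dd [u, v] (rho_model r s h R) 0) A C = 4 * model_form r s A C"
  using assms model_form_hermitian[of r s C A]
  by (simp add: levi_form_eq dd_rho_model rho_model_parts_jets model_form_Jc graph_base_def remainder_jets
      linear_0[OF trilinearD(1)[OF trilinear_model_cubic]] linear_0[OF trilinearD(2)[OF trilinear_model_cubic]]
      linear_0[OF trilinearD(3)[OF trilinear_model_cubic]] complex_eq_iff)

lemma levi_cubic_rho_model: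
  assumes "snd A = 0" "snd B = 0" "snd C = 0"
    and h: "\<forall>\<alpha> \<beta> \<gamma>. r + s < pos \<gamma> \<longrightarrow> h \<alpha> \<beta> \<gamma> = h \<beta> \<alpha> \<gamma>"
  shows "levi_cubic (\<lambda>t u v. dd [t, u, v] (rho_model r s h R) 0) A B C = 16 * model_cubic r s h A B C"
  using assms(1-3) model_cubic_symmetric[OF h, of B A C]
  by (simp add: levi_cubic_def levi_form_eq dd_rho_model rho_model_parts_jets model_cubic_Jc graph_base_def
      remainder_jets complex_eq_iff)

end

subsection \<open>Normal form coordinates\<close>

lemma hypersurface_nbhd_subset:
  assumes "hypersurface_nbhd M U \<rho>" "open V" "V \<subseteq> U"
  shows "hypersurface_nbhd M V \<rho>"
  using assms unfolding hypersurface_nbhd_def by (blast intro: cinf_on_subset)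

lemma hol_coords_dd_surj:
  assumes \<Phi>: "hol_coords U \<Phi>" and p: "p \<in> U"
  obtains v where "dd [v] \<Phi> p = w"
proof -
  obtain \<Psi> where \<Psi>: "holo_on (\<Phi> ` U) \<Psi>" "\<And>x. x \<in> U \<Longrightarrow> \<Psi> (\<Phi> x) = x"
    and hol: "holo_on U \<Phi>" using \<Phi> by (auto simp: hol_coords_def)
  note smooth = cinf_on_holo[OF hol]
  have "dd [dd [v] \<Phi> p] \<Psi> (\<Phi> p) = v" for v
    using dd_compose[OF cinf_on_holo[OF \<Psi>(1)] smooth imageI p, of v]
      dd_cong[OF cinf_on_open[OF smooth] \<Psi>(2) p, where vs="[v]"] by (simp add: dd_ident)
  then have "inj (\<lambda>v. dd [v] \<Phi> p)" by (rule inj_on_inverseI)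
  then have "surj (\<lambda>v. dd [v] \<Phi> p)"
    by (rule linear_injective_imp_surjective[OF linear_dd[OF smooth p]]) simp
  then obtain v where "w = dd [v] \<Phi> p" by (rule surjE)
  then show ?thesis by (intro that) (rule sym)
qed

locale normal_form =
  fixes M :: "('n::{finite,linorder}) amb set" and p :: "('n::{finite,linorder}) amb" and r s :: nat
    and h :: "'n \<Rightarrow> 'n \<Rightarrow> 'n \<Rightarrow> complex"
    and U :: "('n::{finite,linorder}) amb set" and \<Phi> :: "('n::{finite,linorder}) amb \<Rightarrow> ('n::{finite,linorder}) amb"
    and R :: "(complex ^ ('n::{finite,linorder})) \<times> real \<Rightarrow> real" and U' :: "('n::{finite,linorder}) amb set"
  assumes coords: "hol_coords U \<Phi>" and center: "\<Phi> p = 0" and remainder: "weighted_vanish4 R"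
    and nbhd: "open U'" "p \<in> U'" "U' \<subseteq> U"
    and equation: "M \<inter> U' = {x \<in> U'. rho_model r s h R (\<Phi> x) = 0}"
begin

abbreviation "rho \<equiv> (\<lambda>x. rho_model r s h R (\<Phi> x))"

lemma center_mem: "p \<in> U"
  using nbhd by blast

lemma holo: "holo_on U \<Phi>"
  using coords by (simp add: hol_coords_def)

lemma center_mem_M: "p \<in> M"
proof -
  obtain W where "weighted_vanish4_on W R" using remainder unfolding weighted_vanish4_iff ..
  from weighted_vanish4_onD(3)[OF this, of "[]"] have "R 0 = 0" by simp
  then have "rho p = 0"
    by (simp add: center rho_model_eq model_form_def model_cubic_def)
  then show ?thesis using equation nbhd(2) by blast
qed

lemma chart_domain:
  obtains D V where "weighted_vanish4_on D R"
    "open V" "p \<in> V" "V \<subseteq> U'" "holo_on V \<Phi>" "\<And>x. x \<in> V \<Longrightarrow> \<Phi> x \<in> graph_base -` D"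
proof -
  obtain D where D: "weighted_vanish4_on D R" using remainder unfolding weighted_vanish4_iff ..
  define V where "V = \<Phi> -` graph_base -` D \<inter> U'"
  note smooth = cinf_on_holo[OF holo_on_subset[OF holo nbhd(1,3)]]
  have V: "open V" "p \<in> V" "V \<subseteq> U'"
    using continuous_on_open_vimage[OF nbhd(1)] cinf_on_continuous[OF smooth]
        open_vimage_graph_base[OF cinf_on_open[OF weighted_vanish4_onD(2)[OF D]]]
      nbhd(2) weighted_vanish4_onD(1)[OF D] center by (auto simp: V_def)
  have "holo_on V \<Phi>" using holo_on_subset[OF holo V(1)] V(3) nbhd(3) by blast
  then show ?thesis using that[OF D V] by (simp add: V_def)
qed

lemma dd_rho: "dd [v] rho p = - Im (snd (dd [v] \<Phi> p))"
proof -
  obtain D V where D: "weighted_vanish4_on D R"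
    and V: "p \<in> V" "holo_on V \<Phi>" "\<And>x. x \<in> V \<Longrightarrow> \<Phi> x \<in> graph_base -` D"
    by (rule chart_domain) blast
  show ?thesis
    using dd_compose[OF cinf_on_rho_model[OF D] cinf_on_holo[OF V(2)] V(3,1)]
    by (simp add: center dd1_rho_model[OF D])
qed

lemma levi_form_rho:
  assumes "snd (dd [C] \<Phi> p) = 0"
  shows "levi_form (\<lambda>u v. dd [u, v] rho p) A C = 4 * model_form r s (dd [A] \<Phi> p) (dd [C] \<Phi> p)"
proof -
  obtain D V where D: "weighted_vanish4_on D R"
    and V: "p \<in> V" "holo_on V \<Phi>" "\<And>x. x \<in> V \<Longrightarrow> \<Phi> x \<in> graph_base -` D"
    by (rule chart_domain) blast
  show ?thesis
    using levi_form_compose_holo[OF V(2,1) cinf_on_rho_model[OF D] V(3)] levi_form_rho_model[OF D assms]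
    by (simp add: center)
qed

lemma levi_cubic_rho:
  assumes sym: "\<forall>\<alpha> \<beta> \<gamma>. r + s < pos \<gamma> \<longrightarrow> h \<alpha> \<beta> \<gamma> = h \<beta> \<alpha> \<gamma>"
    and horizontal: "snd (dd [A] \<Phi> p) = 0" "snd (dd [B] \<Phi> p) = 0" "snd (dd [C] \<Phi> p) = 0"
    and null: "\<And>u. model_form r s u (dd [C] \<Phi> p) = 0"
  shows "levi_cubic (\<lambda>t u v. dd [t, u, v] rho p) A B C =
    16 * model_cubic r s h (dd [A] \<Phi> p) (dd [B] \<Phi> p) (dd [C] \<Phi> p)"
proof -
  obtain D V where D: "weighted_vanish4_on D R"
    and V: "p \<in> V" "holo_on V \<Phi>" "\<And>x. x \<in> V \<Longrightarrow> \<Phi> x \<in> graph_base -` D"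
    by (rule chart_domain) blast
  show ?thesis
    using levi_cubic_compose_holo[OF V(2,1) cinf_on_rho_model[OF D] V(3)] levi_form_rho_model[OF D horizontal(3)] null
      levi_cubic_rho_model[OF D horizontal sym] by (simp add: center)
qed

lemma rho_nbhd:
  obtains W where "p \<in> W" "W \<subseteq> U'" "hypersurface_nbhd M W rho"
proof -
  obtain D V where D: "weighted_vanish4_on D R"
    and V: "open V" "p \<in> V" "V \<subseteq> U'" "holo_on V \<Phi>" "\<And>x. x \<in> V \<Longrightarrow> \<Phi> x \<in> graph_base -` D"
    by (rule chart_domain) blast
  have smooth_rho: "cinf_on V rho"
    by (rule cinf_on_compose[OF cinf_on_rho_model[OF D] cinf_on_holo[OF V(4)] V(5)])
  obtain n where n: "dd [n] \<Phi> p = (0, \<i>)" by (rule hol_coords_dd_surj[OF coords center_mem])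
  define W where "W = dd [n] rho -` (- {0}) \<inter> V"
  have W: "open W" "p \<in> W" "W \<subseteq> V"
    using continuous_on_open_vimage[OF V(1)] cinf_on_continuous_dd[OF smooth_rho] open_Compl[OF closed_singleton]
      dd_rho[of n] n V(2) unfolding W_def by auto
  have "hypersurface_nbhd M W rho"
  proof
    show "cinf_on W rho" by (rule cinf_on_subset[OF smooth_rho W(1,3)])
    show "\<exists>v. dd [v] rho x \<noteq> 0" if "x \<in> W" for x using that unfolding W_def by blast
    show "M \<inter> W = {x \<in> W. rho x = 0}" using equation V(3) W(3) by blast
  qed
  then show ?thesis using that W V(3) by blast
qed

end

text \<open>The operators \<open>Top\<close> carry the factor \<open>1 / (2 * \<i>)\<close>, so that the coordinate fields of type (0,1) have
  third order tensor \<open>- \<i> * h\<close>. Multiplying them by \<open>\<i>\<close> changes this to \<open>h\<close> and keeps the Levi form; the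
  real part of the resulting field is \<open>- \<i> / 2\<close> times a basis vector.\<close>

locale normal_form_frame = normal_form M p r s h U \<Phi> R U'
  for M :: "('n::{finite,linorder}) amb set" and p r s h U \<Phi> R U' +
  fixes V :: "('n::{finite,linorder}) amb set" and Lb :: "'n \<Rightarrow> ('n::{finite,linorder}) amb cvf"
    and c :: "('n::{finite,linorder}) amb \<Rightarrow> ('n::{finite,linorder}) amb"
  assumes frame_nbhd: "open V" "p \<in> V"
    and CR: "CR_field M V (Lb \<alpha>)" and form: "char_form M V c"
    and frame_value: "dd [fst (Lb \<alpha>) p] \<Phi> p = (axis \<alpha> (- \<i> / 2), 0)"
    and form_value: "tangent_vec M p v \<Longrightarrow> c p \<bullet> v = - Re (snd (dd [v] \<Phi> p))"
begin

lemma
  shows Top_frame: "Top (Lb \<alpha>) (thform c) (cnjv (Lb \<beta>)) p = gmat r s \<alpha> \<beta>"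
    and Top_Top_frame: "\<lbrakk>\<forall>\<alpha> \<beta> \<gamma>. r + s < pos \<gamma> \<longrightarrow> h \<alpha> \<beta> \<gamma> = h \<beta> \<alpha> \<gamma>; r + s < pos \<gamma>\<rbrakk> \<Longrightarrow>
      Top (Lb \<alpha>) (Top (Lb \<beta>) (thform c)) (cnjv (Lb \<gamma>)) p = h \<alpha> \<beta> \<gamma>"
proof -
  obtain W\<^sub>0 where W\<^sub>0: "p \<in> W\<^sub>0" "hypersurface_nbhd M W\<^sub>0 rho" by (rule rho_nbhd)
  define W where "W = W\<^sub>0 \<inter> V"
  have W: "open W" "p \<in> W" "W \<subseteq> V" "W \<subseteq> W\<^sub>0"
    using hypersurface_nbhd.open_U[OF W\<^sub>0(2)] W\<^sub>0(1) frame_nbhd by (auto simp: W_def)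
  interpret hypersurface_form M W rho c
    by (intro hypersurface_form.intro hypersurface_nbhd_subset[OF W\<^sub>0(2) W(1,4)] hypersurface_form_axioms.intro
        char_form_subset[OF form W(1,3)])
  have CR_W: "CR_field M W (Lb \<alpha>)" for \<alpha> by (rule CR_field_subset[OF CR W(1,3)])
  have pW: "p \<in> M \<inter> W" using center_mem_M W(2) by blast
  have lam: "lam p = 1"
  proof -
    obtain v where v: "dd [v] \<Phi> p = (0, 1)" by (rule hol_coords_dd_surj[OF coords center_mem])
    have "tangent_vec M p v" using tangent_iff[OF pW] by (simp add: dd_rho v)
    from char_tangent[OF pW this] form_value[OF this] show ?thesis
      by (simp add: dd_rho v holo_dd1_Jc[OF holo center_mem])
  qed
  show "Top (Lb \<alpha>) (thform c) (cnjv (Lb \<beta>)) p = gmat r s \<alpha> \<beta>" for \<alpha> \<beta>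
    unfolding Top_cnjv[OF CR_W CR_W pW] lam by (simp add: levi_form_rho frame_value model_form_axis mult.assoc)
  assume sym: "\<forall>\<alpha> \<beta> \<gamma>. r + s < pos \<gamma> \<longrightarrow> h \<alpha> \<beta> \<gamma> = h \<beta> \<alpha> \<gamma>" and \<gamma>: "r + s < pos \<gamma>"
  have "Top (Lb \<alpha>) (Top (Lb \<beta>) (thform c)) (cnjv (Lb \<gamma>)) p =
     levi_cubic (third_deriv p) (fst (Lb \<alpha>) p) (fst (Lb \<beta>) p) (fst (Lb \<gamma>) p) / (2 * \<i>)"
    by (subst Top_Top_cnjv[OF CR_W CR_W CR_W pW]) (simp_all add: lam levi_form_rho frame_value
        model_form_axis_null[OF \<gamma>])
  also have "\<dots> = h \<alpha> \<beta> \<gamma>"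
    by (subst levi_cubic_rho[OF sym]) (simp_all add: frame_value model_form_axis_null[OF \<gamma>]
        model_cubic_axis[OF \<gamma>] field_simps)
  finally show "Top (Lb \<alpha>) (Top (Lb \<beta>) (thform c)) (cnjv (Lb \<gamma>)) p = h \<alpha> \<beta> \<gamma>" .
qed

end

subsection \<open>Frames with prescribed values\<close>

definition frame_map :: "('n \<Rightarrow> 'n amb) \<Rightarrow> 'n amb \<Rightarrow> 'n amb \<Rightarrow> 'n::finite amb" where
  "frame_map A n Z = (\<Sum>\<alpha>\<in>UNIV. fst Z $ \<alpha> *\<^sub>C A \<alpha>) + snd Z *\<^sub>C n"

lemma complex_linear_functional_sum:
  fixes \<eta> :: "'n::finite amb \<Rightarrow> complex"
  assumes "linear \<eta>" "\<And>v. \<eta> (Jc v) = \<i> * \<eta> v"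
  shows "\<eta> (\<Sum>i\<in>I. c i *\<^sub>C A i) = (\<Sum>i\<in>I. c i * \<eta> (A i))"
  using complex_linear_functional_scaleC[OF assms] by (simp add: linear_sum[OF assms(1)])

lemma linear_frame_map: "linear (frame_map A n)"
  by (rule linearI) (simp_all add: frame_map_def scaleC_simps sum.distrib scaleR_sum_right scaleR_add_right
      scaleC_eq_Jc algebra_simps)

lemma frame_map_Jc: "frame_map A n (Jc Z) = Jc (frame_map A n Z)"
proof -
  have "Jc (\<Sum>\<alpha>\<in>UNIV. fst Z $ \<alpha> *\<^sub>C A \<alpha>) = (\<Sum>\<alpha>\<in>UNIV. Jc (fst Z $ \<alpha> *\<^sub>C A \<alpha>))"
    by (rule linear_sum[OF linear_Jc])
  then show ?thesis by (simp add: frame_map_def Jc_simps(1)) (simp add: Jc_eq_scaleC scaleC_simps)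
qed

lemma frame_map_functional:
  fixes \<eta> :: "'n::finite amb \<Rightarrow> complex"
  assumes "linear \<eta>" "\<And>v. \<eta> (Jc v) = \<i> * \<eta> v" "\<And>\<alpha>. \<eta> (A \<alpha>) = 0"
  shows "\<eta> (frame_map A n Z) = snd Z * \<eta> n"
  by (simp add: frame_map_def linear_add[OF assms(1)] complex_linear_functional_sum[OF assms(1,2)]
      complex_linear_functional_scaleC[OF assms(1,2)] assms(3))

lemma inj_frame_map:
  fixes \<eta> :: "'n::finite amb \<Rightarrow> complex"
  assumes "linear \<eta>" "\<And>v. \<eta> (Jc v) = \<i> * \<eta> v" "\<And>\<alpha>. \<eta> (A \<alpha>) = 0" "\<eta> n \<noteq> 0"
    and indep: "\<And>d. (\<Sum>\<alpha>\<in>UNIV. d \<alpha> *\<^sub>C A \<alpha>) = 0 \<Longrightarrow> \<forall>\<alpha>. d \<alpha> = 0"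
  shows "inj (frame_map A n)"
  unfolding linear_injective_0[OF linear_frame_map]
proof (intro allI impI)
  fix Z assume "frame_map A n Z = 0"
  moreover have "\<eta> (frame_map A n Z) = snd Z * \<eta> n"
    by (rule frame_map_functional[OF assms(1,2)]) (rule assms(3))
  ultimately have snd: "snd Z = 0"
    using assms(4) linear_0[OF assms(1)] by simp
  then have "\<forall>\<alpha>. fst Z $ \<alpha> = 0" using indep[of "\<lambda>\<alpha>. fst Z $ \<alpha>"] \<open>frame_map A n Z = 0\<close>
    by (simp add: frame_map_def scaleC_simps)
  then show "Z = 0" using snd by (simp add: amb_eq_iff)
qed

lemma inj_linear_nearby:
  fixes S :: "'a::topological_space \<Rightarrow> 'b::euclidean_space \<Rightarrow> 'c::euclidean_space"
  assumes W: "open W" "p \<in> W" and lin: "\<And>x. linear (S x)" and cont: "\<And>b. continuous_on W (\<lambda>x. S x b)"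
    and inj: "inj (S p)"
  obtains V where "open V" "p \<in> V" "V \<subseteq> W" "\<And>x. x \<in> V \<Longrightarrow> inj (S x)"
proof -
  obtain B where B: "B > 0" "\<And>Z. B * norm Z \<le> norm (S p Z)"
    using linear_inj_bounded_below_pos[OF lin inj] by blast
  define \<epsilon> where "\<epsilon> x = (\<Sum>b\<in>Basis. norm (S p b - S x b))" for x
  have "continuous_on W \<epsilon>"
    unfolding \<epsilon>_def by (intro continuous_intros cont)
  then have V: "open (\<epsilon> -` {..<B} \<inter> W)"
    using continuous_on_open_vimage[OF W(1)] open_lessThan by blast
  show ?thesis
  proof (rule that[OF V])
    show "p \<in> \<epsilon> -` {..<B} \<inter> W" using W(2) B(1) by (simp add: \<epsilon>_def)
    fix x assume x: "x \<in> \<epsilon> -` {..<B} \<inter> W"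
    show "inj (S x)"
      unfolding linear_injective_0[OF lin]
    proof (intro allI impI)
      fix Z assume "S x Z = 0"
      then have "S p Z = (\<Sum>b\<in>Basis. (Z \<bullet> b) *\<^sub>R (S p b - S x b))"
        using linear_basis_expand[OF lin, of p Z] linear_basis_expand[OF lin, of x Z]
        by (simp add: scaleR_diff_right sum_subtractf)
      also have "norm \<dots> \<le> (\<Sum>b\<in>Basis. norm Z * norm (S p b - S x b))"
        by (intro sum_norm_le) (simp add: mult_right_mono Basis_le_norm)
      finally have "norm Z * B \<le> norm Z * \<epsilon> x" using B(2)[of Z] by (simp add: \<epsilon>_def sum_distrib_left mult.commute)
      then show "Z = 0" using x by (auto simp: mult_le_cancel_left)
    qed
  qed auto
qed

lemma sum_cscal:
  "(\<Sum>\<alpha>\<in>UNIV. cscal (c \<alpha>) (v \<alpha>, Jc (v \<alpha>))) =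
     (\<Sum>\<alpha>\<in>UNIV. cnj (c \<alpha>) *\<^sub>C v \<alpha>, Jc (\<Sum>\<alpha>\<in>UNIV. cnj (c \<alpha>) *\<^sub>C v \<alpha>))"
  for v :: "'i::finite \<Rightarrow> 'n::finite amb"
proof -
  have "cscal d (v, Jc v) = (cnj d *\<^sub>C v, Jc (cnj d *\<^sub>C v))" for d and v :: "'n amb"
    by (simp add: cscal_def scaleC_eq_Jc Jc_simps)
  then show ?thesis
    by (simp add: sum_prod linear_sum[OF linear_Jc])
qed

lemma CR_basis_independent:
  assumes Lb: "CR_basis M U Lb" and x: "x \<in> M \<inter> U" and zero: "(\<Sum>\<alpha>\<in>UNIV. d \<alpha> *\<^sub>C fst (Lb \<alpha>) x) = 0"
  shows "\<forall>\<alpha>. d \<alpha> = 0"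
proof -
  have independent: "\<forall>c. (\<Sum>\<alpha>\<in>UNIV. cscal (c \<alpha>) (fst (Lb \<alpha>) x, snd (Lb \<alpha>) x)) = (0, 0) \<longrightarrow> (\<forall>\<alpha>. c \<alpha> = 0)"
    and CR: "\<And>\<alpha>. CR_field M U (Lb \<alpha>)"
    using Lb x unfolding CR_basis_def by blast+
  have "(\<Sum>\<alpha>\<in>UNIV. cscal (cnj (d \<alpha>)) (fst (Lb \<alpha>) x, snd (Lb \<alpha>) x)) = (0, 0)"
    using sum_cscal[of "\<lambda>\<alpha>. cnj (d \<alpha>)" "\<lambda>\<alpha>. fst (Lb \<alpha>) x"] zero CR_fieldD(4)[OF CR x] by (simp add: Jc_simps)
  then have "\<forall>\<alpha>. cnj (d \<alpha>) = 0"
    using spec[OF independent, of "\<lambda>\<alpha>. cnj (d \<alpha>)"] by blast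
  then show ?thesis by simp
qed

definition complex_tangential_part :: "'n::finite amb \<Rightarrow> 'n amb \<Rightarrow> 'n amb" where
  "complex_tangential_part n a = a - ((a \<bullet> n) / (n \<bullet> n)) *\<^sub>R n - ((a \<bullet> Jc n) / (n \<bullet> n)) *\<^sub>R Jc n"

lemma complex_tangential_part_orthogonal:
  assumes "n \<noteq> 0"
  shows "n \<bullet> complex_tangential_part n a = 0" "n \<bullet> Jc (complex_tangential_part n a) = 0"
  using assms
  by (simp_all add: complex_tangential_part_def inner_diff_right inner_add_right Jc_simps inner_Jc_self inner_Jc_left
      inner_commute[of a])

context hypersurface_nbhd
begin

lemma tangent_iff_grad: "x \<in> M \<inter> U \<Longrightarrow> tangent_vec M x v \<longleftrightarrow> grad \<rho> x \<bullet> v = 0"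
  using tangent_iff[of x v] grad_inner[OF smooth, of x v] by simp

lemma char_form_grad: "char_form M U (\<lambda>x. - Jc (grad \<rho> x))"
  unfolding char_form_def
proof (intro conjI ballI)
  show "cinf_on U (\<lambda>x. - Jc (grad \<rho> x))" by (intro cinf_on_minus cinf_on_Jc cinf_on_grad smooth)
  fix x assume x: "x \<in> M \<inter> U"
  show "\<forall>v. tangent_vec M x v \<and> tangent_vec M x (Jc v) \<longrightarrow> - Jc (grad \<rho> x) \<bullet> v = 0"
    by (simp add: tangent_iff_grad[OF x] inner_Jc_left)
  show "\<exists>v. tangent_vec M x v \<and> - Jc (grad \<rho> x) \<bullet> v \<noteq> 0"
    using grad_nonzero[of x] x
    by (intro exI[of _ "Jc (grad \<rho> x)"]) (simp add: tangent_iff_grad inner_Jc_self inner_Jc_Jc)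
qed

lemma hol_linear_grad:
  shows "linear (hol_linear (\<lambda>v. grad \<rho> x \<bullet> v))"
    and "hol_linear (\<lambda>v. grad \<rho> x \<bullet> v) (Jc v) = \<i> * hol_linear (\<lambda>v. grad \<rho> x \<bullet> v) v"
    and "x \<in> U \<Longrightarrow> hol_linear (\<lambda>v. grad \<rho> x \<bullet> v) (grad \<rho> x) \<noteq> 0"
proof -
  have lin: "linear (\<lambda>v. grad \<rho> x \<bullet> v)"
    by (rule bounded_linear.linear[OF bounded_linear_inner_right])
  show "linear (hol_linear (\<lambda>v. grad \<rho> x \<bullet> v))"
    and "hol_linear (\<lambda>v. grad \<rho> x \<bullet> v) (Jc v) = \<i> * hol_linear (\<lambda>v. grad \<rho> x \<bullet> v) v"
    by (rule linear_hol_linear[OF lin]) (rule hol_linear_Jc[OF lin])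
  show "hol_linear (\<lambda>v. grad \<rho> x \<bullet> v) (grad \<rho> x) \<noteq> 0" if "x \<in> U"
    using grad_nonzero[OF that] by (simp add: hol_linear_def complex_eq_iff)
qed

lemma CR_basisI:
  fixes A :: "'n \<Rightarrow> 'n amb \<Rightarrow> 'n amb"
  assumes A: "\<And>\<alpha>. cinf_on U (A \<alpha>)"
    and orthogonal: "\<And>\<alpha> x. x \<in> U \<Longrightarrow> grad \<rho> x \<bullet> A \<alpha> x = 0" "\<And>\<alpha> x. x \<in> U \<Longrightarrow> grad \<rho> x \<bullet> Jc (A \<alpha> x) = 0"
    and inj: "\<And>x. x \<in> U \<Longrightarrow> inj (frame_map (\<lambda>\<alpha>. A \<alpha> x) (grad \<rho> x))"
  shows "CR_basis M U (\<lambda>\<alpha>. (A \<alpha>, \<lambda>x. Jc (A \<alpha> x)))"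
  unfolding CR_basis_def fst_conv snd_conv sum_cscal
proof (intro conjI allI ballI impI)
  show "CR_field M U (A \<alpha>, \<lambda>x. Jc (A \<alpha> x))" for \<alpha>
    unfolding CR_field_def using orthogonal by (simp add: A cinf_on_Jc tangent_iff_grad)
  fix x assume x: "x \<in> M \<inter> U"
  let ?S = "frame_map (\<lambda>\<alpha>. A \<alpha> x) (grad \<rho> x)"
  have inj_S: "inj ?S" using inj x by blast
  have combination: "(\<Sum>\<alpha>\<in>UNIV. cnj (c \<alpha>) *\<^sub>C A \<alpha> x) = ?S (\<chi> \<alpha>. cnj (c \<alpha>), 0)" for c
    by (simp add: frame_map_def scaleC_simps)
  {
    fix c :: "'n \<Rightarrow> complex" and \<alpha>
    assume "(\<Sum>\<alpha>\<in>UNIV. cnj (c \<alpha>) *\<^sub>C A \<alpha> x, Jc (\<Sum>\<alpha>\<in>UNIV. cnj (c \<alpha>) *\<^sub>C A \<alpha> x)) = (0, 0)"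
    then have "?S (\<chi> \<alpha>. cnj (c \<alpha>), 0) = ?S 0"
      unfolding combination linear_0[OF linear_frame_map] by simp
    then have "(\<chi> \<alpha>. cnj (c \<alpha>), 0 :: complex) = 0" by (rule injD[OF inj_S])
    then show "c \<alpha> = 0" by (simp add: amb_eq_iff)
  next
    fix b assume "tangent_vec M x b \<and> tangent_vec M x (Jc b)"
    then have "hol_linear (\<lambda>v. grad \<rho> x \<bullet> v) b = 0"
      by (simp add: hol_linear_def tangent_iff_grad[OF x] complex_eq_iff)
    moreover have "surj ?S" using linear_injective_imp_surjective[OF linear_frame_map inj_S] by simp
    then obtain Z where Z: "b = ?S Z" by blast
    moreover have "hol_linear (\<lambda>v. grad \<rho> x \<bullet> v) (A \<alpha> x) = 0" for \<alpha>
      using orthogonal x by (simp add: hol_linear_def complex_eq_iff)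
    ultimately have "snd Z = 0"
      using frame_map_functional[OF hol_linear_grad(1,2)] hol_linear_grad(3)[of x] x by simp
    then have "(\<chi> \<alpha>. cnj (cnj (fst Z $ \<alpha>)), 0) = Z" by (simp add: amb_eq_iff)
    then show "\<exists>c. (\<Sum>\<alpha>\<in>UNIV. cnj (c \<alpha>) *\<^sub>C A \<alpha> x, Jc (\<Sum>\<alpha>\<in>UNIV. cnj (c \<alpha>) *\<^sub>C A \<alpha> x)) = (b, Jc b)"
      unfolding combination Z by (intro exI[of _ "\<lambda>\<alpha>. cnj (fst Z $ \<alpha>)"]) (simp only:)
  }
qed

lemma CR_basis_exists:
  fixes a :: "'n \<Rightarrow> 'n amb"
  assumes p: "p \<in> M \<inter> U" and tangent: "\<And>\<alpha>. dd [a \<alpha>] \<rho> p = 0" "\<And>\<alpha>. dd [Jc (a \<alpha>)] \<rho> p = 0"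
    and indep: "\<And>c. (\<Sum>\<alpha>\<in>UNIV. c \<alpha> *\<^sub>C a \<alpha>) = 0 \<Longrightarrow> \<forall>\<alpha>. c \<alpha> = 0"
  obtains V Lb where "open V" "p \<in> V" "V \<subseteq> U" "CR_basis M V Lb" "\<And>\<alpha>. fst (Lb \<alpha>) p = a \<alpha>"
proof -
  have pU: "p \<in> U" using p by blast
  define A where "A \<alpha> x = complex_tangential_part (grad \<rho> x) (a \<alpha>)" for \<alpha> x
  have A: "cinf_on U (A \<alpha>)" for \<alpha>
    unfolding A_def complex_tangential_part_def
    by (intro cinf_on_diff cinf_on_scaleR cinf_on_divide cinf_on_inner cinf_on_const open_U cinf_on_Jc
        cinf_on_grad smooth) (use grad_nonzero in auto)
  have orthogonal: "grad \<rho> x \<bullet> A \<alpha> x = 0" "grad \<rho> x \<bullet> Jc (A \<alpha> x) = 0" if "x \<in> U" for \<alpha> x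
    unfolding A_def using complex_tangential_part_orthogonal[OF grad_nonzero[OF that]] by blast+
  have "grad \<rho> p \<bullet> a \<alpha> = 0" "grad \<rho> p \<bullet> Jc (a \<alpha>) = 0" for \<alpha>
    using tangent grad_inner[OF smooth pU] by simp_all
  then have A_p: "A \<alpha> p = a \<alpha>" for \<alpha>
    using inner_Jc_left[of "grad \<rho> p" "a \<alpha>"] by (simp add: A_def complex_tangential_part_def inner_commute)
  let ?S = "\<lambda>x. frame_map (\<lambda>\<alpha>. A \<alpha> x) (grad \<rho> x)"
  have "hol_linear (\<lambda>v. grad \<rho> p \<bullet> v) (A \<alpha> p) = 0" for \<alpha>
    using orthogonal[OF pU] by (simp add: hol_linear_def complex_eq_iff)
  then have inj_p: "inj (?S p)"
    using inj_frame_map[OF hol_linear_grad(1,2) _ hol_linear_grad(3)[OF pU]] indep by (simp add: A_p)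
  have continuous: "continuous_on U (\<lambda>x. ?S x b)" for b
    unfolding frame_map_def
    by (intro continuous_intros bounded_linear.continuous_on[OF bounded_linear_scaleC] cinf_on_continuous[OF A]
        cinf_on_continuous[OF cinf_on_grad[OF smooth]])
  obtain V where V: "open V" "p \<in> V" "V \<subseteq> U" "\<And>x. x \<in> V \<Longrightarrow> inj (?S x)"
    by (rule inj_linear_nearby[OF open_U pU linear_frame_map continuous inj_p]) blast
  interpret V: hypersurface_nbhd M V \<rho>
    by (rule hypersurface_nbhd_subset[OF hypersurface_nbhd_axioms V(1,3)])
  have "CR_basis M V (\<lambda>\<alpha>. (A \<alpha>, \<lambda>x. Jc (A \<alpha> x)))"
    by (rule V.CR_basisI) (use orthogonal V(3,4) in \<open>auto intro: cinf_on_subset[OF A V(1,3)]\<close>)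
  with V(1-3) show ?thesis by (rule that) (simp add: A_p)
qed

end

definition normalized_frame ::
    "('n::{finite,linorder}) amb set \<Rightarrow> ('n::{finite,linorder}) amb \<Rightarrow> nat \<Rightarrow> nat \<Rightarrow> ('n \<Rightarrow> 'n \<Rightarrow> 'n \<Rightarrow> complex) \<Rightarrow>
     ('n::{finite,linorder}) amb set \<Rightarrow> ('n \<Rightarrow> ('n::{finite,linorder}) amb cvf) \<Rightarrow>
     (('n::{finite,linorder}) amb \<Rightarrow> ('n::{finite,linorder}) amb) \<Rightarrow> bool" where
  "normalized_frame M p r s h U Lb c \<longleftrightarrow> open U \<and> p \<in> U \<and> CR_basis M U Lb \<and> char_form M U c \<and>
     (\<forall>\<alpha> \<beta>. Top (Lb \<alpha>) (thform c) (cnjv (Lb \<beta>)) p = gmat r s \<alpha> \<beta>) \<and>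
     (\<forall>\<alpha> \<beta> \<gamma>. r + s < pos \<gamma> \<longrightarrow> Top (Lb \<alpha>) (Top (Lb \<beta>) (thform c)) (cnjv (Lb \<gamma>)) p = h \<alpha> \<beta> \<gamma>)"

lemma (in normal_form) normalized_frame_exists:
  assumes sym: "\<forall>\<alpha> \<beta> \<gamma>. r + s < pos \<gamma> \<longrightarrow> h \<alpha> \<beta> \<gamma> = h \<beta> \<alpha> \<gamma>"
  shows "\<exists>V Lb c. normalized_frame M p r s h V Lb c"
proof -
  obtain W where pW: "p \<in> W" and "hypersurface_nbhd M W rho" using rho_nbhd by blast
  then interpret hypersurface_nbhd M W rho by blast
  note linear_d\<Phi> = linear_dd[OF cinf_on_holo[OF holo] center_mem] and Jc_d\<Phi> = holo_dd1_Jc[OF holo center_mem]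
  have "\<forall>\<alpha>. \<exists>v. dd [v] \<Phi> p = (axis \<alpha> (- \<i> / 2), 0)"
    using hol_coords_dd_surj[OF coords center_mem] by metis
  then obtain a where a: "\<And>\<alpha>. dd [a \<alpha>] \<Phi> p = (axis \<alpha> (- \<i> / 2), 0)" by metis
  have tangent: "dd [a \<alpha>] rho p = 0" "dd [Jc (a \<alpha>)] rho p = 0" for \<alpha>
    by (simp_all add: dd_rho Jc_d\<Phi> a)
  have indep: "\<forall>\<alpha>. d \<alpha> = 0" if zero: "(\<Sum>\<alpha>\<in>UNIV. d \<alpha> *\<^sub>C a \<alpha>) = 0" for d
  proof
    fix \<beta>
    have "linear (\<lambda>v. fst (dd [v] \<Phi> p) $ \<beta>)"
      by (rule linearI) (simp_all add: linear_add[OF linear_d\<Phi>] linear_scale[OF linear_d\<Phi>])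
    from complex_linear_functional_sum[OF this, of d a UNIV]
    show "d \<beta> = 0"
      using zero linear_0[OF linear_d\<Phi>] by (simp add: Jc_d\<Phi> a axis_def if_distrib[of "(*) _"] cong: if_cong)
  qed
  obtain V Lb where V: "open V" "p \<in> V" "V \<subseteq> W" and Lb: "CR_basis M V Lb" "\<And>\<alpha>. fst (Lb \<alpha>) p = a \<alpha>"
    using CR_basis_exists[of p a] center_mem_M pW tangent indep by blast
  let ?c = "\<lambda>x. - Jc (grad rho x)"
  have form: "char_form M V ?c" by (rule char_form_subset[OF char_form_grad V(1,3)])
  interpret normal_form_frame M p r s h U \<Phi> R U' V Lb ?c
  proof
    show "- Jc (grad rho p) \<bullet> v = - Re (snd (dd [v] \<Phi> p))" for v
      using grad_inner[OF smooth pW, of "Jc v"] by (simp add: inner_Jc_left dd_rho Jc_d\<Phi>)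
  qed (use V(1,2) Lb form in \<open>auto simp: CR_basis_def a\<close>)
  have "normalized_frame M p r s h V Lb ?c"
    unfolding normalized_frame_def using V(1,2) Lb(1) form Top_frame Top_Top_frame[OF sym] by blast
  then show ?thesis by blast
qed

subsection \<open>Order of vanishing at zero from the right\<close>

definition order_ge :: "nat \<Rightarrow> (real \<Rightarrow> 'a::real_normed_vector) \<Rightarrow> bool" where
  "order_ge k f \<longleftrightarrow> (\<lambda>t. norm (f t)) \<in> O[at_right 0](\<lambda>t. t ^ k)"

lemma order_ge_bound:
  assumes f: "order_ge k f" and "\<forall>\<^sub>F t in at_right 0. norm (g t) \<le> C * norm (f t)"
  shows "order_ge k g"
  using landau_o.big_trans[OF bigoI f[unfolded order_ge_def]] assms(2) by (simp add: order_ge_def)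

lemma order_ge_cong:
  assumes "order_ge k f" "\<forall>\<^sub>F t in at_right 0. f t = g t"
  shows "order_ge k g"
  by (rule order_ge_bound[OF assms(1), where C=1]) (use assms(2) in \<open>auto elim: eventually_mono\<close>)

lemma eventually_at_right_0_less: "0 < d \<Longrightarrow> \<forall>\<^sub>F t in at_right 0. 0 < t \<and> t < d" for d :: real
  by (auto simp: eventually_at_right)

lemma power_bigo_at_right_0:
  assumes "j \<le> k"
  shows "(\<lambda>t :: real. t ^ k) \<in> O[at_right 0](\<lambda>t. t ^ j)"
proof (rule bigoI[where c=1])
  show "\<forall>\<^sub>F t :: real in at_right 0. norm (t ^ k) \<le> 1 * norm (t ^ j)"
    using eventually_at_right_0_less[OF zero_less_one]
    by eventually_elim (use assms in \<open>auto intro: power_decreasing\<close>)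
qed

lemma order_ge_mono: "order_ge k f \<Longrightarrow> j \<le> k \<Longrightarrow> order_ge j f"
  unfolding order_ge_def using landau_o.big_trans[OF _ power_bigo_at_right_0] by blast

lemma order_ge_power: "k \<le> j \<Longrightarrow> order_ge k (\<lambda>t. t ^ j *\<^sub>R v)"
  by (rule order_ge_mono[of j]) (auto simp: order_ge_def intro!: bigoI[where c="norm v"] simp: mult.commute)

lemma order_ge_zero: "order_ge k (\<lambda>t. 0)"
  by (simp add: order_ge_def)

lemma order_ge_add: "order_ge k f \<Longrightarrow> order_ge k g \<Longrightarrow> order_ge k (\<lambda>t. f t + g t)"
  by (rule order_ge_bound[of k "\<lambda>t. norm (f t) + norm (g t)" _ 1])
    (simp_all add: order_ge_def sum_in_bigo(1) always_eventually norm_triangle_ineq)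

lemma order_ge_bounded_linear:
  assumes "bounded_linear l" "order_ge k f"
  shows "order_ge k (\<lambda>t. l (f t))"
proof -
  obtain C where "\<And>x. norm (l x) \<le> norm x * C" using bounded_linear.bounded[OF assms(1)] by blast
  then show ?thesis by (intro order_ge_bound[OF assms(2), of _ C] always_eventually) (simp add: mult.commute)
qed

lemma order_ge_diff: "order_ge k f \<Longrightarrow> order_ge k g \<Longrightarrow> order_ge k (\<lambda>t. f t - g t)"
  using order_ge_add[OF _ order_ge_bounded_linear[OF bounded_linear_minus[OF bounded_linear_ident]], of k f g] by simp

lemma order_ge_sum: "(\<And>i. i \<in> I \<Longrightarrow> order_ge k (f i)) \<Longrightarrow> order_ge k (\<lambda>t. \<Sum>i\<in>I. f i t)"
  by (induction I rule: infinite_finite_induct) (simp_all add: order_ge_zero order_ge_add)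

lemma order_ge_Pair: "order_ge k f \<Longrightarrow> order_ge k g \<Longrightarrow> order_ge k (\<lambda>t. (f t, g t))"
  using order_ge_add[OF order_ge_bounded_linear[OF bounded_linear_Pair[OF bounded_linear_ident bounded_linear_zero]]
      order_ge_bounded_linear[OF bounded_linear_Pair[OF bounded_linear_zero bounded_linear_ident]], of k f g]
  by simp

lemma order_ge_bounded_bilinear:
  assumes B: "bounded_bilinear B" and f: "order_ge j f" and g: "order_ge k g" and "m \<le> j + k"
  shows "order_ge m (\<lambda>t. B (f t) (g t))"
proof (rule order_ge_mono[OF _ assms(4)])
  obtain C where C: "\<And>x y. norm (B x y) \<le> norm x * norm y * C" using bounded_bilinear.bounded[OF B] by blast
  have "(\<lambda>t. norm (f t) * norm (g t)) \<in> O[at_right 0](\<lambda>t. t ^ (j + k))"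
    using landau_o.big.mult[OF f[unfolded order_ge_def] g[unfolded order_ge_def]] by (simp add: power_add)
  then have "order_ge (j + k) (\<lambda>t. norm (f t) * norm (g t))" by (simp add: order_ge_def)
  then show "order_ge (j + k) (\<lambda>t. B (f t) (g t))"
    by (rule order_ge_bound[of _ _ _ C]) (use C in \<open>simp add: mult.commute\<close>)
qed

lemma order_ge_linear:
  fixes l :: "'a::euclidean_space \<Rightarrow> 'b::real_normed_vector"
  assumes "linear l" "order_ge k f"
  shows "order_ge k (\<lambda>t. l (f t))"
  by (rule order_ge_bounded_linear[OF assms(1)[unfolded linear_conv_bounded_linear] assms(2)])

lemma order_ge_bilinear:
  fixes B :: "'a::euclidean_space \<Rightarrow> 'b::euclidean_space \<Rightarrow> 'c::real_normed_vector"
  assumes "bilinear B" "order_ge j f" "order_ge k g" "m \<le> j + k"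
  shows "order_ge m (\<lambda>t. B (f t) (g t))"
  by (rule order_ge_bounded_bilinear[OF assms(1)[unfolded bilinear_conv_bounded_bilinear] assms(2-4)])

lemma order_ge_trilinear:
  fixes T :: "'a::euclidean_space \<Rightarrow> 'b::euclidean_space \<Rightarrow> 'c::euclidean_space \<Rightarrow> 'd::real_normed_vector"
  assumes T: "trilinear T" and f: "order_ge i f" and g: "order_ge j g" and h: "order_ge k h" and "m \<le> i + j + k"
  shows "order_ge m (\<lambda>t. T (f t) (g t) (h t))"
proof -
  have "order_ge m (\<lambda>t. \<Sum>b\<in>Basis. (f t \<bullet> b) *\<^sub>R T b (g t) (h t))"
  proof (intro order_ge_sum order_ge_bounded_bilinear[OF bounded_bilinear_scaleR])
    fix b :: 'a
    have "bilinear (T b)" using trilinearD[OF T] by (simp add: bilinear_def)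
    then show "order_ge (j + k) (\<lambda>t. T b (g t) (h t))" by (rule order_ge_bilinear[OF _ g h order_refl])
    show "order_ge i (\<lambda>t. f t \<bullet> b)" by (rule order_ge_bounded_linear[OF bounded_linear_inner_left f])
    show "m \<le> i + (j + k)" using assms(5) by simp
  qed
  moreover have "T (f t) (g t) (h t) = (\<Sum>b\<in>Basis. (f t \<bullet> b) *\<^sub>R T b (g t) (h t))" for t
    by (rule linear_basis_expand[OF trilinearD(1)[OF T]])
  ultimately show ?thesis by (simp only:)
qed

lemma order_ge_tendsto_0:
  assumes "order_ge (Suc k) f"
  shows "(f \<longlongrightarrow> 0) (at_right 0)"
proof -
  have "(\<lambda>t. norm (f t)) \<in> O[at_right 0](\<lambda>t. t ^ 1)"
    using order_ge_mono[OF assms, of 1] by (simp add: order_ge_def)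
  then obtain C where "\<forall>\<^sub>F t in at_right 0. norm (norm (f t)) \<le> C * norm (t ^ 1)" by (rule landau_o.bigE)
  then have "\<forall>\<^sub>F t in at_right 0. norm (f t) \<le> norm t * C" by eventually_elim (simp add: mult.commute)
  then show ?thesis by (rule tendsto_0_le[OF tendsto_ident_at])
qed

lemma order_ge_eventually_mem:
  assumes "order_ge (Suc k) v" "open U" "0 \<in> U"
  shows "\<forall>\<^sub>F t in at_right 0. v t \<in> U"
  using topological_tendstoD[OF order_ge_tendsto_0[OF assms(1)] assms(2,3)] .

lemma order_ge_eventually_nhds:
  assumes "order_ge (Suc k) v" "\<forall>\<^sub>F y in nhds 0. P y"
  shows "\<forall>\<^sub>F t in at_right 0. P (v t)"
  using eventually_compose_filterlim[OF assms(2) order_ge_tendsto_0[OF assms(1)]] .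

lemma order_ge_differentiable:
  assumes f: "(f has_derivative f') (at 0)" and f_0: "f 0 = 0" and v: "order_ge (Suc k) v"
  shows "order_ge (Suc k) (\<lambda>t. f (v t))"
proof -
  obtain K where K: "\<And>x. norm (f' x) \<le> norm x * K"
    using bounded_linear.bounded[OF has_derivative_bounded_linear[OF f]] by blast
  obtain d where d: "d > 0" "\<And>y. norm y < d \<Longrightarrow> norm (f y - f' y) \<le> norm y"
    using f f_0 unfolding has_derivative_at_alt by (metis diff_zero mult_1 zero_less_one)
  have "norm (f y) \<le> (1 + K) * norm y" if "y \<in> ball 0 d" for y
    using norm_triangle_ineq[of "f y - f' y" "f' y"] d(2)[of y] K[of y] that by (simp add: algebra_simps)
  then have "\<forall>\<^sub>F y in nhds 0. norm (f y) \<le> (1 + K) * norm y"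
    using d(1) by (intro eventually_nhds[THEN iffD2] exI[of _ "ball 0 d"]) simp
  from order_ge_eventually_nhds[OF v this] show ?thesis by (rule order_ge_bound[OF v])
qed

lemma order_ge_coeff_eq_0:
  fixes c :: "nat \<Rightarrow> 'a::real_normed_vector"
  assumes "order_ge n (\<lambda>t. \<Sum>i<n. t ^ i *\<^sub>R c i)" "i < n"
  shows "c i = 0"
  using assms
proof (induction n arbitrary: i)
  case (Suc n)
  have "order_ge n (\<lambda>t. (\<Sum>i<Suc n. t ^ i *\<^sub>R c i) - t ^ n *\<^sub>R c n)"
    by (intro order_ge_diff order_ge_mono[OF Suc.prems(1)] order_ge_power) simp_all
  then have lower: "c i = 0" if "i < n" for i using Suc.IH that by simp
  then have "order_ge (Suc n) (\<lambda>t. t ^ n *\<^sub>R c n)" using Suc.prems(1) by simp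
  then obtain C where "\<forall>\<^sub>F t in at_right 0. norm (norm (t ^ n *\<^sub>R c n)) \<le> C * norm (t ^ Suc n)"
    unfolding order_ge_def by (rule landau_o.bigE)
  then have "\<forall>\<^sub>F t in at_right 0. norm (c n) \<le> C * t"
    using eventually_at_right_0_less[OF zero_less_one] by eventually_elim (simp add: mult_ac)
  moreover have "((\<lambda>t. C * t) \<longlongrightarrow> C * 0) (at_right 0)" by (intro tendsto_intros)
  ultimately have "norm (c n) \<le> C * 0" by (intro tendsto_lowerbound[of "\<lambda>t. C * t"]) auto
  with lower Suc.prems(2) show ?case by (auto simp: less_Suc_eq)
qed simp

subsection \<open>Weighted Taylor expansion\<close>

lemma order_ge_Taylor:
  fixes f :: "'a::euclidean_space \<Rightarrow> real"
  assumes f: "cinf_on U f" "0 \<in> U" and v: "order_ge 1 v" and n: "0 < n"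
  shows "order_ge n (\<lambda>t. f (v t) - (\<Sum>m<n. dd (replicate m (v t)) f 0 / fact m))"
proof -
  obtain C where "\<forall>\<^sub>F v in nhds 0. \<bar>f (0 + v) - (\<Sum>m<n. dd (replicate m v) f 0 / fact m)\<bar> \<le> C * norm v ^ n"
    using Taylor_dd[OF f n] by blast
  then have remainder: "\<forall>\<^sub>F t in at_right 0. \<bar>f (0 + v t) - (\<Sum>m<n. dd (replicate m (v t)) f 0 / fact m)\<bar> \<le>
      C * norm (v t) ^ n"
    by (rule order_ge_eventually_nhds[OF v[unfolded One_nat_def]])
  have "(\<lambda>t. norm (v t) ^ n) \<in> O[at_right 0](\<lambda>t. (t ^ 1) ^ n)"
    by (rule landau_o.big_power[OF v[unfolded order_ge_def]])
  then have "order_ge n (\<lambda>t. norm (v t) ^ n)" by (simp add: order_ge_def)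
  then show ?thesis by (rule order_ge_bound) (use remainder in simp)
qed

definition weighted_jet :: "('a::real_normed_vector \<times> 'b::real_normed_vector \<Rightarrow> real) \<Rightarrow> 'a \<Rightarrow> 'b \<Rightarrow> real" where
  "weighted_jet f z u = f 0 + dd [(z, 0)] f 0 + dd [(0, u)] f 0 + dd [(z, 0), (z, 0)] f 0 / 2
     + dd [(z, 0), (0, u)] f 0 + dd [(z, 0), (z, 0), (z, 0)] f 0 / 6"

lemma order_ge_weighted_jet:
  fixes f :: "'a::euclidean_space \<times> 'b::euclidean_space \<Rightarrow> real"
  assumes f: "cinf_on U f" "0 \<in> U" and z: "order_ge 1 z" and u: "order_ge 2 u"
  shows "order_ge 4 (\<lambda>t. f (z t, u t) - weighted_jet f (z t) (u t))"
proof -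
  define v where "v t = (z t, u t)" for t
  define a b where "a t = (z t, 0 :: 'b)" and "b t = (0 :: 'a, u t)" for t
  note linear = linear_dd[OF f] and bilinear = bilinear_dd2[OF f] and trilinear = trilinear_dd3[OF f]
  have order: "order_ge 1 v" "order_ge 1 a" "order_ge 2 b"
    unfolding v_def[abs_def] a_def[abs_def] b_def[abs_def]
    by (intro order_ge_Pair z u order_ge_zero order_ge_mono[OF u]; simp)+
  have v: "v t = a t + b t" for t by (simp add: v_def a_def b_def)
  have "order_ge 4 (\<lambda>t. f (v t) - (\<Sum>m<4. dd (replicate m (v t)) f 0 / fact m)
      + (dd [b t, b t] f 0 /\<^sub>R 2
        + (dd [b t, v t, v t] f 0 + dd [a t, b t, v t] f 0 + dd [a t, a t, b t] f 0) /\<^sub>R 6))"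
    by (intro order_ge_add order_ge_Taylor[OF f order(1)] order_ge_bounded_linear[OF bounded_linear_scaleR_right]
        order_ge_bilinear[OF bilinear order(3,3)] order_ge_trilinear[OF trilinear order(3,1,1)]
        order_ge_trilinear[OF trilinear order(2,3,1)] order_ge_trilinear[OF trilinear order(2,2,3)]) simp_all
  moreover have "f (v t) - (\<Sum>m<4. dd (replicate m (v t)) f 0 / fact m)
      + (dd [b t, b t] f 0 /\<^sub>R 2
        + (dd [b t, v t, v t] f 0 + dd [a t, b t, v t] f 0 + dd [a t, a t, b t] f 0) /\<^sub>R 6)
      = f (z t, u t) - weighted_jet f (z t) (u t)" for t
  proof -
    have "dd [v t, v t] f 0 = dd [a t, a t] f 0 + 2 * dd [a t, b t] f 0 + dd [b t, b t] f 0"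
      unfolding v using dd_swap[OF f, of "b t" "a t"] by (simp add: bilinear_simps[OF bilinear])
    moreover have "dd [v t, v t, v t] f 0 = dd [a t, a t, a t] f 0
        + (dd [b t, v t, v t] f 0 + dd [a t, b t, v t] f 0 + dd [a t, a t, b t] f 0)"
      unfolding v by (simp add: trilinear_simps[OF trilinear])
    ultimately show ?thesis
      by (simp add: weighted_jet_def a_def[symmetric] b_def[symmetric] v_def[symmetric] eval_nat_numeral
          linear_add[OF linear] v field_simps)
  qed
  ultimately show ?thesis by simp
qed

subsection \<open>Polarization\<close>

lemma bilinear_compose:
  assumes "linear f" "linear g" "bilinear B"
  shows "bilinear (\<lambda>x y. B (f x) (g y))"
  unfolding bilinear_def
  by (intro conjI allI linearI) (simp_all add: bilinear_simps[OF assms(3)] linear_add[OF assms(1)]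
      linear_add[OF assms(2)]
      linear_scale[OF assms(1)] linear_scale[OF assms(2)])

lemma trilinear_compose:
  assumes "linear f" "linear g" "linear h" "trilinear T"
  shows "trilinear (\<lambda>x y z. T (f x) (g y) (h z))"
  unfolding trilinear_def
  by (intro conjI allI linearI) (simp_all add: trilinear_simps[OF assms(4)] linear_add[OF assms(1)]
      linear_add[OF assms(2)]
      linear_add[OF assms(3)] linear_scale[OF assms(1)] linear_scale[OF assms(2)] linear_scale[OF assms(3)])

lemma bilinear_eq_0_if_diag_eq_0:
  assumes B: "bilinear B" and sym: "\<And>x y. B x y = B y x" and diag: "\<And>x. B x x = 0"
  shows "B x y = 0"
proof -
  have "B x y + B x y = 0"
    using diag[of "x + y"] diag[of x] diag[of y] sym[of y x] by (simp add: bilinear_simps[OF B])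
  then show ?thesis by (simp flip: scaleR_2)
qed

lemma trilinear_eq_0_if_diag_eq_0:
  fixes T :: "'a::real_vector \<Rightarrow> 'a \<Rightarrow> 'a \<Rightarrow> 'b::real_vector"
  assumes T: "trilinear T" and sym: "\<And>x y z. T x y z = T y x z" "\<And>x y z. T x y z = T x z y"
      and diag: "\<And>x. T x x x = 0"
  shows "T x y z = 0"
proof -
  have triple: "3 *\<^sub>R a = a + a + a" for a :: 'b
    using scaleR_left_distrib[of 2 1 a] by (simp add: scaleR_2)
  have expand: "3 *\<^sub>R T x x y + 3 *\<^sub>R T x y y = 0" for x y
    using diag[of "x + y"] diag[of x] diag[of y] sym(1)[of y x y] sym(2)[of x y x] sym(1)[of y x x] sym(2)[of y y x]
    by (simp add: trilinear_simps[OF T] triple algebra_simps)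
  have "T x x y = 0" for x y
  proof -
    have "6 *\<^sub>R T x x y = (3 *\<^sub>R T x x y + 3 *\<^sub>R T x y y) - (3 *\<^sub>R T x x (- y) + 3 *\<^sub>R T x (- y) (- y))"
      by (simp add: trilinear_simps[OF T] flip: scaleR_left_distrib)
    then show ?thesis unfolding expand by simp
  qed
  then show ?thesis
    using bilinear_eq_0_if_diag_eq_0[of "\<lambda>x y. T x y z"] trilinearD[OF T] sym(1) by (simp add: bilinear_def)
qed

subsection \<open>A criterion for vanishing to weighted order four\<close>

lemma weighted_jet_scaled:
  fixes f :: "'a::euclidean_space \<times> 'b::euclidean_space \<Rightarrow> real"
  assumes f: "cinf_on U f" "0 \<in> U"
  shows "weighted_jet f (t *\<^sub>R z) (t\<^sup>2 *\<^sub>R u) = f 0 + t * dd [(z, 0)] f 0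
      + t\<^sup>2 * (dd [(0, u)] f 0 + dd [(z, 0), (z, 0)] f 0 / 2)
    + t ^ 3 * (dd [(z, 0), (0, u)] f 0 + dd [(z, 0), (z, 0), (z, 0)] f 0 / 6)"
proof -
  have "(t *\<^sub>R z, 0) = t *\<^sub>R (z, 0 :: 'b)" "(0, t\<^sup>2 *\<^sub>R u) = t\<^sup>2 *\<^sub>R (0 :: 'a, u)" by simp_all
  then show ?thesis
    unfolding weighted_jet_def
    by (simp add: linear_scale[OF linear_dd[OF f]] bilinear_simps[OF bilinear_dd2[OF f]]
        trilinear_simps[OF trilinear_dd3[OF f]] algebra_simps power2_eq_square power3_eq_cube del: scaleR_Pair)
qed

lemma jets_vanish_if_order_ge_4:
  fixes f :: "'a::euclidean_space \<times> 'b::euclidean_space \<Rightarrow> real"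
  assumes f: "cinf_on U f" "0 \<in> U" and order: "\<And>z u. order_ge 4 (\<lambda>t. f (t *\<^sub>R z, t\<^sup>2 *\<^sub>R u))"
  shows "f 0 = 0" "dd [v] f 0 = 0" "dd [(z, 0), v] f 0 = 0" "dd [(x, 0), (y, 0), (z, 0)] f 0 = 0"
proof -
  define coeff where "coeff z u = (\<lambda>i. [f 0, dd [(z, 0)] f 0, dd [(0, u)] f 0 + dd [(z, 0), (z, 0)] f 0 / 2,
    dd [(z, 0), (0, u)] f 0 + dd [(z, 0), (z, 0), (z, 0)] f 0 / 6] ! i)" for z u
  have coeff: "coeff z u i = 0" if "i < 4" for i z u
  proof (rule order_ge_coeff_eq_0[OF _ that])
    have "order_ge 1 (\<lambda>t. t *\<^sub>R z)" "order_ge 2 (\<lambda>t. t\<^sup>2 *\<^sub>R u)"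
      using order_ge_power[of 1 1 z] order_ge_power[of 2 2 u] by simp_all
    from order_ge_diff[OF order[of z u] order_ge_weighted_jet[OF f this]]
    have "order_ge 4 (\<lambda>t. weighted_jet f (t *\<^sub>R z) (t\<^sup>2 *\<^sub>R u))" by simp
    then show "order_ge 4 (\<lambda>t. \<Sum>i<4. t ^ i *\<^sub>R coeff z u i)"
      unfolding weighted_jet_scaled[OF f] by (simp add: coeff_def eval_nat_numeral)
  qed
  have weights: "f 0 = 0" "dd [(z, 0)] f 0 = 0" "dd [(0, u)] f 0 + dd [(z, 0), (z, 0)] f 0 / 2 = 0"
    "dd [(z, 0), (0, u)] f 0 + dd [(z, 0), (z, 0), (z, 0)] f 0 / 6 = 0" for z u
    using coeff[of 0 z u] coeff[of 1 z u] coeff[of 2 z u] coeff[of 3 z u] by (simp_all add: coeff_def numeral_eq_Suc)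
  note at_0 = linear_0[OF linear_dd[OF f]] bilinear_rzero[OF bilinear_dd2[OF f]]
  have zz: "dd [(z, 0), (z, 0)] f 0 = 0" and zzz: "dd [(z, 0), (z, 0), (z, 0)] f 0 = 0" for z
    using weights(3)[where u=0 and z=z] weights(4)[where u=0 and z=z] at_0 by (simp_all add: zero_prod_def)
  have u: "dd [(0, u)] f 0 = 0" and zu: "dd [(z, 0), (0, u)] f 0 = 0" for z u
    using weights(3)[where u=u and z=0] weights(4)[where u=u and z=z] zz zzz by simp_all
  have inclusion: "linear (\<lambda>x :: 'a. (x, 0 :: 'b))" by (rule linearI) simp_all
  have horizontal: "dd [(x, 0), (y, 0)] f 0 = 0" for x y
    by (rule bilinear_eq_0_if_diag_eq_0[OF bilinear_compose[OF inclusion inclusion bilinear_dd2[OF f]]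
        dd_swap[OF f] zz])
  show "dd [(x, 0), (y, 0), (z, 0)] f 0 = 0"
    by (rule trilinear_eq_0_if_diag_eq_0[OF trilinear_compose[OF inclusion inclusion inclusion trilinear_dd3[OF f]]
          dd3_swap[OF f] zzz])
  have v: "v = (fst v, 0) + (0, snd v)" by simp
  show "f 0 = 0" by (rule weights(1))
  show "dd [v] f 0 = 0"
    by (subst v) (simp only: linear_add[OF linear_dd[OF f]] weights(2) u)
  show "dd [(z, 0), v] f 0 = 0"
    by (subst v) (simp only: bilinear_radd[OF bilinear_dd2[OF f]] horizontal zu)
qed

lemma weighted_vanish4I:
  fixes R :: "(complex ^ 'n::finite) \<times> real \<Rightarrow> real"
  assumes R: "cinf_on W R" "0 \<in> W" and order: "\<And>z u. order_ge 4 (\<lambda>t. R (t *\<^sub>R z, t\<^sup>2 *\<^sub>R u))"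
  shows "weighted_vanish4 R"
  unfolding weighted_vanish4_def
proof (intro exI conjI allI impI)
  show "0 \<in> W" "cinf_on W R" by fact+
  fix vs :: "((complex ^ 'n) \<times> real) list"
  assume vs: "set vs \<subseteq> Basis \<and> sum_list (map wt vs) < 4"
  note jets = jets_vanish_if_order_ge_4[OF R order]
  have wt_ge: "1 \<le> wt b" and weight_1: "wt b < 2 \<Longrightarrow> b = (fst b, 0)" for b :: "(complex ^ 'n) \<times> real"
    by (auto simp: wt_def prod_eq_iff split: if_splits)
  consider (none) "vs = []" | (one) b where "vs = [b]" | (two) b b' where "vs = [b, b']"
    | (three) b b' b'' where "vs = [b, b', b'']" | (many) a b b' b'' ws where "vs = a # b # b' # b'' # ws"
    by (metis list.exhaust)
  then show "dd vs R 0 = 0"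
  proof cases
    case none
    then show ?thesis using jets(1) by simp
  next
    case (one b)
    then show ?thesis using jets(2) by simp
  next
    case (two b b')
    with vs have "wt b < 2 \<or> wt b' < 2" by auto
    then have "b = (fst b, 0) \<or> b' = (fst b', 0)" using weight_1 by blast
    then show ?thesis
      using two jets(3)[of "fst b" b'] jets(3)[of "fst b'" b] dd_swap[OF R, of b b'] by metis
  next
    case (three b b' b'')
    with vs have "wt b + wt b' + wt b'' < 4" by simp
    then have "b = (fst b, 0)" "b' = (fst b', 0)" "b'' = (fst b'', 0)"
      using wt_ge[of b] wt_ge[of b'] wt_ge[of b''] by (intro weight_1; linarith)+
    then show ?thesis using three jets(4)[of "fst b" "fst b'" "fst b''"] by metis
  next
    case (many a b b' b'' ws)
    then show ?thesis using vs wt_ge[of a] wt_ge[of b] wt_ge[of b'] wt_ge[of b''] by simp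
  qed
qed

subsection \<open>Graphs with normalized Levi form\<close>

definition graph_remainder :: "nat \<Rightarrow> nat \<Rightarrow> ('n \<Rightarrow> 'n \<Rightarrow> 'n \<Rightarrow> complex) \<Rightarrow>
    ((complex ^ ('n::{finite,linorder})) \<times> real \<Rightarrow> real) \<Rightarrow> (complex ^ ('n::{finite,linorder})) \<times> real \<Rightarrow> real" where
  "graph_remainder r s h \<phi> x = - rho_model r s h (\<lambda>x. 0) (graph_point \<phi> x)"

lemma rho_model_graph_remainder: "rho_model r s h (graph_remainder r s h \<phi>) Z = \<phi> (graph_base Z) - Im (snd Z)"
  by (simp add: rho_model_eq graph_remainder_def graph_point_def graph_base_def model_form_def model_cubic_def)

lemma cinf_on_graph_remainder:
  fixes \<phi> :: "(complex ^ ('n::{finite,linorder})) \<times> real \<Rightarrow> real"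
  assumes "cinf_on D \<phi>"
  shows "cinf_on D (graph_remainder r s h \<phi>)"
proof -
  have eq: "graph_remainder r s h \<phi> = (\<lambda>x. \<phi> x - Re (model_form r s (fst x, 0) (fst x, 0))
      - 2 * Re (model_cubic r s h (fst x, 0) (fst x, 0) (fst x, 0)))"
    by (rule ext) (simp add: graph_remainder_def rho_model_eq graph_point_def model_form_def model_cubic_def)
  have lin: "linear (\<lambda>x :: (complex ^ ('n::{finite,linorder})) \<times> real. (fst x, 0 :: complex))"
    by (rule linearI) simp_all
  note D = cinf_on_open[OF assms]
  show ?thesis
    unfolding eq
    by (intro cinf_on_diff assms cinf_on_mult cinf_on_const D
        cinf_on_bounded_linear_apply[OF cinf_on_bilinear_diag[OF D
            bilinear_compose[OF lin lin bilinear_model_form]] bounded_linear_Re]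
        cinf_on_bounded_linear_apply[OF cinf_on_trilinear_diag[OF D
            trilinear_compose[OF lin lin lin trilinear_model_cubic]] bounded_linear_Re])
qed

lemma normal_form_if_graph:
  assumes coords: "hol_coords U \<Phi>" and p: "p \<in> U" "\<Phi> p = 0" and V: "open V" "0 \<in> V"
    and remainder: "weighted_vanish4 (graph_remainder r s h \<phi>)"
    and graph: "\<And>x. x \<in> U \<Longrightarrow> \<Phi> x \<in> V \<Longrightarrow> x \<in> M \<longleftrightarrow> Im (snd (\<Phi> x)) = \<phi> (graph_base (\<Phi> x))"
  shows "normal_form M p r s h U \<Phi> (graph_remainder r s h \<phi>) (\<Phi> -` V \<inter> U)"
proof
  have hol: "holo_on U \<Phi>" using coords by (simp add: hol_coords_def)
  show "open (\<Phi> -` V \<inter> U)"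
    using continuous_on_open_vimage[OF cinf_on_open[OF cinf_on_holo[OF hol]]]
        cinf_on_continuous[OF cinf_on_holo[OF hol]] V(1) by blast
  show "M \<inter> (\<Phi> -` V \<inter> U) = {x \<in> \<Phi> -` V \<inter> U. rho_model r s h (graph_remainder r s h \<phi>) (\<Phi> x) = 0}"
    using graph by (auto simp: rho_model_graph_remainder)
qed (use coords p V remainder in auto)

lemma dd_graph_point:
  fixes \<phi> :: "(complex ^ 'n::finite) \<times> real \<Rightarrow> real"
  assumes \<phi>: "cinf_on D \<phi>"
  shows "cinf_on D (graph_point \<phi>)"
    and "x \<in> D \<Longrightarrow> dd [v] (graph_point \<phi>) x = (fst v, Complex (snd v) (dd [v] \<phi> x))"
    and "x \<in> D \<Longrightarrow> dd [u, v] (graph_point \<phi>) x = (0, Complex 0 (dd [u, v] \<phi> x))"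
proof -
  define \<iota> where "\<iota> = (\<lambda>x :: (complex ^ 'n) \<times> real. (fst x, Complex (snd x) 0))"
  have \<iota>: "linear \<iota>" by (rule linearI) (simp_all add: \<iota>_def complex_eq_iff)
  have vertical: "bounded_linear (\<lambda>y. (0 :: complex ^ 'n, Complex 0 y))"
    by (auto intro!: linearI simp: complex_eq_iff simp flip: linear_conv_bounded_linear)
  have graph_point: "graph_point \<phi> = (\<lambda>x. \<iota> x + (0, Complex 0 (\<phi> x)))"
    by (auto simp: graph_point_def \<iota>_def complex_eq_iff)
  note smooth = cinf_on_linear[OF cinf_on_open[OF \<phi>] \<iota>] cinf_on_bounded_linear_apply[OF \<phi> vertical]
  show "cinf_on D (graph_point \<phi>)" unfolding graph_point by (rule cinf_on_add[OF smooth])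
  have "dd vs (graph_point \<phi>) x = dd vs \<iota> x + (0, Complex 0 (dd vs \<phi> x))" if "x \<in> D" for vs x
    unfolding graph_point dd_add[OF smooth that] dd_bounded_linear_apply[OF \<phi> vertical that] ..
  then show "x \<in> D \<Longrightarrow> dd [v] (graph_point \<phi>) x = (fst v, Complex (snd v) (dd [v] \<phi> x))"
    "x \<in> D \<Longrightarrow> dd [u, v] (graph_point \<phi>) x = (0, Complex 0 (dd [u, v] \<phi> x))"
    by (simp_all add: dd_linear_form[OF \<iota>]) (simp_all add: \<iota>_def complex_eq_iff)
qed

lemma implicit_graph_jets:
  fixes f :: "'n::finite amb \<Rightarrow> real"
  assumes f: "cinf_on V f" and df: "\<And>v. dd [v] f 0 = - Im (snd v)"
    and \<phi>: "cinf_on D \<phi>" "0 \<in> D" "\<phi> 0 = 0"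
    and sub: "\<And>x. x \<in> D \<Longrightarrow> graph_point \<phi> x \<in> V" and zero: "\<And>x. x \<in> D \<Longrightarrow> f (graph_point \<phi> x) = 0"
  shows "dd [v] \<phi> 0 = 0" and "dd [u, v] \<phi> 0 = dd [(fst u, Complex (snd u) 0), (fst v, Complex (snd v) 0)] f 0"
proof -
  note graph = dd_graph_point[OF \<phi>(1)] and smooth = dd_graph_point(1)[OF \<phi>(1)]
  have at_0: "graph_point \<phi> 0 = 0" using \<phi>(3) by (simp add: graph_point_def zero_prod_def complex_eq_iff)
  have vanish: "dd vs (\<lambda>x. f (graph_point \<phi> x)) 0 = dd vs (\<lambda>x. 0) 0" for vs
    by (rule dd_cong[OF cinf_on_open[OF \<phi>(1)] zero \<phi>(2)])
  show d\<phi>: "dd [v] \<phi> 0 = 0" for v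
    using vanish[of "[v]"] dd_compose[OF f smooth sub \<phi>(2), of v] graph(2)[OF \<phi>(2), of v]
    by (simp add: at_0 df dd_linear_form[OF linear_zero])
  show "dd [u, v] \<phi> 0 = dd [(fst u, Complex (snd u) 0), (fst v, Complex (snd v) 0)] f 0"
    using vanish[of "[u, v]"] dd_compose2[OF f smooth sub \<phi>(2), of u v] graph(2,3)[OF \<phi>(2)]
    by (simp add: at_0 df dd_linear_form[OF linear_zero] d\<phi>)
qed

locale levi_graph =
  fixes \<phi> :: "(complex ^ ('n::{finite,linorder})) \<times> real \<Rightarrow> real"
      and D :: "((complex ^ ('n::{finite,linorder})) \<times> real) set"
    and r s :: nat
  assumes smooth: "cinf_on D \<phi>" and zero_mem: "0 \<in> D" and \<phi>_0: "\<phi> 0 = 0" and d\<phi>: "dd [x] \<phi> 0 = 0"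
    and levi_form_jet: "levi_form (\<lambda>u v. dd [(fst u, 0), (fst v, 0)] \<phi> 0) u v = 4 * model_form r s u v"
begin

definition graph :: "('n::{finite,linorder}) amb set" where
  "graph = {Z. graph_base Z \<in> D \<and> Im (snd Z) = \<phi> (graph_base Z)}"

end

lemma levi_graph_exists:
  fixes f :: "('n::{finite,linorder}) amb \<Rightarrow> real"
  assumes f: "cinf_on V f" "0 \<in> V" "f 0 = 0" and df: "\<And>v. dd [v] f 0 = - Im (snd v)"
    and levi: "\<And>u v. snd u = 0 \<Longrightarrow> snd v = 0 \<Longrightarrow> levi_form (\<lambda>u v. dd [u, v] f 0) u v = 4 * model_form r s u v"
  obtains \<phi> D U where "levi_graph \<phi> D r s" "open U" "0 \<in> U" "U \<subseteq> V"
    "\<And>Z. Z \<in> U \<Longrightarrow> f Z = 0 \<longleftrightarrow> Z \<in> levi_graph.graph \<phi> D"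
proof -
  have "dd [(0, \<i>)] f 0 \<noteq> 0" by (simp add: df)
  then obtain U D \<phi> where U: "open U" "0 \<in> U" "U \<subseteq> V" and \<phi>: "cinf_on D \<phi>" "0 \<in> D" "\<phi> 0 = 0"
    and sub: "\<And>x. x \<in> D \<Longrightarrow> graph_point \<phi> x \<in> V" and zero: "\<And>x. x \<in> D \<Longrightarrow> f (graph_point \<phi> x) = 0"
    and base: "\<And>Z. Z \<in> U \<Longrightarrow> graph_base Z \<in> D"
    and iff: "\<And>Z. Z \<in> U \<Longrightarrow> f Z = 0 \<longleftrightarrow> Im (snd Z) = \<phi> (graph_base Z)"
    using implicit_graph[OF f] by blast
  note jets = implicit_graph_jets[OF f(1) df \<phi> sub zero]
  interpret levi_graph \<phi> D r s
  proof
    fix u v :: "('n::{finite,linorder}) amb"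
    have "Jc (fst w, 0) = (fst (Jc w), 0)" for w :: "('n::{finite,linorder}) amb" by (simp add: Jc_def)
    then have "levi_form (\<lambda>u v. dd [(fst u, 0), (fst v, 0)] \<phi> 0) u v =
        levi_form (\<lambda>u v. dd [u, v] f 0) (fst u, 0) (fst v, 0)"
      by (simp add: levi_form_eq jets(2) flip: zero_complex.code)
    also have "\<dots> = 4 * model_form r s u v" by (subst levi) (simp_all add: model_form_def)
    finally show "levi_form (\<lambda>u v. dd [(fst u, 0), (fst v, 0)] \<phi> 0) u v = 4 * model_form r s u v" .
  qed (use \<phi> jets(1) in auto)
  have "f Z = 0 \<longleftrightarrow> Z \<in> graph" if "Z \<in> U" for Z
    using iff[OF that] base[OF that] by (simp add: graph_def)
  with levi_graph_axioms U show ?thesis by (rule that)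
qed

subsection \<open>The normalizing change of coordinates\<close>

context levi_graph
begin

definition jet2 :: "('n::{finite,linorder}) amb \<Rightarrow> ('n::{finite,linorder}) amb \<Rightarrow> real" where
  "jet2 u v = dd [(fst u, 0), (fst v, 0)] \<phi> 0"

definition jet3 :: "('n::{finite,linorder}) amb \<Rightarrow> ('n::{finite,linorder}) amb \<Rightarrow> ('n::{finite,linorder}) amb \<Rightarrow>
    real" where
  "jet3 t u v = dd [(fst t, 0), (fst u, 0), (fst v, 0)] \<phi> 0"

definition mixed_jet :: "('n::{finite,linorder}) amb \<Rightarrow> real" where
  "mixed_jet u = dd [(fst u, 0), (0, 1)] \<phi> 0"

text \<open>Adding \<open>twist z * w\<close> to \<open>w\<close> removes the term \<open>mixed_jet z * Re w\<close> from \<open>Im w\<close>; in exchange it produces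
  \<open>Re (twist z) * Im w\<close>, which is cubic on the graph and therefore a part of \<open>cubic\<close>.\<close>

definition twist :: "('n::{finite,linorder}) amb \<Rightarrow> complex" where
  "twist u = - \<i> * hol_linear mixed_jet u"

definition cubic :: "('n::{finite,linorder}) amb \<Rightarrow> ('n::{finite,linorder}) amb \<Rightarrow> ('n::{finite,linorder}) amb \<Rightarrow>
    real" where
  "cubic t u v = jet3 t u v / 6 + (Re (twist t) * jet2 u v + Re (twist u) * jet2 t v + Re (twist v) * jet2 t u) / 6"

definition coeff :: "'n \<Rightarrow> 'n \<Rightarrow> 'n \<Rightarrow> complex" where
  "coeff \<alpha> \<beta> \<gamma> = 3 / 8 * levi_cubic cubic (axis \<alpha> 1, 0) (axis \<beta> 1, 0) (axis \<gamma> 1, 0)"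

text \<open>The terms \<open>coeff \<alpha> \<beta> \<gamma>\<close> with nondegenerate \<open>\<gamma>\<close> are absorbed by completing the square in the model form.\<close>

definition shift :: "('n::{finite,linorder}) amb \<Rightarrow> ('n::{finite,linorder}) amb \<Rightarrow> complex ^
    ('n::{finite,linorder})" where
  "shift u v = (\<chi> \<gamma>. eps r s \<gamma> * (\<Sum>\<alpha>\<in>UNIV. \<Sum>\<beta>\<in>UNIV. cnj (coeff \<alpha> \<beta> \<gamma>) * fst u $ \<alpha> * fst v $ \<beta>))"

definition correction :: "('n::{finite,linorder}) amb \<Rightarrow> complex" where
  "correction u = - \<i> / 4 * hol_bilinear jet2 u u + twist u * snd u + - \<i> / 4 * hol_trilinear cubic u u u"

definition change :: "('n::{finite,linorder}) amb \<Rightarrow> ('n::{finite,linorder}) amb" where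
  "change u = (fst u + shift u u, snd u + correction u)"

lemma linear_horizontal: "linear (\<lambda>u :: ('n::{finite,linorder}) amb. (fst u, 0 :: real))"
  by (rule linearI) simp_all

lemma bilinear_jet2: "bilinear jet2"
  unfolding jet2_def[abs_def]
  by (rule bilinear_compose[OF linear_horizontal linear_horizontal bilinear_dd2[OF smooth zero_mem]])

lemma trilinear_jet3: "trilinear jet3"
  unfolding jet3_def[abs_def]
  by (rule trilinear_compose[OF linear_horizontal linear_horizontal linear_horizontal
      trilinear_dd3[OF smooth zero_mem]])

lemma linear_mixed_jet: "linear mixed_jet"
  unfolding mixed_jet_def[abs_def]
  using linear_compose[OF linear_horizontal bilinearD(1)[OF bilinear_dd2[OF smooth zero_mem]]] by (simp add: o_def)

lemma linear_twist: "linear twist"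
  by (rule linearI) (simp_all add: twist_def linear_add[OF linear_hol_linear[OF linear_mixed_jet]]
      linear_scale[OF linear_hol_linear[OF linear_mixed_jet]] algebra_simps)

lemma twist_Jc: "twist (Jc u) = \<i> * twist u"
  by (simp add: twist_def hol_linear_Jc[OF linear_mixed_jet])

lemma trilinear_cubic: "trilinear cubic"
  unfolding trilinear_def
  by (intro conjI allI linearI) (simp_all add: cubic_def trilinear_simps[OF trilinear_jet3]
      bilinear_simps[OF bilinear_jet2]
      linear_add[OF linear_twist] linear_scale[OF linear_twist] field_simps)

lemma cubic_symmetric: "cubic t u v = cubic u t v" "cubic t u v = cubic t v u"
proof -
  have jet2_swap: "jet2 u v = jet2 v u" for u v
    unfolding jet2_def by (rule dd_swap[OF smooth zero_mem])
  have jet3_swap: "jet3 t u v = jet3 u t v" "jet3 t u v = jet3 t v u" for t u v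
    unfolding jet3_def by (rule dd3_swap[OF smooth zero_mem])+
  show "cubic t u v = cubic u t v"
    by (simp add: cubic_def jet3_swap(1)[of t u v] jet2_swap[of t u])
  show "cubic t u v = cubic t v u"
    by (simp add: cubic_def jet3_swap(2)[of t u v] jet2_swap[of u v])
qed

lemma coeff_symmetric: "coeff \<alpha> \<beta> \<gamma> = coeff \<beta> \<alpha> \<gamma>"
  unfolding coeff_def by (subst levi_cubic_symmetric[OF cubic_symmetric(1)]) (rule refl)

lemma levi_cubic_cubic_eq_sum:
  "3 / 8 * levi_cubic cubic t u v =
    (\<Sum>\<alpha>\<in>UNIV. \<Sum>\<beta>\<in>UNIV. \<Sum>\<gamma>\<in>UNIV. coeff \<alpha> \<beta> \<gamma> * cnj (fst t $ \<alpha>) * cnj (fst u $ \<beta>) * fst v $ \<gamma>)"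
proof -
  have "levi_cubic cubic t u v = levi_cubic cubic (fst t, 0) (fst u, 0) (fst v, 0)"
    by (simp add: levi_cubic_def levi_form_eq cubic_def jet2_def jet3_def twist_def hol_linear_def
        mixed_jet_def Jc_def)
  then show ?thesis
    by (simp add: amb_axis_sum[of "fst _"] levi_cubic_sum_scaleC[OF trilinear_cubic] coeff_def
        sum_distrib_left mult.assoc)
qed

lemma bilinear_shift: "bilinear shift"
  unfolding bilinear_def
  by (intro conjI allI linearI)
    (simp_all add: shift_def vec_eq_iff algebra_simps sum.distrib scaleR_sum_right sum_distrib_left)

lemma shift_Jc: "shift (Jc u) v $ \<gamma> = \<i> * shift u v $ \<gamma>" "shift u (Jc v) $ \<gamma> = \<i> * shift u v $ \<gamma>"
  by (simp_all add: shift_def Jc_def sum_distrib_left mult_ac)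

lemma holo_on_change: "open U \<Longrightarrow> holo_on U change"
proof (rule holo_on_components)
  have coordinates: "linear (\<lambda>u :: ('n::{finite,linorder}) amb. fst u $ j)"
      "linear (\<lambda>u :: ('n::{finite,linorder}) amb. snd u)" for j
    by (rule linearI; simp)+
  have "bilinear (\<lambda>u v. shift u v $ \<gamma>)" for \<gamma>
    using bilinear_simps[OF bilinear_shift] unfolding bilinear_def by (intro conjI allI linearI) simp_all
  then show "holo_fun (\<lambda>u. fst (change u) $ \<gamma>)" for \<gamma>
    unfolding change_def fst_conv vector_add_component
    by (intro holo_fun_add holo_fun_linear coordinates holo_fun_quadratic[where B="\<lambda>u v. shift u v $ \<gamma>"] shift_Jc)
      (simp_all add: Jc_def)
  have const: "holo_fun (\<lambda>u. a)" for a
    by (simp add: holo_fun_def cinf_on_const dd_const)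
  have "holo_fun (\<lambda>u. hol_bilinear jet2 u u)"
    by (rule holo_fun_quadratic[where B="hol_bilinear jet2", OF bilinear_hol_bilinear[OF bilinear_jet2]
        hol_bilinear_Jc[OF bilinear_jet2]])
  moreover have "holo_fun (\<lambda>u. hol_trilinear cubic u u u)"
    by (rule holo_fun_cubic[where T="hol_trilinear cubic", OF trilinear_hol_trilinear[OF trilinear_cubic]
        hol_trilinear_Jc[OF trilinear_cubic]])
  moreover have "holo_fun twist" "holo_fun (\<lambda>u :: ('n::{finite,linorder}) amb. snd u)"
    by (rule holo_fun_linear[OF linear_twist twist_Jc]) (rule holo_fun_linear[OF coordinates(2)], simp add: Jc_def)
  ultimately show "holo_fun (\<lambda>u. snd (change u))"
    unfolding change_def snd_conv correction_def by (intro holo_fun_add holo_fun_mult const)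
qed

lemma dd_change_0: "dd [v] change 0 = v"
proof (rule has_vector_derivative_imp_dd)
  note forms = bilinear_simps[OF bilinear_hol_bilinear[OF bilinear_jet2]]
      trilinear_simps[OF trilinear_hol_trilinear[OF trilinear_cubic]]
    bilinear_simps[OF bilinear_shift] linear_scale[OF linear_twist]
  have "change (0 + t *\<^sub>R v) = t *\<^sub>R v + t\<^sup>2 *\<^sub>R (shift v v, - \<i> / 4 * hol_bilinear jet2 v v + twist v * snd v)
      + t ^ 3 *\<^sub>R (0, - \<i> / 4 * hol_trilinear cubic v v v)" for t
    by (simp add: change_def correction_def forms prod_eq_iff power2_eq_square power3_eq_cube
        scaleR_conv_of_real algebra_simps)
  then show "((\<lambda>t. change (0 + t *\<^sub>R v)) has_vector_derivative v) (at 0)"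
    by (auto intro!: derivative_eq_intros simp: zero_prod_def)
qed

lemma change_0: "change 0 = 0"
  by (simp add: change_def correction_def prod_eq_iff bilinear_lzero[OF bilinear_shift] linear_0[OF linear_twist]
      bilinear_lzero[OF bilinear_hol_bilinear[OF bilinear_jet2]]
      linear_0[OF trilinearD(1)[OF trilinear_hol_trilinear[OF trilinear_cubic]]])

subsection \<open>The equation in the new coordinates\<close>

lemma order_shift: "order_ge 1 Z \<Longrightarrow> order_ge 2 (\<lambda>t. shift (Z t) (Z t))"
  by (rule order_ge_bilinear[OF bilinear_shift, of 1 _ 1]) (assumption, assumption, simp)

lemma order_correction:
  assumes Z: "order_ge 1 Z"
  shows "order_ge 2 (\<lambda>t. correction (Z t))"
  unfolding correction_def
  by (intro order_ge_add order_ge_bounded_linear[OF bounded_linear_mult_right] Z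
      order_ge_bilinear[OF bilinear_hol_bilinear[OF bilinear_jet2] Z Z] order_ge_linear[OF linear_twist]
      order_ge_bounded_bilinear[OF bounded_bilinear_mult, of 1 _ 1] order_ge_bounded_linear[OF bounded_linear_snd]
      order_ge_trilinear[OF trilinear_hol_trilinear[OF trilinear_cubic] Z Z Z]) simp_all

context
  fixes Z :: "real \<Rightarrow> ('n::{finite,linorder}) amb"
  assumes Z: "order_ge 1 Z" and u: "order_ge 2 (\<lambda>t. Re (snd (Z t)))"
    and on_graph: "\<forall>\<^sub>F t in at_right 0. Im (snd (Z t)) = \<phi> (graph_base (Z t))"
begin

lemma graph_expansion:
  "order_ge 4 (\<lambda>t. Im (snd (Z t)) -
     (jet2 (Z t) (Z t) / 2 + Re (snd (Z t)) * mixed_jet (Z t) + jet3 (Z t) (Z t) (Z t) / 6))"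
proof (rule order_ge_cong)
  show "order_ge 4 (\<lambda>t. \<phi> (fst (Z t), Re (snd (Z t))) - weighted_jet \<phi> (fst (Z t)) (Re (snd (Z t))))"
    by (rule order_ge_weighted_jet[OF smooth zero_mem order_ge_bounded_linear[OF bounded_linear_fst Z] u])
  have vertical: "dd [(z, 0), (0, x)] \<phi> 0 = x * dd [(z, 0), (0, 1)] \<phi> 0" for z x
    using bilinear_rmul[OF bilinear_dd2[OF smooth zero_mem], of "(z, 0)" x "(0, 1)"] by simp
  show "\<forall>\<^sub>F t in at_right 0. \<phi> (fst (Z t), Re (snd (Z t))) - weighted_jet \<phi> (fst (Z t)) (Re (snd (Z t))) =
      Im (snd (Z t)) - (jet2 (Z t) (Z t) / 2 + Re (snd (Z t)) * mixed_jet (Z t) + jet3 (Z t) (Z t) (Z t) / 6)"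
    using on_graph by eventually_elim
      (simp add: weighted_jet_def \<phi>_0 d\<phi> vertical[of _ "Re _"] jet2_def jet3_def mixed_jet_def graph_base_def)
qed

lemma change_expansion:
  "order_ge 4 (\<lambda>t. Im (snd (change (Z t))) -
     (Re (model_form r s (Z t) (Z t)) + 3 / 4 * Re (levi_cubic cubic (Z t) (Z t) (Z t))))"
proof -
  let ?y = "\<lambda>t. Im (snd (Z t))" and ?jet = "\<lambda>t. jet2 (Z t) (Z t) / 2 + Re (snd (Z t)) * mixed_jet (Z t)
      + jet3 (Z t) (Z t) (Z t) / 6"
  have order_twist: "order_ge 1 (\<lambda>t. Re (twist (Z t)))"
    by (intro order_ge_bounded_linear[OF bounded_linear_Re] order_ge_linear[OF linear_twist] Z)
  have "order_ge 3 (\<lambda>t. ?y t - ?jet t + (Re (snd (Z t)) * mixed_jet (Z t) + jet3 (Z t) (Z t) (Z t) / 6))"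
    by (intro order_ge_add order_ge_mono[OF graph_expansion] order_ge_bounded_linear[OF bounded_linear_divide]
        order_ge_bounded_bilinear[OF bounded_bilinear_mult u order_ge_linear[OF linear_mixed_jet Z]]
        order_ge_trilinear[OF trilinear_jet3 Z Z Z]) simp_all
  then have quadratic: "order_ge 3 (\<lambda>t. ?y t - jet2 (Z t) (Z t) / 2)"
    by (rule order_ge_cong) (simp add: always_eventually)
  have "order_ge 4 (\<lambda>t. ?y t - ?jet t + Re (twist (Z t)) * (?y t - jet2 (Z t) (Z t) / 2))"
    by (intro order_ge_add graph_expansion order_ge_bounded_bilinear[OF bounded_bilinear_mult order_twist
        quadratic]) simp
  moreover have "?y t - ?jet t + Re (twist (Z t)) * (?y t - jet2 (Z t) (Z t) / 2) =
      Im (snd (change (Z t))) -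
        (Re (model_form r s (Z t) (Z t)) + 3 / 4 * Re (levi_cubic cubic (Z t) (Z t) (Z t)))" for t
  proof -
    have "jet2 (Z t) (Z t) / 2 = Re (hol_bilinear jet2 (Z t) (Z t)) / 4 + Re (model_form r s (Z t) (Z t))"
      using bilinear_form_decomposition[of jet2 "Z t"] levi_form_jet[of "Z t" "Z t"] by (simp add: jet2_def[abs_def])
    moreover have "cubic (Z t) (Z t) (Z t) = Re (hol_trilinear cubic (Z t) (Z t) (Z t)) / 4
        + 3 / 4 * Re (levi_cubic cubic (Z t) (Z t) (Z t))"
      by (rule trilinear_form_decomposition[OF cubic_symmetric])
    moreover have "Im (correction (Z t)) = - Re (hol_bilinear jet2 (Z t) (Z t)) / 4
        + (Re (twist (Z t)) * ?y t - mixed_jet (Z t) * Re (snd (Z t)))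
        - Re (hol_trilinear cubic (Z t) (Z t) (Z t)) / 4"
      by (simp add: correction_def) (simp add: twist_def hol_linear_def)
    ultimately show ?thesis
      by (simp add: change_def cubic_def field_simps)
  qed
  ultimately show ?thesis by simp
qed

end

lemma levi_cubic_cubic_split:
  "3 / 4 * Re (levi_cubic cubic u u u) = 2 * Re (model_form r s u (shift u u, 0))
      + 2 * Re (model_cubic r s coeff u u u)"
proof -
  define S where "S \<gamma> = (\<Sum>\<alpha>\<in>UNIV. \<Sum>\<beta>\<in>UNIV. coeff \<alpha> \<beta> \<gamma> * cnj (fst u $ \<alpha>) * cnj (fst u $ \<beta>) * fst u $ \<gamma>)" for \<gamma>
  have swap: "(\<Sum>\<alpha>\<in>UNIV. \<Sum>\<beta>\<in>UNIV. \<Sum>\<gamma>\<in>G. coeff \<alpha> \<beta> \<gamma> * cnj (fst u $ \<alpha>) * cnj (fst u $ \<beta>) * fst u $ \<gamma>) = sum S G" for G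
    by (simp add: S_def sum.swap[of _ G])
  have square: "eps r s \<gamma> * eps r s \<gamma> = (if r + s < pos \<gamma> then 0 else 1)" for \<gamma> :: 'n
    by (simp add: eps_def)
  have term_eq: "eps r s \<gamma> * cnj (fst u $ \<gamma>) * shift u u $ \<gamma> = (if r + s < pos \<gamma> then 0 else cnj (S \<gamma>))" for \<gamma>
  proof -
    have "cnj (S \<gamma>) = cnj (fst u $ \<gamma>) * (\<Sum>\<alpha>\<in>UNIV. \<Sum>\<beta>\<in>UNIV. cnj (coeff \<alpha> \<beta> \<gamma>) * fst u $ \<alpha> * fst u $ \<beta>)"
      by (simp add: S_def sum_distrib_left mult_ac)
    then have "eps r s \<gamma> * cnj (fst u $ \<gamma>) * shift u u $ \<gamma> = (eps r s \<gamma> * eps r s \<gamma>) * cnj (S \<gamma>)"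
      by (simp only: shift_def vec_lambda_beta mult_ac)
    then show ?thesis by (simp add: square)
  qed
  have gmat_mult: "gmat r s \<alpha> \<beta> * a * b = (if \<alpha> = \<beta> then eps r s \<beta> * a * b else 0)" for \<alpha> \<beta> :: 'n and a b
    by (simp add: gmat_def)
  have "model_form r s u (shift u u, 0) = (\<Sum>\<gamma>\<in>UNIV. if r + s < pos \<gamma> then 0 else cnj (S \<gamma>))"
    by (simp add: model_form_def gmat_mult term_eq)
  then have "model_form r s u (shift u u, 0) = cnj (sum S {\<gamma>. \<not> r + s < pos \<gamma>})"
    by (simp add: sum.If_cases Collect_neg_eq)
  moreover have "model_cubic r s coeff u u u = sum S {\<gamma>. r + s < pos \<gamma>}"
    unfolding model_cubic_def by (rule swap)
  moreover have "3 / 8 * levi_cubic cubic u u u = sum S {\<gamma>. \<not> r + s < pos \<gamma>} + sum S {\<gamma>. r + s < pos \<gamma>}"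
    unfolding levi_cubic_cubic_eq_sum swap
    by (subst sum.union_disjoint[symmetric]) (auto intro: sum.cong)
  ultimately have "Re (3 / 8 * levi_cubic cubic u u u) =
      Re (model_form r s u (shift u u, 0)) + Re (model_cubic r s coeff u u u)"
    by simp
  then show ?thesis by simp
qed

lemma model_form_change:
  fixes u :: "('n::{finite,linorder}) amb"
  defines "q \<equiv> (shift u u, 0)"
  shows "Re (model_form r s (change u) (change u)) =
    Re (model_form r s u u) + 2 * Re (model_form r s u q) + Re (model_form r s q q)"
proof -
  have "model_form r s (change u) (change u) = model_form r s (u + q) (u + q)"
    by (simp add: model_form_def change_def q_def)
  then show ?thesis
    using model_form_hermitian[of r s q u] by (simp add: bilinear_simps[OF bilinear_model_form])
qed

lemma model_cubic_change:
  fixes u :: "('n::{finite,linorder}) amb"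
  defines "q \<equiv> (shift u u, 0)"
  shows "model_cubic r s h (change u) (change u) (change u) = model_cubic r s h u u u
    + (model_cubic r s h q (u + q) (u + q) + model_cubic r s h u q (u + q) + model_cubic r s h u u q)"
proof -
  have "model_cubic r s h (change u) (change u) (change u) = model_cubic r s h (u + q) (u + q) (u + q)"
    by (simp add: model_cubic_def change_def q_def)
  then show ?thesis by (simp add: trilinear_simps[OF trilinear_model_cubic])
qed

lemma model_expansion:
  assumes Z: "order_ge 1 Z"
  shows "order_ge 4 (\<lambda>t. Re (model_form r s (change (Z t)) (change (Z t)))
      + 2 * Re (model_cubic r s coeff (change (Z t)) (change (Z t)) (change (Z t)))
      - (Re (model_form r s (Z t) (Z t)) + 3 / 4 * Re (levi_cubic cubic (Z t) (Z t) (Z t))))"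
proof -
  define q where "q t = (shift (Z t) (Z t), 0 :: complex)" for t
  have q: "order_ge 2 q"
    unfolding q_def[abs_def] by (intro order_ge_Pair order_shift Z order_ge_zero)
  have Zq: "order_ge 1 (\<lambda>t. Z t + q t)" by (intro order_ge_add Z order_ge_mono[OF q]) simp
  note cubic_order = order_ge_trilinear[OF trilinear_model_cubic]
  have "order_ge 4 (\<lambda>t. Re (model_form r s (q t) (q t)) + 2 * Re (model_cubic r s coeff (q t) (Z t + q t) (Z t + q t)
      + model_cubic r s coeff (Z t) (q t) (Z t + q t) + model_cubic r s coeff (Z t) (Z t) (q t)))"
    by (intro order_ge_add order_ge_bounded_linear[OF bounded_linear_Re]
        order_ge_bounded_linear[OF bounded_linear_mult_right] order_ge_bilinear[OF bilinear_model_form q q]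
        cubic_order[OF q Zq Zq] cubic_order[OF Z q Zq] cubic_order[OF Z Z q]) simp_all
  then show ?thesis
    unfolding model_form_change model_cubic_change levi_cubic_cubic_split q_def[symmetric]
    by (rule order_ge_cong) (simp add: always_eventually)
qed

lemma rho_model_expansion:
  assumes Z: "order_ge 1 Z" and "order_ge 2 (\<lambda>t. Re (snd (Z t)))"
    and "\<forall>\<^sub>F t in at_right 0. Im (snd (Z t)) = \<phi> (graph_base (Z t))"
  shows "order_ge 4 (\<lambda>t. - rho_model r s coeff (\<lambda>x. 0) (change (Z t)))"
  by (rule order_ge_cong[OF order_ge_diff[OF change_expansion[OF assms] model_expansion[OF Z]]])
    (simp add: rho_model_eq always_eventually)

lemma weighted_vanish4_remainder:
  fixes \<phi>' :: "(complex ^ ('n::{finite,linorder})) \<times> real \<Rightarrow> real"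
  assumes \<phi>': "cinf_on D' \<phi>'" and mem: "0 \<in> D'" and \<Gamma>: "cinf_on D' \<Gamma>" "\<Gamma> 0 = 0"
    and change_\<Gamma>: "\<And>x. x \<in> D' \<Longrightarrow> change (\<Gamma> x) = graph_point \<phi>' x" and graph_\<Gamma>: "\<And>x. x \<in> D' \<Longrightarrow> \<Gamma> x \<in> graph"
  shows "weighted_vanish4 (graph_remainder r s coeff \<phi>')"
proof (rule weighted_vanish4I[OF cinf_on_graph_remainder[OF \<phi>'] mem])
  fix z :: "complex ^ ('n::{finite,linorder})" and u :: real
  define x where "x t = (t *\<^sub>R z, t\<^sup>2 *\<^sub>R u)" for t
  define Z where "Z t = \<Gamma> (x t)" for t
  have "order_ge 1 (\<lambda>t. t ^ 1 *\<^sub>R z)" "order_ge 1 (\<lambda>t. t\<^sup>2 *\<^sub>R u)" by (rule order_ge_power; simp)+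
  then have order_x: "order_ge (Suc 0) x" unfolding x_def[abs_def] using order_ge_Pair by fastforce
  have order_Z: "order_ge 1 Z"
    unfolding Z_def[abs_def] One_nat_def
    by (rule order_ge_differentiable[OF cinf_on_has_derivative[OF \<Gamma>(1) mem] \<Gamma>(2) order_x])
  have curve: "\<forall>\<^sub>F t in at_right 0. x t \<in> D'"
    by (rule order_ge_eventually_mem[OF order_x cinf_on_open[OF \<phi>'] mem])
  have order_u: "order_ge 2 (\<lambda>t. Re (snd (Z t)))"
  proof (rule order_ge_cong)
    show "order_ge 2 (\<lambda>t. t\<^sup>2 *\<^sub>R u - Re (correction (Z t)))"
      by (intro order_ge_diff order_ge_power order_ge_bounded_linear[OF bounded_linear_Re] order_correction
          order_Z) simp
    show "\<forall>\<^sub>F t in at_right 0. t\<^sup>2 *\<^sub>R u - Re (correction (Z t)) = Re (snd (Z t))"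
      using curve
    proof eventually_elim
      case (elim t)
      have "snd (change (Z t)) = Complex (t\<^sup>2 * u) (\<phi>' (x t))"
        using change_\<Gamma>[OF elim] by (simp add: Z_def graph_point_def x_def)
      then show ?case by (simp add: change_def complex_eq_iff)
    qed
  qed
  have on_graph: "\<forall>\<^sub>F t in at_right 0. Im (snd (Z t)) = \<phi> (graph_base (Z t))"
    using curve by eventually_elim (use graph_\<Gamma> in \<open>simp add: Z_def graph_def\<close>)
  have "\<forall>\<^sub>F t in at_right 0. - rho_model r s coeff (\<lambda>x. 0) (change (Z t)) = graph_remainder r s coeff \<phi>' (x t)"
    using curve by eventually_elim (simp add: graph_remainder_def Z_def change_\<Gamma>)
  with rho_model_expansion[OF order_Z order_u on_graph]
  have "order_ge 4 (\<lambda>t. graph_remainder r s coeff \<phi>' (x t))" by (rule order_ge_cong)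
  then show "order_ge 4 (\<lambda>t. graph_remainder r s coeff \<phi>' (t *\<^sub>R z, t\<^sup>2 *\<^sub>R u))" by (simp add: x_def)
qed

definition defining_function :: "('n::{finite,linorder}) amb \<Rightarrow> real" where
  "defining_function Z = \<phi> (graph_base Z) - Im (snd Z)"

lemma graph_eq: "graph = {Z \<in> graph_base -` D. defining_function Z = 0}"
  by (auto simp: graph_def defining_function_def)

lemma cinf_on_defining_function: "cinf_on (graph_base -` D) defining_function"
  and dd_defining_function: "dd [v] defining_function 0 = - Im (snd v)"
proof -
  have W: "open (graph_base -` D :: ('n::{finite,linorder}) amb set)"
      "0 \<in> (graph_base -` D :: ('n::{finite,linorder}) amb set)"
    using open_vimage_graph_base[OF cinf_on_open[OF smooth]] zero_mem by simp_all
  have base: "cinf_on (graph_base -` D) (\<lambda>Z :: ('n::{finite,linorder}) amb. \<phi> (graph_base Z))"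
    by (rule cinf_on_compose[OF smooth cinf_on_linear[OF W(1) linear_graph_base]]) simp
  have height: "linear (\<lambda>Z :: ('n::{finite,linorder}) amb. - Im (snd Z))" by (rule linearI) simp_all
  have sum: "defining_function = (\<lambda>Z. \<phi> (graph_base Z) + - Im (snd Z))"
    by (simp add: defining_function_def[abs_def])
  show "cinf_on (graph_base -` D) defining_function"
    unfolding sum by (rule cinf_on_add[OF base cinf_on_linear[OF W(1) height]])
  show "dd [v] defining_function 0 = - Im (snd v)"
    unfolding sum dd_add[OF base cinf_on_linear[OF W(1) height] W(2)]
    using dd_compose_linear[OF linear_graph_base, of "[v]" \<phi> 0] by (simp add: d\<phi> dd_linear_form[OF height])
qed

lemma change_chart:
  obtains U \<Psi> where "0 \<in> U" "U \<subseteq> graph_base -` D" "hol_coords U change" "cinf_on (change ` U) \<Psi>"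
    "\<And>x. x \<in> U \<Longrightarrow> \<Psi> (change x) = x" "\<And>v. dd [v] \<Psi> 0 = v"
proof -
  have W: "open (graph_base -` D :: ('n::{finite,linorder}) amb set)"
      "0 \<in> (graph_base -` D :: ('n::{finite,linorder}) amb set)"
    using open_vimage_graph_base[OF cinf_on_open[OF smooth]] zero_mem by simp_all
  have "bij (\<lambda>v. dd [v] change 0)" unfolding dd_change_0 by (rule bij_id[unfolded id_def])
  then obtain U where U: "0 \<in> U" "U \<subseteq> graph_base -` D" and coords: "hol_coords U change"
    by (rule hol_coords_local[OF holo_on_change[OF W(1)] W(2)])
  then obtain \<Psi> where hol: "holo_on U change" "holo_on (change ` U) \<Psi>" and \<Psi>: "\<And>x. x \<in> U \<Longrightarrow> \<Psi> (change x) = x"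
    by (auto simp: hol_coords_def)
  note smooth_change = cinf_on_holo[OF hol(1)] and smooth_\<Psi> = cinf_on_holo[OF hol(2)]
  have "dd [v] \<Psi> 0 = v" for v
    using dd_compose[OF smooth_\<Psi> smooth_change imageI U(1), of v]
      dd_cong[OF cinf_on_open[OF smooth_change] \<Psi> U(1), where vs="[v]"] by (simp add: dd_change_0 change_0 dd_ident)
  with U coords smooth_\<Psi> \<Psi> show ?thesis by (rule that)
qed

lemma normal_form_graph:
  obtains U R U' where "normal_form graph 0 r s coeff U change R U'"
proof -
  obtain U \<Psi> where U: "0 \<in> U" "U \<subseteq> graph_base -` D" and coords: "hol_coords U change"
    and \<Psi>: "cinf_on (change ` U) \<Psi>" "\<And>x. x \<in> U \<Longrightarrow> \<Psi> (change x) = x" "\<And>v. dd [v] \<Psi> 0 = v"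
    by (rule change_chart) blast
  define f where "f y = defining_function (\<Psi> y)" for y
  have V: "0 \<in> change ` U" using U(1) change_0 by force
  have \<Psi>_0: "\<Psi> 0 = 0" using \<Psi>(2)[OF U(1)] change_0 by simp
  have inverse: "\<Psi> y \<in> U" "\<Psi> y \<in> graph_base -` D" "change (\<Psi> y) = y" if "y \<in> change ` U" for y
    using that \<Psi>(2) U(2) by auto
  have f: "cinf_on (change ` U) f"
    unfolding f_def[abs_def] by (rule cinf_on_compose[OF cinf_on_defining_function \<Psi>(1) inverse(2)])
  have "dd [v] f 0 = - Im (snd v)" for v
    unfolding f_def[abs_def] using dd_compose[OF cinf_on_defining_function \<Psi>(1) inverse(2) V]
    by (simp add: \<Psi>_0 \<Psi>(3) dd_defining_function)
  then have vertical: "dd [(0, \<i>)] f 0 \<noteq> 0" by simp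
  have f_0: "f 0 = 0" by (simp add: f_def \<Psi>_0 defining_function_def \<phi>_0)
  obtain V' D' \<phi>' where V': "open V'" "0 \<in> V'" "V' \<subseteq> change ` U" and \<phi>': "cinf_on D' \<phi>'" "0 \<in> D'" "\<phi>' 0 = 0"
    and sub: "\<And>x. x \<in> D' \<Longrightarrow> graph_point \<phi>' x \<in> change ` U" and zero: "\<And>x. x \<in> D' \<Longrightarrow> f (graph_point \<phi>' x) = 0"
    and iff: "\<And>Z. Z \<in> V' \<Longrightarrow> f Z = 0 \<longleftrightarrow> Im (snd Z) = \<phi>' (graph_base Z)"
    by (rule implicit_graph[OF f V f_0 vertical]) blast
  have remainder: "weighted_vanish4 (graph_remainder r s coeff \<phi>')"
  proof (rule weighted_vanish4_remainder[OF \<phi>'(1,2)])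
    show "cinf_on D' (\<lambda>x. \<Psi> (graph_point \<phi>' x))"
      by (rule cinf_on_compose[OF \<Psi>(1) dd_graph_point(1)[OF \<phi>'(1)] sub])
    show "\<Psi> (graph_point \<phi>' 0) = 0" using \<Psi>_0 \<phi>'(3)
      by (simp add: graph_point_def zero_prod_def flip: zero_complex.code)
    show "change (\<Psi> (graph_point \<phi>' x)) = graph_point \<phi>' x" "\<Psi> (graph_point \<phi>' x) \<in> graph" if "x \<in> D'" for x
      using inverse[OF sub[OF that]] zero[OF that] by (simp_all add: graph_eq f_def)
  qed
  have "x \<in> graph \<longleftrightarrow> Im (snd (change x)) = \<phi>' (graph_base (change x))" if "x \<in> U" "change x \<in> V'" for x
    using iff[OF that(2)] \<Psi>(2) U(2) that(1) by (auto simp: graph_eq f_def)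
  from normal_form_if_graph[OF coords U(1) change_0 V'(1,2) remainder this] show ?thesis by (rule that)
qed

end

subsection \<open>Affine changes of coordinates\<close>

lemma holo_on_compose:
  assumes F: "holo_on V F" and G: "holo_on U G" and sub: "\<And>x. x \<in> U \<Longrightarrow> G x \<in> V"
  shows "holo_on U (\<lambda>x. F (G x))"
  unfolding holo_on_def
proof (intro conjI ballI)
  show "open U" using G by (simp add: holo_on_def)
  fix x assume x: "x \<in> U"
  obtain G' where G': "(G has_derivative G') (at x)" "\<forall>v. G' (Jc v) = Jc (G' v)"
    using G x unfolding holo_on_def by blast
  obtain F' where F': "(F has_derivative F') (at (G x))" "\<forall>v. F' (Jc v) = Jc (F' v)"
    using F sub[OF x] unfolding holo_on_def by blast
  have "\<forall>v. F' (G' (Jc v)) = Jc (F' (G' v))" using F'(2) G'(2) by (simp del: split_paired_All)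
  with has_derivative_compose[OF G'(1) F'(1)]
  show "\<exists>D. ((\<lambda>x. F (G x)) has_derivative D) (at x) \<and> (\<forall>v. D (Jc v) = Jc (D v))" by blast
qed

lemma hol_coords_compose:
  assumes G: "hol_coords U G" and F: "hol_coords (G ` U) F"
  shows "hol_coords U (\<lambda>x. F (G x))"
proof -
  obtain G' F' where inverse: "holo_on (G ` U) G'" "\<forall>x\<in>U. G' (G x) = x" "holo_on (F ` G ` U) F'"
      "\<forall>y\<in>G ` U. F' (F y) = y"
    using G F unfolding hol_coords_def by blast
  have "holo_on U (\<lambda>x. F (G x))"
    by (rule holo_on_compose[of "G ` U"]) (use F G in \<open>auto simp: hol_coords_def\<close>)
  moreover have "holo_on (F ` G ` U) (\<lambda>y. G' (F' y))"
    by (rule holo_on_compose[OF inverse(1,3)]) (use inverse(4) in auto)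
  moreover have "inj_on (\<lambda>x. F (G x)) U" "open (F ` G ` U)"
    using F G unfolding hol_coords_def by (auto simp: inj_on_def)
  ultimately show ?thesis
    unfolding hol_coords_def using inverse(2,4) by (auto simp: image_image intro!: exI[of _ "\<lambda>y. G' (F' y)"])
qed

lemma holo_on_affine:
  fixes S :: "'n::finite amb \<Rightarrow> 'n amb"
  assumes S: "linear S" "\<And>v. S (Jc v) = Jc (S v)" and U: "open U"
  shows "holo_on U (\<lambda>x. a + S (x - b))"
  unfolding holo_on_def
proof (intro conjI ballI U)
  have "bounded_linear S" using S(1) by (simp add: linear_conv_bounded_linear)
  from bounded_linear.has_derivative[OF this] have "((\<lambda>x. a + S (x - b)) has_derivative (\<lambda>v. 0 + S (v - 0)))
      (at x)" for x
    by (rule has_derivative_add[OF has_derivative_const])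
        (rule has_derivative_diff[OF has_derivative_ident has_derivative_const])
  then have "((\<lambda>x. a + S (x - b)) has_derivative S) (at x)" for x by simp
  then show "\<exists>D. ((\<lambda>x. a + S (x - b)) has_derivative D) (at x) \<and> (\<forall>v. D (Jc v) = Jc (D v))" for x
    using S(2) by blast
qed

locale complex_linear_iso =
  fixes S T :: "'n::finite amb \<Rightarrow> 'n amb"
  assumes linear: "linear S" "linear T" and inverse: "T (S Z) = Z" "S (T Z) = Z" and Jc: "S (Jc Z) = Jc (S Z)"
begin

lemma Jc_inverse: "T (Jc v) = Jc (T v)"
  using Jc[of "T v"] inverse by metis

lemma affine_image: "(\<lambda>x. T (x - p)) ` {x. T (x - p) \<in> U} = U"
proof (intro equalityI subsetI)
  show "Z \<in> (\<lambda>x. T (x - p)) ` {x. T (x - p) \<in> U}" if "Z \<in> U" for Z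
    using that by (intro image_eqI[of _ _ "p + S Z"]) (simp_all add: inverse)
qed auto

lemma hol_coords_affine:
  assumes "open U"
  shows "hol_coords {x. T (x - p) \<in> U} (\<lambda>x. T (x - p))"
proof -
  have "bounded_linear T" using linear(2) by (simp add: linear_conv_bounded_linear)
  then have "continuous_on UNIV (\<lambda>x. T (x - p))"
    by (rule bounded_linear.continuous_on) (intro continuous_intros)
  from open_vimage[OF assms this] have "open {x. T (x - p) \<in> U}" by (simp add: vimage_def)
  from holo_on_affine[OF linear(2) Jc_inverse this, of 0 p]
  have "holo_on {x. T (x - p) \<in> U} (\<lambda>x. T (x - p))" by simp
  moreover have "holo_on U (\<lambda>y. p + S y)"
    using holo_on_affine[OF linear(1) Jc assms, of p 0] by simp
  moreover have "p + S (T (x - p)) = x" for x by (simp add: inverse)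
  ultimately show ?thesis
    unfolding hol_coords_def affine_image using assms by (auto intro!: inj_on_inverseI[of _ "\<lambda>y. p + S y"]
        exI[of _ "\<lambda>y. p + S y"])
qed

lemma dd_affine: "dd vs (\<lambda>x. f (T (x - p))) p = dd (map T vs) f 0"
  using dd_translate[of vs "\<lambda>x. f (T x)" "- p" p] dd_compose_linear[OF linear(2), of vs f 0]
  by (simp add: linear_0[OF linear(2)])

lemma dd_affine_inverse: "dd vs (\<lambda>Z. f (p + S Z)) 0 = dd (map S vs) f p"
  using dd_compose_linear[OF linear(1), of vs "\<lambda>y. f (p + y)" 0] by (simp add: dd_translate linear_0[OF linear(1)])

lemma
  fixes \<rho> :: "'n amb \<Rightarrow> real"
  assumes \<rho>: "cinf_on U \<rho>" and p: "p \<in> U"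
  shows affine_vimage_mem: "0 \<in> {Z. p + S Z \<in> U}"
    and cinf_on_affine_pullback: "cinf_on {Z. p + S Z \<in> U} (\<lambda>Z. k * \<rho> (p + S Z))"
    and dd_affine_pullback: "dd vs (\<lambda>Z. k * \<rho> (p + S Z)) 0 = k * dd (map S vs) \<rho> p"
proof -
  have "continuous_on UNIV (\<lambda>Z. p + S Z)"
    by (intro continuous_on_add continuous_on_const linear_continuous_on linear(1)[unfolded linear_conv_bounded_linear])
  from open_vimage[OF cinf_on_open[OF \<rho>] this] have vimage: "open {Z. p + S Z \<in> U}" by (simp add: vimage_def)
  show mem: "0 \<in> {Z. p + S Z \<in> U}" using p by (simp add: linear_0[OF linear(1)])
  have pullback: "cinf_on {Z. p + S Z \<in> U} (\<lambda>Z. \<rho> (p + S Z))"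
    by (rule cinf_on_compose[OF \<rho> cinf_on_add[OF cinf_on_const[OF vimage] cinf_on_linear[OF vimage linear(1)]]]) simp
  then show "cinf_on {Z. p + S Z \<in> U} (\<lambda>Z. k * \<rho> (p + S Z))"
    by (rule cinf_on_bounded_linear_apply[OF _ bounded_linear_mult_right])
  show "dd vs (\<lambda>Z. k * \<rho> (p + S Z)) 0 = k * dd (map S vs) \<rho> p"
    unfolding dd_bounded_linear_apply[OF pullback bounded_linear_mult_right mem] dd_affine_inverse ..
qed

end

lemma complex_linear_iso_exists:
  fixes S :: "'n::finite amb \<Rightarrow> 'n amb"
  assumes "linear S" "inj S" "\<And>Z. S (Jc Z) = Jc (S Z)"
  obtains T where "complex_linear_iso S T"
proof -
  obtain T where T: "linear T" "\<And>x. T (S x) = x" "\<And>x. S (T x) = x"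
    using linear_injective_isomorphism[OF assms(1,2)] by blast
  have "complex_linear_iso S T" by (rule complex_linear_iso.intro) (rule assms(1,3) T)+
  then show ?thesis by (rule that)
qed

lemma (in normal_form) normal_form_affine:
  assumes "p = 0" and iso: "complex_linear_iso S T" and W: "open W" "0 \<in> W"
    and iff: "\<And>Z. Z \<in> W \<Longrightarrow> Z \<in> M \<longleftrightarrow> q + S Z \<in> N"
  shows "normal_form N q r s h {x. T (x - q) \<in> U} (\<lambda>x. \<Phi> (T (x - q))) R {x. T (x - q) \<in> U' \<inter> W}"
proof -
  interpret complex_linear_iso S T by (rule iso)
  have T_0: "T 0 = 0" by (rule linear_0[OF linear(2)])
  have U: "open U" using holo by (simp add: holo_on_def)
  show ?thesis
  proof
    show "hol_coords {x. T (x - q) \<in> U} (\<lambda>x. \<Phi> (T (x - q)))"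
      by (rule hol_coords_compose[OF hol_coords_affine[OF U]]) (simp add: affine_image coords)
    show "open {x. T (x - q) \<in> U' \<inter> W}"
      using hol_coords_affine[of "U' \<inter> W" q] nbhd(1) W(1) by (auto simp: hol_coords_def holo_on_def)
    show "N \<inter> {x. T (x - q) \<in> U' \<inter> W} = {x \<in> {x. T (x - q) \<in> U' \<inter> W}. rho_model r s h R (\<Phi> (T (x - q))) = 0}"
    proof (intro set_eqI)
      fix x
      show "x \<in> N \<inter> {x. T (x - q) \<in> U' \<inter> W} \<longleftrightarrow>
          x \<in> {x \<in> {x. T (x - q) \<in> U' \<inter> W}. rho_model r s h R (\<Phi> (T (x - q))) = 0}"
        using iff[of "T (x - q)"] equation by (auto simp: inverse)
    qed
  qed (use T_0 center remainder nbhd W(2) \<open>p = 0\<close> in auto)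
qed

subsection \<open>Coordinates adapted to a frame\<close>

context hypersurface_form
begin

lemma transversal_exists:
  assumes "x \<in> M \<inter> U"
  obtains n where "hol_linear (\<lambda>v. dd [v] \<rho> x) n = \<i> / lam x"
proof
  have x: "x \<in> U" using assms by blast
  show "hol_linear (\<lambda>v. dd [v] \<rho> x) ((1 / (lam x * (grad \<rho> x \<bullet> grad \<rho> x))) *\<^sub>R Jc (grad \<rho> x)) = \<i> / lam x"
    using grad_nonzero[OF x]
    by (simp add: hol_linear_def inner_Jc_self Jc_simps complex_eq_iff flip: grad_inner[OF smooth x])
qed

end

locale framed_hypersurface = hypersurface_form M U \<rho> c
  for M :: "('n::{finite,linorder}) amb set" and U \<rho> c +
  fixes p :: "('n::{finite,linorder}) amb" and Lb :: "'n \<Rightarrow> ('n::{finite,linorder}) amb cvf" and r s :: nat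
  assumes basis: "CR_basis M U Lb" and p: "p \<in> M \<inter> U"
    and levi_tensor: "Top (Lb \<alpha>) (thform c) (cnjv (Lb \<beta>)) p = gmat r s \<alpha> \<beta>"
begin

lemma pU: "p \<in> U"
  using p by blast

lemma CR: "CR_field M U (Lb \<alpha>)"
  using basis by (simp add: CR_basis_def)

definition frame_vector :: "'n \<Rightarrow> ('n::{finite,linorder}) amb" where
  "frame_vector \<alpha> = (2 * \<i>) *\<^sub>C fst (Lb \<alpha>) p"

lemma hol_linear_frame_vector: "hol_linear (\<lambda>v. dd [v] \<rho> p) (frame_vector \<alpha>) = 0"
proof -
  have "hol_linear (\<lambda>v. dd [v] \<rho> p) (fst (Lb \<alpha>) p) = 0"
    using CR_fieldD(1,2)[OF CR, THEN tangent_fieldD(2), OF p]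
    by (simp add: hol_linear_def tangent_iff[OF p] complex_eq_iff)
  then show ?thesis
    by (simp add: frame_vector_def complex_linear_functional_scaleC[OF linear_hol_linear[OF linear_dd[OF smooth pU]]
        hol_linear_Jc[OF linear_dd[OF smooth pU]]])
qed

lemma frame_vector_independent:
  assumes "(\<Sum>\<alpha>\<in>UNIV. d \<alpha> *\<^sub>C frame_vector \<alpha>) = 0"
  shows "\<forall>\<alpha>. d \<alpha> = 0"
  using CR_basis_independent[OF basis p, of "\<lambda>\<alpha>. d \<alpha> * (2 * \<i>)"] assms by (simp add: frame_vector_def scaleC_simps)

lemma levi_form_frame_map:
  assumes "snd u = 0" "snd v = 0"
  shows "of_real (lam p) * levi_form (hessian p) (frame_map frame_vector n u) (frame_map frame_vector n v) =
      4 * model_form r s u v"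
proof -
  have horizontal: "frame_map frame_vector n u = (\<Sum>\<alpha>\<in>UNIV. (fst u $ \<alpha> * (2 * \<i>)) *\<^sub>C fst (Lb \<alpha>) p)"
      if "snd u = 0" for u
    using that by (simp add: frame_map_def frame_vector_def scaleC_simps)
  have "of_real (lam p) * levi_form (hessian p) (frame_map frame_vector n u) (frame_map frame_vector n v) =
      (\<Sum>\<alpha>\<in>UNIV. \<Sum>\<beta>\<in>UNIV. 4 * (of_real (lam p) * levi_form (hessian p) (fst (Lb \<alpha>) p) (fst (Lb \<beta>) p)
        * cnj (fst u $ \<alpha>) * fst v $ \<beta>))"
    unfolding horizontal[OF assms(1)] horizontal[OF assms(2)] levi_form_sum_scaleC[OF bilinear_hessian[OF pU]]
    by (simp add: sum_distrib_left mult_ac)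
  also have "\<dots> = 4 * model_form r s u v"
    using levi_tensor Top_cnjv[OF CR CR p] by (simp add: model_form_def sum_distrib_left)
  finally show ?thesis .
qed

lemma frame_coordinates_exist:
  obtains S T where "complex_linear_iso S T" "\<And>Z. lam p * dd [S Z] \<rho> p = - Im (snd Z)"
    "\<And>u v. snd u = 0 \<Longrightarrow> snd v = 0 \<Longrightarrow> levi_form (\<lambda>u v. lam p * dd [S u, S v] \<rho> p) u v = 4 * model_form r s u v"
    "\<And>\<alpha>. T (fst (Lb \<alpha>) p) = (axis \<alpha> (- \<i> / 2), 0)"
proof -
  define \<eta> where "\<eta> = hol_linear (\<lambda>v. dd [v] \<rho> p)"
  have \<eta>: "linear \<eta>" "\<eta> (Jc v) = \<i> * \<eta> v" for v
    unfolding \<eta>_def by (rule linear_hol_linear[OF linear_dd[OF smooth pU]],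
        rule hol_linear_Jc[OF linear_dd[OF smooth pU]])
  have \<eta>_frame: "\<eta> (frame_vector \<alpha>) = 0" for \<alpha> unfolding \<eta>_def by (rule hol_linear_frame_vector)
  obtain n where n: "\<eta> n = \<i> / lam p" unfolding \<eta>_def by (rule transversal_exists[OF p])
  define S where "S = frame_map frame_vector n"
  have "inj S"
    unfolding S_def using lam_nonzero[OF p] frame_vector_independent
    by (intro inj_frame_map[OF \<eta> \<eta>_frame]) (simp_all add: n)
  then obtain T where iso: "complex_linear_iso S T"
    unfolding S_def by (rule complex_linear_iso_exists[OF linear_frame_map _ frame_map_Jc])
  then interpret iso: complex_linear_iso S T .
  show ?thesis
  proof (rule that[OF iso])
    have "\<eta> (S Z) = snd Z * (\<i> / lam p)" for Z
      unfolding S_def n[symmetric] by (rule frame_map_functional[OF \<eta> \<eta>_frame])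
    then have "Re (\<eta> (S Z)) = - Im (snd Z) / lam p" for Z by simp
    then show "lam p * dd [S Z] \<rho> p = - Im (snd Z)" for Z
      using lam_nonzero[OF p] by (simp add: \<eta>_def hol_linear_def)
    show "levi_form (\<lambda>u v. lam p * dd [S u, S v] \<rho> p) u v = 4 * model_form r s u v" if "snd u = 0" "snd v = 0" for u v
    proof -
      have "levi_form (\<lambda>u v. lam p * dd [S u, S v] \<rho> p) u v = of_real (lam p) * levi_form (hessian p) (S u) (S v)"
        by (simp add: levi_form_eq iso.Jc complex_eq_iff algebra_simps)
      then show ?thesis using levi_form_frame_map[OF that, of n] by (simp add: S_def)
    qed
    have "S (axis \<alpha> (- \<i> / 2), 0) = fst (Lb \<alpha>) p" for \<alpha>
      by (simp add: S_def frame_map_def frame_vector_def axis_def if_distrib[of "\<lambda>a. a *\<^sub>C _"]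
          if_distrib[of "\<lambda>a. a * _"]
          scaleC_simps cong: if_cong)
    then show "T (fst (Lb \<alpha>) p) = (axis \<alpha> (- \<i> / 2), 0)" for \<alpha>
      using iso.inverse(1) by metis
  qed
qed

lemma normal_form_exists:
  obtains k V \<Phi> R V' where "normal_form_frame M p r s k V \<Phi> R V' U Lb c" "\<And>\<alpha> \<beta> \<gamma>. k \<alpha> \<beta> \<gamma> = k \<beta> \<alpha> \<gamma>"
proof -
  obtain S T where iso: "complex_linear_iso S T" and d\<rho>: "\<And>Z. lam p * dd [S Z] \<rho> p = - Im (snd Z)"
    and levi: "\<And>u v. snd u = 0 \<Longrightarrow> snd v = 0 \<Longrightarrow> levi_form (\<lambda>u v. lam p * dd [S u, S v] \<rho> p) u v = 4 * model_form r s u v"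
    and T_frame: "\<And>\<alpha>. T (fst (Lb \<alpha>) p) = (axis \<alpha> (- \<i> / 2), 0)"
    by (rule frame_coordinates_exist) blast
  interpret iso: complex_linear_iso S T by (rule iso)
  define f where "f Z = lam p * \<rho> (p + S Z)" for Z
  note f = iso.cinf_on_affine_pullback[OF smooth pU, of "lam p", folded f_def]
    and df = iso.dd_affine_pullback[OF smooth pU, of _ "lam p", folded f_def]
    and mem = iso.affine_vimage_mem[OF smooth pU]
  have "f 0 = 0" using p mem_iff[OF pU] by (simp add: f_def linear_0[OF iso.linear(1)])
  then obtain \<phi> D W where levi_graph: "levi_graph \<phi> D r s" and W: "open W" "0 \<in> W" "W \<subseteq> {Z. p + S Z \<in> U}"
    and on_graph: "\<And>Z. Z \<in> W \<Longrightarrow> f Z = 0 \<longleftrightarrow> Z \<in> levi_graph.graph \<phi> D"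
    by (rule levi_graph_exists[OF f mem, where r=r and s=s]) (simp_all add: df d\<rho> levi)
  interpret graph: levi_graph \<phi> D r s by (rule levi_graph)
  obtain V R V' where "normal_form graph.graph 0 r s graph.coeff V graph.change R V'"
    by (rule graph.normal_form_graph)
  moreover have "Z \<in> graph.graph \<longleftrightarrow> p + S Z \<in> M" if "Z \<in> W" for Z
    using on_graph[OF that] mem_iff[of "p + S Z"] lam_nonzero[OF p] W(3) that by (auto simp: f_def)
  ultimately have "normal_form M p r s graph.coeff {x. T (x - p) \<in> V} (\<lambda>x. graph.change (T (x - p))) R
      {x. T (x - p) \<in> V' \<inter> W}"
    by (rule normal_form.normal_form_affine[OF _ refl iso W(1,2)])
  moreover have d\<Phi>: "dd [v] (\<lambda>x. graph.change (T (x - p))) p = T v" for v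
    by (simp add: iso.dd_affine graph.dd_change_0)
  have "c p \<bullet> v = - Re (snd (dd [v] (\<lambda>x. graph.change (T (x - p))) p))" if "tangent_vec M p v" for v
    using char_tangent[OF p that] d\<rho>[of "Jc (T v)"] by (simp add: iso.Jc iso.inverse d\<Phi> Jc_simps)
  ultimately have "normal_form_frame M p r s graph.coeff {x. T (x - p) \<in> V} (\<lambda>x. graph.change (T (x - p))) R
      {x. T (x - p) \<in> V' \<inter> W} U Lb c"
    by (intro normal_form_frame.intro normal_form_frame_axioms.intro open_U pU CR char) (simp_all add: d\<Phi> T_frame)
  then show ?thesis using graph.coeff_symmetric by (rule that)
qed

end

lemma CR_basis_subset: "CR_basis M U Lb \<Longrightarrow> open V \<Longrightarrow> V \<subseteq> U \<Longrightarrow> CR_basis M V Lb"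
  unfolding CR_basis_def using CR_field_subset by blast

lemma normal_form_if_normalized_frame:
  assumes hyp: "real_hypersurface M" and pM: "p \<in> M" and frame: "normalized_frame M p r s h U Lb c"
  obtains V \<Phi> R V' where "normal_form M p r s h V \<Phi> R V'"
proof -
  obtain U\<^sub>0 and \<rho> :: "('a::{finite,linorder}) amb \<Rightarrow> real" where U\<^sub>0: "p \<in> U\<^sub>0" "hypersurface_nbhd M U\<^sub>0 \<rho>"
    using hyp[unfolded real_hypersurface_def, THEN bspec, OF pM] unfolding hypersurface_nbhd_def by blast
  have U: "open U" "p \<in> U" "CR_basis M U Lb" "char_form M U c"
    and levi_tensor: "Top (Lb \<alpha>) (thform c) (cnjv (Lb \<beta>)) p = gmat r s \<alpha> \<beta>"
    and cubic_tensor: "r + s < pos \<gamma> \<Longrightarrow> Top (Lb \<alpha>) (Top (Lb \<beta>) (thform c)) (cnjv (Lb \<gamma>)) p = h \<alpha> \<beta> \<gamma>" for \<alpha> \<beta> \<gamma>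
    using frame unfolding normalized_frame_def by blast+
  define W where "W = U \<inter> U\<^sub>0"
  have W: "open W" "W \<subseteq> U" "W \<subseteq> U\<^sub>0" using U(1) hypersurface_nbhd.open_U[OF U\<^sub>0(2)] by (auto simp: W_def)
  interpret framed_hypersurface M W \<rho> c p Lb r s
    by (intro framed_hypersurface.intro hypersurface_form.intro hypersurface_form_axioms.intro
        framed_hypersurface_axioms.intro
        hypersurface_nbhd_subset[OF U\<^sub>0(2) W(1,3)] char_form_subset[OF U(4) W(1,2)]
            CR_basis_subset[OF U(3) W(1,2)] levi_tensor)
      (use pM U(2) U\<^sub>0(1) in \<open>simp add: W_def\<close>)
  obtain k V \<Phi> R V' where "normal_form_frame M p r s k V \<Phi> R V' W Lb c" and symmetric: "\<And>\<alpha> \<beta> \<gamma>. k \<alpha> \<beta> \<gamma> = k \<beta> \<alpha> \<gamma>"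
    by (rule normal_form_exists) blast
  then interpret normal_form_frame M p r s k V \<Phi> R V' W Lb c by blast
  have "k \<alpha> \<beta> \<gamma> = h \<alpha> \<beta> \<gamma>" if "r + s < pos \<gamma>" for \<alpha> \<beta> \<gamma>
    using Top_Top_frame[OF _ that] symmetric cubic_tensor[OF that] by simp
  then have "rho_model r s k R Z = rho_model r s h R Z" for Z by (rule rho_model_cong)
  then have "normal_form M p r s h V \<Phi> R V'"
    using coords center remainder nbhd equation by unfold_locales simp_all
  then show ?thesis by (rule that)
qed

theorem theorem4p15:
  fixes M :: "('n::{finite,linorder}) amb set"
    and p :: "'n amb"
    and r s :: nat
    and h :: "'n \<Rightarrow> 'n \<Rightarrow> 'n \<Rightarrow> complex"
  assumes hyp: "real_hypersurface M"
    and pM: "p \<in> M"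
    and levi: "\<exists>U Lb c. open U \<and> p \<in> U \<and> CR_basis M U Lb \<and> char_form M U c \<and>
                 herm_inertia (\<lambda>\<alpha> \<beta>. Top (Lb \<alpha>) (thform c) (cnjv (Lb \<beta>)) p) r s"
    and rs: "r + s < CARD('n)"
    and hsym: "\<forall>\<alpha> \<beta> \<gamma>. r + s < pos \<gamma> \<longrightarrow> h \<alpha> \<beta> \<gamma> = h \<beta> \<alpha> \<gamma>"
  shows "(\<exists>U \<Phi> R. p \<in> U \<and> hol_coords U \<Phi> \<and> \<Phi> p = 0 \<and> weighted_vanish4 R \<and>
            (\<exists>U'. open U' \<and> p \<in> U' \<and> U' \<subseteq> U \<and>
                  M \<inter> U' = {x \<in> U'. rho_model r s h R (\<Phi> x) = 0}))
     \<longleftrightarrow>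
         (\<exists>U Lb c. open U \<and> p \<in> U \<and> CR_basis M U Lb \<and> char_form M U c \<and>
            (\<forall>\<alpha> \<beta>. Top (Lb \<alpha>) (thform c) (cnjv (Lb \<beta>)) p = gmat r s \<alpha> \<beta>) \<and>
            (\<forall>\<alpha> \<beta> \<gamma>. r + s < pos \<gamma> \<longrightarrow>
               Top (Lb \<alpha>) (Top (Lb \<beta>) (thform c)) (cnjv (Lb \<gamma>)) p = h \<alpha> \<beta> \<gamma>))"
    (is "?coordinates \<longleftrightarrow> ?frame")
proof
  assume ?coordinates
  then obtain U \<Phi> R U' where "hol_coords U \<Phi>" "\<Phi> p = 0" "weighted_vanish4 R" "open U'" "p \<in> U'" "U' \<subseteq> U"
    "M \<inter> U' = {x \<in> U'. rho_model r s h R (\<Phi> x) = 0}"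
    by blast
  then interpret normal_form M p r s h U \<Phi> R U' by (rule normal_form.intro)
  show ?frame using normalized_frame_exists[OF hsym] unfolding normalized_frame_def .
next
  assume ?frame
  then obtain V Lb c where "normalized_frame M p r s h V Lb c" unfolding normalized_frame_def by blast
  then obtain U \<Phi> R U' where "normal_form M p r s h U \<Phi> R U'" by (rule normal_form_if_normalized_frame[OF hyp pM])
  then interpret normal_form M p r s h U \<Phi> R U' .
  show ?coordinates using center_mem coords center remainder nbhd equation by blast
qed

end
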